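(* Let $d\ge3$. For each $N\ge 3$ let $Z_1,\dots,Z_{N^d}$ be the vertices of $\mathbb{T}_N$ ordered by entrance time, so that $\max_{x\in\mathbb{T}_N}H_x=H_{Z_1}>H_{Z_2}>\dots>H_{Z_{N^d}}$ ($P$-almost surely). Then for every $k\ge2$ (with $0<\delta\le\frac14$), $$\lim_{\delta\to0}\ \limsup_{N\to\infty}\ P\big[\exists\,1\le i<j\le k\text{ with }d(Z_i,Z_j)\le\delta N\big]=0.$$
   Context: $\mathbb{T}_N=(\mathbb{Z}/N\mathbb{Z})^d$, with $d(\cdot,\cdot)$ the distance on $\mathbb{T}_N$ induced by the Euclidean norm. $P$ is the law of continuous-time simple random walk $(Y_t)_{t\ge0}$ on $\mathbb{T}_N$ (jump rate $1$) started from the uniform distribution, and $H_x=\inf\{t\ge0:Y_t=x\}$. *)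

theory Defs
  imports "HOL-Probability.Probability"
begin

text \<open>The torus is represented by the residues \<open>{0..<N}\<close> in every coordinate.\<close>

definition torus :: "nat \<Rightarrow> (int ^ 'd::finite) set" where
  "torus N = {x. \<forall>i. 0 \<le> x $ i \<and> x $ i < int N}"

definition torus_proj :: "nat \<Rightarrow> int ^ 'd::finite \<Rightarrow> int ^ 'd" where
  "torus_proj N x = (\<chi> i. x $ i mod int N)"

text \<open>Quotient distance: the Euclidean norm minimised over the lifts of \<open>x - y\<close>.\<close>

definition torus_dist :: "nat \<Rightarrow> int ^ 'd::finite \<Rightarrow> int ^ 'd \<Rightarrow> real" where
  "torus_dist N x y =
     (INF z :: int ^ 'd. norm (\<chi> i. real_of_int (x $ i - y $ i + int N * z $ i)))"

definition unit_steps :: "(int ^ 'd::finite) set" where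
  "unit_steps = range (\<lambda>i. axis i 1) \<union> range (\<lambda>i. - axis i 1)"

text \<open>
  A sample \<open>(x, \<xi>, \<tau>)\<close> consists of the starting point, the successive steps and the successive
  holding times of the walk.  Under \<open>srw_space N\<close> all of these are independent, the starting point
  is uniform on the torus, the steps are uniform on the \<open>2d\<close> unit steps and the holding times are
  exponential with rate 1.
\<close>

type_synonym 'd srw_sample = "(int ^ 'd) \<times> (nat \<Rightarrow> int ^ 'd) \<times> (nat \<Rightarrow> real)"

definition srw_space :: "nat \<Rightarrow> ('d::finite) srw_sample measure" where
  "srw_space N =
     measure_pmf (pmf_of_set (torus N)) \<Otimes>\<^sub>M
     ((\<Pi>\<^sub>M n\<in>UNIV. measure_pmf (pmf_of_set unit_steps)) \<Otimes>\<^sub>M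
      (\<Pi>\<^sub>M n\<in>UNIV. density lborel (exponential_density 1)))"

definition jump_count :: "(nat \<Rightarrow> real) \<Rightarrow> real \<Rightarrow> nat" where
  "jump_count \<tau> t = (LEAST n. t < (\<Sum>m\<le>n. \<tau> m))"

definition walk :: "nat \<Rightarrow> real \<Rightarrow> ('d::finite) srw_sample \<Rightarrow> int ^ 'd" where
  "walk N t = (\<lambda>(x, \<xi>, \<tau>). torus_proj N (x + (\<Sum>m<jump_count \<tau> t. \<xi> m)))"

definition entrance_time :: "nat \<Rightarrow> int ^ 'd::finite \<Rightarrow> 'd srw_sample \<Rightarrow> ereal" where
  "entrance_time N x \<omega> = Inf (ereal ` {t. 0 \<le> t \<and> walk N t \<omega> = x})"

text \<open>
  \<open>last_visited N \<omega> i\<close> is the vertex \<open>Z\<^sub>i\<close>, for \<open>i\<close> in \<open>{1..N ^ d}\<close>; in particular \<open>Z\<^sub>1\<close> is the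
  last vertex to be entered.  Almost surely the entrance times are finite and distinct, so that
  exactly one enumeration of the torus (on \<open>{1..N ^ d}\<close>) is as required; on the remaining null
  set, and at indices outside \<open>{1..N ^ d}\<close>, the value is arbitrary.
\<close>

definition last_visited :: "nat \<Rightarrow> ('d::finite) srw_sample \<Rightarrow> nat \<Rightarrow> int ^ 'd" where
  "last_visited N \<omega> = (SOME z. bij_betw z {1..N ^ CARD('d)} (torus N) \<and>
     (\<forall>i\<in>{1..N ^ CARD('d)}. \<forall>j\<in>{1..N ^ CARD('d)}.
        i < j \<longrightarrow> entrance_time N (z i) \<omega> > entrance_time N (z j) \<omega>))"

text \<open>
  The events considered are measurable, so that \<^const>\<open>measure\<close> does not assign them the default
  value 0.  The key point is that the paths are right-continuous for every sample, which reduces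
  the infimum in \<^const>\<open>entrance_time\<close> to rational times.
\<close>

lemma jump_count_right_continuous:
  "\<exists>e>0. \<forall>u. t \<le> u \<and> u < t + e \<longrightarrow> jump_count \<tau> u = jump_count \<tau> t"
proof (cases "\<exists>n. t < (\<Sum>m\<le>n. \<tau> m)")
  case True
  define n where "n = jump_count \<tau> t"
  have n: "t < (\<Sum>m\<le>n. \<tau> m)"
    unfolding n_def jump_count_def using True by (rule LeastI_ex)
  have less: "\<not> t < (\<Sum>m\<le>k. \<tau> m)" if "k < n" for k
    using that unfolding n_def jump_count_def by (rule not_less_Least)
  have "jump_count \<tau> u = n" if "t \<le> u" "u < (\<Sum>m\<le>n. \<tau> m)" for u
    unfolding jump_count_def
  proof (rule Least_equality)
    fix k assume "u < (\<Sum>m\<le>k. \<tau> m)"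
    then show "n \<le> k" using less[of k] that by force
  qed (use that in auto)
  moreover have "t + ((\<Sum>m\<le>n. \<tau> m) - t) = (\<Sum>m\<le>n. \<tau> m)"
    by simp
  ultimately show ?thesis
    using n unfolding n_def by (metis diff_gt_0_iff_gt)
next
  case False
  have "jump_count \<tau> u = jump_count \<tau> t" if "t \<le> u" for u
  proof -
    have "\<not> u < (\<Sum>m\<le>n. \<tau> m)" "\<not> t < (\<Sum>m\<le>n. \<tau> m)" for n
      using False that by (meson order.strict_trans1)+
    then show ?thesis
      by (simp add: jump_count_def)
  qed
  then show ?thesis
    using zero_less_one by blast
qed

lemma entrance_time_less_iff:
  "entrance_time N x \<omega> < a \<longleftrightarrow> (\<exists>q\<in>{q\<in>\<rat>. 0 \<le> q \<and> ereal q < a}. walk N q \<omega> = x)"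
proof
  assume "entrance_time N x \<omega> < a"
  then obtain t where t: "0 \<le> t" "walk N t \<omega> = x" "ereal t < a"
    by (auto simp: entrance_time_def Inf_less_iff)
  obtain y \<xi> \<tau> where \<omega>: "\<omega> = (y, \<xi>, \<tau>)" by (metis prod_cases3)
  obtain e where e: "e > 0" "\<And>u. t \<le> u \<Longrightarrow> u < t + e \<Longrightarrow> jump_count \<tau> u = jump_count \<tau> t"
    using jump_count_right_continuous by metis
  obtain b where b: "t < b" "ereal b < a"
    using ereal_dense2[OF t(3)] by auto
  obtain q where q: "q \<in> \<rat>" "t < q" "q < min b (t + e)"
    using Rats_dense_in_real[of t "min b (t + e)"] b e by auto
  have "walk N q \<omega> = x"
    using t(2) e(2)[of q] q by (auto simp: walk_def \<omega>)
  moreover have "ereal q < a"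
    using q(3) b(2) by (meson less_ereal.simps(1) min_less_iff_conj order.strict_trans)
  ultimately show "\<exists>q\<in>{q\<in>\<rat>. 0 \<le> q \<and> ereal q < a}. walk N q \<omega> = x"
    using q t by auto
next
  assume "\<exists>q\<in>{q\<in>\<rat>. 0 \<le> q \<and> ereal q < a}. walk N q \<omega> = x"
  then show "entrance_time N x \<omega> < a"
    by (auto simp: entrance_time_def Inf_less_iff)
qed

lemma finite_torus: "finite (torus N :: (int ^ 'd::finite) set)"
proof (rule finite_imageD[of vec_nth])
  have "vec_nth ` (torus N :: (int ^ 'd) set) \<subseteq> (\<Pi>\<^sub>E i\<in>UNIV. {0..<int N})"
    by (auto simp: torus_def)
  then show "finite (vec_nth ` (torus N :: (int ^ 'd) set))"
    by (rule finite_subset) (intro finite_PiE, auto)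
qed (auto simp: inj_on_def vec_nth_inject)

lemma measurable_walk: "walk N t \<in> srw_space N \<rightarrow>\<^sub>M count_space (UNIV :: (int ^ 'd::finite) set)"
proof -
  have countable: "countable (UNIV :: (int ^ 'd) set)" by (rule countableI_type)
  have [measurable]: "(\<lambda>\<omega>. fst \<omega>) \<in> srw_space N \<rightarrow>\<^sub>M count_space (UNIV :: (int ^ 'd) set)"
    unfolding srw_space_def by (rule measurable_compose[OF measurable_fst]) simp
  have [measurable]: "(\<lambda>\<omega>. fst (snd \<omega>) m) \<in> srw_space N \<rightarrow>\<^sub>M count_space (UNIV :: (int ^ 'd) set)" for m
    unfolding srw_space_def
    by (rule measurable_compose[OF measurable_snd], rule measurable_compose[OF measurable_fst],
        rule measurable_compose[OF measurable_component_singleton]) auto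
  have [measurable]: "(\<lambda>\<omega> :: 'd srw_sample. snd (snd \<omega>) m) \<in> borel_measurable (srw_space N)" for m
    unfolding srw_space_def
    by (rule measurable_compose[OF measurable_snd], rule measurable_compose[OF measurable_snd],
        rule measurable_compose[OF measurable_component_singleton]) auto
  have [measurable]:
    "(\<lambda>\<omega> :: 'd srw_sample. jump_count (snd (snd \<omega>)) t) \<in> srw_space N \<rightarrow>\<^sub>M count_space UNIV"
    unfolding jump_count_def by measurable
  have [measurable]: "(\<lambda>\<omega>. fst \<omega> + (\<Sum>m<n. fst (snd \<omega>) m)) \<in>
      srw_space N \<rightarrow>\<^sub>M count_space (UNIV :: (int ^ 'd) set)" for n
  proof (induction n)
    case (Suc n)
    have "(\<lambda>\<omega>. (\<lambda>(a, b). a + b) (fst \<omega> + (\<Sum>m<n. fst (snd \<omega>) m), fst (snd \<omega>) n)) \<in>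
        srw_space N \<rightarrow>\<^sub>M count_space (UNIV :: (int ^ 'd) set)"
    proof (rule measurable_compose[where g = "\<lambda>(a, b). a + b"])
      show "(\<lambda>\<omega>. (fst \<omega> + (\<Sum>m<n. fst (snd \<omega>) m), fst (snd \<omega>) n)) \<in>
          srw_space N \<rightarrow>\<^sub>M count_space (UNIV :: (int ^ 'd) set) \<Otimes>\<^sub>M count_space UNIV"
        using Suc by measurable
    qed (simp add: pair_measure_countable[OF countable countable])
    then show ?case by (simp add: add.assoc)
  qed simp
  have "(\<lambda>\<omega>. torus_proj N (fst \<omega> + (\<Sum>m<jump_count (snd (snd \<omega>)) t. fst (snd \<omega>) m))) \<in>
      srw_space N \<rightarrow>\<^sub>M count_space (UNIV :: (int ^ 'd) set)"
  proof (rule measurable_compose_countable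
      [where f = "\<lambda>n \<omega>. torus_proj N (fst \<omega> + (\<Sum>m<n. fst (snd \<omega>) m))"
         and g = "\<lambda>\<omega>. jump_count (snd (snd \<omega>)) t"])
    show "(\<lambda>\<omega>. torus_proj N (fst \<omega> + (\<Sum>m<n. fst (snd \<omega>) m))) \<in>
      srw_space N \<rightarrow>\<^sub>M count_space (UNIV :: (int ^ 'd) set)" for n :: nat
      by (rule measurable_compose[where N = "count_space UNIV"]) measurable
  qed measurable
  then show ?thesis by (simp add: walk_def case_prod_unfold)
qed

lemma measurable_entrance_time:
  "entrance_time N x \<in> borel_measurable (srw_space N :: ('d::finite) srw_sample measure)"
proof (rule borel_measurableI_less)
  note [measurable] = measurable_walk
  fix a
  have "{\<omega> \<in> space (srw_space N). entrance_time N x \<omega> < a} =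
      (\<Union>q\<in>{q\<in>\<rat>. 0 \<le> q \<and> ereal q < a}. {\<omega> \<in> space (srw_space N). walk N q \<omega> = x})"
    by (auto simp: entrance_time_less_iff)
  also have "\<dots> \<in> sets (srw_space N)"
    by (intro sets.countable_UN' countable_subset[OF _ countable_rat]) auto
  finally show "{\<omega> \<in> space (srw_space N). entrance_time N x \<omega> < a} \<in> sets (srw_space N)" .
qed

lemma sets_last_visited:
  "{\<omega> \<in> space (srw_space N :: ('d::finite) srw_sample measure). Q (last_visited N \<omega>)}
     \<in> sets (srw_space N)"
proof -
  note [measurable] = measurable_entrance_time
  define T where "T = (torus N :: (int ^ 'd) set)"
  define R where "R \<omega> = {p \<in> T \<times> T. entrance_time N (fst p) \<omega> > entrance_time N (snd p) \<omega>}" for \<omega>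
  define L where "L r = (SOME z. bij_betw z {1..N ^ CARD('d)} T \<and>
     (\<forall>i\<in>{1..N ^ CARD('d)}. \<forall>j\<in>{1..N ^ CARD('d)}. i < j \<longrightarrow> (z i, z j) \<in> r))" for r
  have fin: "finite (T \<times> T)" by (simp add: T_def finite_torus)
  have L: "last_visited N \<omega> = L (R \<omega>)" for \<omega>
    unfolding last_visited_def L_def T_def[symmetric]
    by (rule arg_cong[where f = Eps]) (auto simp: fun_eq_iff R_def bij_betw_def)
  have eq: "{\<omega> \<in> space (srw_space N). R \<omega> = r} \<in> sets (srw_space N)" if "r \<subseteq> T \<times> T" for r
  proof -
    have "{\<omega> \<in> space (srw_space N). R \<omega> = r} = {\<omega> \<in> space (srw_space N). \<forall>p\<in>T \<times> T.
        p \<in> r \<longleftrightarrow> entrance_time N (fst p) \<omega> > entrance_time N (snd p) \<omega>}"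
      using that by (auto simp: R_def)
    also have "\<dots> \<in> sets (srw_space N)"
      by (rule sets.sets_Collect_finite_All[OF _ fin]) measurable
    finally show ?thesis .
  qed
  have "{\<omega> \<in> space (srw_space N). Q (last_visited N \<omega>)} =
      (\<Union>r\<in>{r \<in> Pow (T \<times> T). Q (L r)}. {\<omega> \<in> space (srw_space N). R \<omega> = r})"
    by (auto simp: L R_def)
  also have "\<dots> \<in> sets (srw_space N)"
    using fin eq by (intro sets.finite_UN) auto
  finally show ?thesis .
qed

end

theory Submission
  imports Defs "HOL-Real_Asymp.Real_Asymp"
begin

text \<open>
  Only the order in which the jump chain discovers the vertices matters. The chain killed on a set
  \<open>A\<close> is a self-adjoint operator. If \<open>h\<close> vanishes on \<open>A\<close> and \<open>h - P h = 1\<close> off \<open>A\<close>, with mean \<open>T\<close>,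
  then Cauchy-Schwarz for the Dirichlet form and the Poincare inequality with constant
  \<open>s = d\<^sup>2 N\<^sup>2\<close> bound its norm by \<open>1 - 1 / (T + s)\<close>, and \<open>h\<close> as a test function gives a lower bound
  of order \<open>1 - 1 / T\<close>. When \<open>A\<close> is \<open>{x}\<close> or \<open>{x, y}\<close>, \<open>h\<close> is explicit in terms of the Green function
  \<open>g\<close> of the torus, and with \<open>V = N\<^sup>d\<close> one finds \<open>T = V g(0)\<close> and \<open>T = V (g(0) + g(y - x)) / 2\<close>.

  As \<open>d \<ge> 3\<close>, \<open>s\<close> is much smaller than \<open>V / ln V\<close>, so after \<open>V g(0) ln (V / M)\<close> jumps the number of
  unvisited vertices has mean about \<open>M\<close> and, because \<open>g(y) = O(ln N / |y|)\<close> and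
  \<open>g(0) - g(y) \<ge> 1 / 2\<close> for \<open>y \<noteq> 0\<close>, second moment about \<open>M + M\<^sup>2\<close>. By Chebyshev fewer than \<open>k\<close>
  vertices are left with probability at most about \<open>M / (M - k)\<^sup>2\<close>; otherwise the last \<open>k\<close> vertices
  are among those left, and two of these lie within \<open>\<delta> N\<close> with probability at most about
  \<open>M\<^sup>2 (2 \<delta>)\<^sup>d\<close>. Let \<open>\<delta>\<close> tend to 0 and then \<open>M\<close> to infinity.
\<close>

section \<open>The Dirichlet form of the torus\<close>

text \<open>Functions on the torus are \<open>N\<close>-periodic functions on the full lattice,
  summed over one period, so that shifts need no reduction. The obstacle is precision. The second
  moment must agree with M^2 up to a factor tending to 1, so survival exponents of size ln V are
  needed with additive error o(1); a mean hitting time alone does not give this, while norm bounds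
  for the killed operator do, with relative error about s / T. Only even times occur: surviving 2n
  steps has as probability the normalised squared norm of n killed steps, which converts norm bounds
  in either direction into probability bounds. Pairs are split at distance (ln N)^3. Beyond it the
  decay 1 / |y|, obtained from a single summation by parts and weaker than the true rate for d > 3,
  makes the correlation negligible. Within it survival is only (M / V)^(1 + c) instead of (M / V)^2,
  but each vertex has just polylogarithmically many such partners, so the extra power c
  suffices.\<close>

definition periodic :: "nat \<Rightarrow> (int ^ 'd::finite \<Rightarrow> 'b) \<Rightarrow> bool" where
  "periodic N f \<longleftrightarrow> (\<forall>x. f (torus_proj N x) = f x)"

definition avg :: "(int ^ 'd::finite \<Rightarrow> real) \<Rightarrow> int ^ 'd \<Rightarrow> real" where
  "avg f x = (\<Sum>i\<in>UNIV. f (x + axis i 1) + f (x - axis i 1)) / (2 * real CARD('d))"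

text \<open>The Dirichlet form of the walk for counting measure rather than the uniform
  distribution; hence the volume factors in later bounds.\<close>

definition energy :: "nat \<Rightarrow> (int ^ 'd::finite \<Rightarrow> real) \<Rightarrow> (int ^ 'd \<Rightarrow> real) \<Rightarrow> real" where
  "energy N f g =
     (\<Sum>x\<in>torus N. \<Sum>i\<in>UNIV. (f (x + axis i 1) - f x) * (g (x + axis i 1) - g x)) / (2 * real CARD('d))"

text \<open>Transition operator of the walk killed on \<open>A\<close>. By
  \<open>steps_avoid\<close>, its powers applied to the indicator of the complement are avoidance
  probabilities.\<close>

definition kill :: "(int ^ 'd::finite) set \<Rightarrow> (int ^ 'd \<Rightarrow> real) \<Rightarrow> int ^ 'd \<Rightarrow> real" where
  "kill A f x = (if x \<in> A then 0 else avg f x)"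

lemma torus_proj_in_torus [simp]: "N > 0 \<Longrightarrow> torus_proj N x \<in> torus N"
  by (simp add: torus_def torus_proj_def)

lemma torus_proj_id: "x \<in> torus N \<Longrightarrow> torus_proj N x = x"
  by (simp add: torus_def torus_proj_def vec_eq_iff)

lemma torus_proj_add: "torus_proj N (torus_proj N x + y) = torus_proj N (x + y)"
  by (simp add: torus_proj_def vec_eq_iff mod_simps)

lemma torus_proj_eq_iff: "torus_proj N x = torus_proj N y \<longleftrightarrow> (\<forall>i. int N dvd x $ i - y $ i)"
  by (simp add: torus_proj_def vec_eq_iff mod_eq_dvd_iff)

lemma periodic_cong: "periodic N f \<Longrightarrow> torus_proj N x = torus_proj N y \<Longrightarrow> f x = f y"
  unfolding periodic_def by metis

lemma periodic_translate: "periodic N f \<Longrightarrow> periodic N (\<lambda>x. f (x + a))"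
  unfolding periodic_def by (metis torus_proj_add)

lemma periodic_diff: "periodic N f \<Longrightarrow> periodic N (\<lambda>x. f (x - a))"
  using periodic_translate[of N f "- a"] by simp

lemma periodic_map2: "periodic N f \<Longrightarrow> periodic N g \<Longrightarrow> periodic N (\<lambda>x. h (f x) (g x))"
  unfolding periodic_def by simp

lemma periodic_map: "periodic N f \<Longrightarrow> periodic N (\<lambda>x. h (f x))"
  unfolding periodic_def by simp

lemma periodic_const: "periodic N (\<lambda>x. c)"
  unfolding periodic_def by simp

lemma periodic_sum: "(\<And>i. i \<in> I \<Longrightarrow> periodic N (f i)) \<Longrightarrow> periodic N (\<lambda>x. \<Sum>i\<in>I. f i x)"
  unfolding periodic_def by (auto intro!: sum.cong)

lemmas periodic_intros = periodic_translate periodic_diff periodic_map2[where h = "(+)"]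
  periodic_map2[where h = "(-)"] periodic_map2[where h = "(*)"] periodic_map[where h = "\<lambda>x. x / c" for c]
  periodic_map[where h = "(*) c" for c]
  periodic_map[where h = "\<lambda>x. x ^ n" for n] periodic_map[where h = "abs"] periodic_const periodic_sum

lemma periodic_avg: "periodic N f \<Longrightarrow> periodic N (avg f)"
  unfolding avg_def[abs_def] by (intro periodic_intros)

lemma periodic_kill:
  assumes "periodic N f" "periodic N (\<lambda>x. x \<in> A)"
  shows "periodic N (kill A f)"
  using periodic_avg[OF assms(1)] assms(2) unfolding periodic_def kill_def by simp

lemma bij_betw_torus_translate:
  assumes "N > 0"
  shows "bij_betw (\<lambda>x. torus_proj N (x + a)) (torus N) (torus N)"
proof (rule bij_betw_byWitness[where f' = "\<lambda>x. torus_proj N (x - a)"])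
  show "\<forall>x\<in>torus N. torus_proj N (torus_proj N (x + a) - a) = x"
    using torus_proj_add[of N "x + a" "- a" for x] by (auto simp: torus_proj_id)
  show "\<forall>x\<in>torus N. torus_proj N (torus_proj N (x - a) + a) = x"
    by (auto simp: torus_proj_id torus_proj_add)
qed (use assms in auto)

lemma sum_torus_translate:
  assumes "periodic N f" "N > 0"
  shows "(\<Sum>x\<in>torus N. f (x + a)) = (\<Sum>x\<in>torus N. f x)"
proof -
  have "(\<Sum>x\<in>torus N. f (x + a)) = (\<Sum>x\<in>torus N. f (torus_proj N (x + a)))"
    using assms by (simp add: periodic_def)
  also have "\<dots> = (\<Sum>x\<in>torus N. f x)"
    by (rule sum.reindex_bij_betw[OF bij_betw_torus_translate[OF assms(2)]])
  finally show ?thesis .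
qed

lemma card_vec_product:
  fixes B :: "'d::finite \<Rightarrow> 'a set"
  assumes "\<And>i. finite (B i)"
  shows "card {x :: 'a ^ 'd. \<forall>i. x $ i \<in> B i} = (\<Prod>i\<in>UNIV. card (B i))"
proof -
  have "bij_betw vec_nth {x :: 'a ^ 'd. \<forall>i. x $ i \<in> B i} (\<Pi>\<^sub>E i\<in>UNIV. B i)"
    by (rule bij_betw_byWitness[where f' = vec_lambda]) auto
  then have "card {x :: 'a ^ 'd. \<forall>i. x $ i \<in> B i} = card (\<Pi>\<^sub>E i\<in>UNIV. B i)"
    by (rule bij_betw_same_card)
  then show ?thesis by (simp add: card_PiE)
qed

lemma card_torus: "card (torus N :: (int ^ 'd::finite) set) = N ^ CARD('d)"
proof -
  have "torus N = {x :: int ^ 'd. \<forall>i. x $ i \<in> {0..<int N}}"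
    by (auto simp: torus_def)
  then show ?thesis
    using card_vec_product[of "\<lambda>_. {0..<int N}"] by simp
qed

lemma sum_torus_shift_mult:
  fixes f g :: "int ^ 'd::finite \<Rightarrow> real"
  assumes f: "periodic N f" and g: "periodic N g" and "N > 0"
  shows "(\<Sum>x\<in>torus N. f x * g (x - a)) = (\<Sum>x\<in>torus N. f (x + a) * g x)"
  using sum_torus_translate[of N "\<lambda>x. f x * g (x - a)" a] assms
  by (simp add: periodic_intros)

text \<open>Green's identity: expand the product of increments; translation invariance returns the
  shifted square term to x and moves a shift from one factor to the other.\<close>

lemma sum_torus_green:
  fixes f g :: "int ^ 'd::finite \<Rightarrow> real"
  assumes f: "periodic N f" and g: "periodic N g" and N: "N > 0"
  shows "(\<Sum>x\<in>torus N. f x * (g x - avg g x)) = energy N f g"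
proof -
  have *: "(\<Sum>x\<in>torus N. (f (x + axis i 1) - f x) * (g (x + axis i 1) - g x)) =
     (\<Sum>x\<in>torus N. 2 * (f x * g x) - f x * (g (x + axis i 1) + g (x - axis i 1)))" for i
  proof -
    have "(\<Sum>x\<in>torus N. f (x + axis i 1) * g (x + axis i 1)) = (\<Sum>x\<in>torus N. f x * g x)"
      by (rule sum_torus_translate[of N "\<lambda>x. f x * g x"]) (intro periodic_intros f g, rule N)
    moreover have "(\<Sum>x\<in>torus N. f x * g (x - axis i 1)) = (\<Sum>x\<in>torus N. f (x + axis i 1) * g x)"
      by (rule sum_torus_shift_mult[OF f g N])
    ultimately show ?thesis
      by (simp add: algebra_simps sum.distrib sum_subtractf sum_distrib_left)
  qed
  have "energy N f g = (\<Sum>i\<in>UNIV. \<Sum>x\<in>torus N. 2 * (f x * g x) - f x * (g (x + axis i 1) + g (x - axis i 1))) / (2 * real CARD('d))"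
    unfolding energy_def by (subst sum.swap) (simp add: *)
  also have "\<dots> = (\<Sum>x\<in>torus N. (\<Sum>i\<in>UNIV. 2 * (f x * g x) - f x * (g (x + axis i 1) + g (x - axis i 1))) / (2 * real CARD('d)))"
    by (subst sum.swap) (simp add: sum_divide_distrib)
  also have "\<dots> = (\<Sum>x\<in>torus N. f x * (g x - avg g x))"
    by (intro sum.cong) (auto simp: avg_def sum_subtractf right_diff_distrib diff_divide_distrib simp flip: sum_distrib_left)
  finally show ?thesis by simp
qed

lemma energy_commute: "energy N f g = energy N g f"
  by (simp add: energy_def mult.commute)

lemma energy_nonneg: "energy N f f \<ge> 0"
  by (auto simp: energy_def intro!: divide_nonneg_pos sum_nonneg)

lemma energy_Cauchy_Schwarz:
  fixes f g :: "int ^ 'd::finite \<Rightarrow> real"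
  shows "(energy N f g)\<^sup>2 \<le> energy N f f * energy N g g"
proof -
  let ?F = "\<lambda>(x, i). f (x + axis i 1) - f x" and ?G = "\<lambda>(x, i). g (x + axis i 1) - g x"
  let ?S = "torus N \<times> (UNIV :: 'd set)"
  have e: "energy N u v = (\<Sum>p\<in>?S. (\<lambda>(x, i). u (x + axis i 1) - u x) p * (\<lambda>(x, i). v (x + axis i 1) - v x) p) / (2 * real CARD('d))"
    for u v :: "int ^ 'd \<Rightarrow> real"
    by (simp add: energy_def sum.cartesian_product case_prod_unfold)
  have "(\<Sum>p\<in>?S. ?F p * ?G p)\<^sup>2 \<le> (\<Sum>p\<in>?S. (?F p)\<^sup>2) * (\<Sum>p\<in>?S. (?G p)\<^sup>2)"
    by (rule Cauchy_Schwarz_ineq_sum)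
  then show ?thesis
    unfolding e by (simp add: power2_eq_square divide_right_mono)
qed

text \<open>
  Poincare inequality: translations are compared in \<open>L\<^sup>2\<close>, where translating by \<open>z\<close> costs at
  most \<open>N\<close> unit translations in each direction; averaging over \<open>z\<close> gives the variance.
\<close>

lemma L2_translate_subadd:
  fixes f :: "int ^ 'd::finite \<Rightarrow> real"
  assumes f: "periodic N f" and N: "N > 0"
  shows "L2_set (\<lambda>x. f (x + (a + b)) - f x) (torus N) \<le>
    L2_set (\<lambda>x. f (x + a) - f x) (torus N) + L2_set (\<lambda>x. f (x + b) - f x) (torus N)"
proof -
  have "L2_set (\<lambda>x. f (x + (a + b)) - f x) (torus N) =
      L2_set (\<lambda>x. (f (x + a + b) - f (x + b)) + (f (x + b) - f x)) (torus N)"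
    by (simp add: add.commute add.left_commute add.assoc)
  also have "\<dots> = L2_set (\<lambda>x. (f (x + b + a) - f (x + b)) + (f (x + b) - f x)) (torus N)"
    by (simp add: add.commute add.left_commute add.assoc)
  also have "\<dots> \<le> L2_set (\<lambda>x. f (x + b + a) - f (x + b)) (torus N) + L2_set (\<lambda>x. f (x + b) - f x) (torus N)"
    by (rule L2_set_triangle_ineq)
  also have "L2_set (\<lambda>x. f (x + b + a) - f (x + b)) (torus N) = L2_set (\<lambda>x. f (x + a) - f x) (torus N)"
    unfolding L2_set_def
    by (subst sum_torus_translate[of N "\<lambda>x. (f (x + a) - f x)\<^sup>2" b]) (intro periodic_intros f, simp_all add: N)
  finally show ?thesis .
qed

lemma L2_translate_axis:
  fixes f :: "int ^ 'd::finite \<Rightarrow> real"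
  assumes f: "periodic N f" and N: "N > 0"
  shows "L2_set (\<lambda>x. f (x + axis i (int k)) - f x) (torus N) \<le>
    real k * L2_set (\<lambda>x. f (x + axis i 1) - f x) (torus N)"
proof (induction k)
  case 0
  have "axis i (0::int) = (0 :: int ^ 'd)" by (simp add: axis_def vec_eq_iff)
  then show ?case unfolding of_nat_0 by (simp only: L2_set_def) simp
next
  case (Suc k)
  have "axis i (int (Suc k)) = axis i (int k) + (axis i 1 :: int ^ 'd)"
    by (simp add: axis_def vec_eq_iff)
  with L2_translate_subadd[OF f N, of "axis i (int k)" "axis i 1"] Suc
  show ?case by (simp add: algebra_simps)
qed

lemma L2_translate_le:
  fixes f :: "int ^ 'd::finite \<Rightarrow> real"
  assumes f: "periodic N f" and N: "N > 0" and z: "z \<in> torus N"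
  shows "L2_set (\<lambda>x. f (x + z) - f x) (torus N) \<le>
    real N * (\<Sum>i\<in>UNIV. L2_set (\<lambda>x. f (x + axis i 1) - f x) (torus N))"
proof -
  have "L2_set (\<lambda>x. f (x + (\<Sum>i\<in>I. axis i (z $ i))) - f x) (torus N) \<le>
    (\<Sum>i\<in>I. real N * L2_set (\<lambda>x. f (x + axis i 1) - f x) (torus N))" if "finite I" for I :: "'d set"
    using that
  proof (induction I)
    case empty
    then show ?case by (simp add: L2_set_def)
  next
    case (insert j I)
    have zj: "0 \<le> z $ j" "z $ j < int N" using z by (auto simp: torus_def)
    have "L2_set (\<lambda>x. f (x + axis j (z $ j)) - f x) (torus N) \<le>
        real (nat (z $ j)) * L2_set (\<lambda>x. f (x + axis j 1) - f x) (torus N)"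
      using L2_translate_axis[OF f N, of j "nat (z $ j)"] zj by simp
    also have "\<dots> \<le> real N * L2_set (\<lambda>x. f (x + axis j 1) - f x) (torus N)"
      by (intro mult_right_mono) (use zj in auto)
    finally show ?case
      using L2_translate_subadd[OF f N, of "axis j (z $ j)" "\<Sum>i\<in>I. axis i (z $ i)"] insert by simp
  qed
  from this[of UNIV] have "L2_set (\<lambda>x. f (x + (\<Sum>i\<in>UNIV. axis i (z $ i))) - f x) (torus N) \<le>
    real N * (\<Sum>i\<in>UNIV. L2_set (\<lambda>x. f (x + axis i 1) - f x) (torus N))"
    by (simp add: sum_distrib_left)
  moreover have "(\<Sum>i\<in>UNIV. axis i (z $ i)) = z"
    by (simp add: vec_eq_iff axis_def if_distrib cong: if_cong)
  ultimately show ?thesis by simp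
qed

lemma torus_Poincare:
  fixes f :: "int ^ 'd::finite \<Rightarrow> real"
  assumes f: "periodic N f" and N: "N > 0"
  shows "real (N ^ CARD('d)) * (\<Sum>x\<in>torus N. (f x)\<^sup>2) - (\<Sum>x\<in>torus N. f x)\<^sup>2 \<le>
     real (N ^ CARD('d)) * (real CARD('d) * real N)\<^sup>2 * energy N f f"
proof -
  define V where "V = real (N ^ CARD('d))"
  define d where "d = real CARD('d)"
  have d: "d > 0" by (simp add: d_def)
  have cV: "real (card (torus N :: (int ^ 'd) set)) = V"
    by (simp add: card_torus V_def)
  define q where "q i = L2_set (\<lambda>x. f (x + axis i 1) - f x) (torus N)" for i
  have q2: "(q i)\<^sup>2 = (\<Sum>x\<in>torus N. (f (x + axis i 1) - f x)\<^sup>2)" for i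
    by (simp add: q_def L2_set_def sum_nonneg)
  have E: "2 * d * energy N f f = (\<Sum>i\<in>UNIV. (q i)\<^sup>2)"
    unfolding energy_def q2 by (subst sum.swap) (simp add: d_def power2_eq_square)
  have qsum: "(\<Sum>i\<in>UNIV. q i)\<^sup>2 \<le> d * (\<Sum>i\<in>UNIV. (q i)\<^sup>2)"
    using Cauchy_Schwarz_ineq_sum[of "\<lambda>_. 1" q "UNIV :: 'd set"] by (simp add: d_def)
  \<comment> \<open>Cauchy-Schwarz over the d directions gives one factor d, \<open>E\<close> gives
    2 d. The 2 cancels against the 2 in \<open>z2\<close>.\<close>
  have z: "(\<Sum>x\<in>torus N. (f (x + z) - f x)\<^sup>2) \<le> 2 * (d * real N)\<^sup>2 * energy N f f" if "z \<in> torus N" for z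
  proof -
    have "(\<Sum>x\<in>torus N. (f (x + z) - f x)\<^sup>2) = (L2_set (\<lambda>x. f (x + z) - f x) (torus N))\<^sup>2"
      by (simp add: L2_set_def sum_nonneg)
    also have "\<dots> \<le> (real N * (\<Sum>i\<in>UNIV. q i))\<^sup>2"
      using L2_translate_le[OF f N that] unfolding q_def by (intro power_mono) auto
    also have "\<dots> \<le> (real N)\<^sup>2 * (d * (2 * d * energy N f f))"
      using qsum unfolding E by (simp add: power_mult_distrib mult_left_mono)
    finally show ?thesis by (simp add: power2_eq_square mult_ac)
  qed
  have z2: "(\<Sum>x\<in>torus N. (f (x + z) - f x)\<^sup>2) =
      2 * (\<Sum>x\<in>torus N. (f x)\<^sup>2) - 2 * (\<Sum>x\<in>torus N. f x * f (x + z))" for z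
  proof -
    have "(\<Sum>x\<in>torus N. (f (x + z))\<^sup>2) = (\<Sum>x\<in>torus N. (f x)\<^sup>2)"
      by (rule sum_torus_translate[of N "\<lambda>x. (f x)\<^sup>2"]) (intro periodic_intros f, rule N)
    then show ?thesis
      by (simp add: power2_diff sum.distrib sum_subtractf sum_distrib_left algebra_simps)
  qed
  \<comment> \<open>Summing the correlation over all translations decouples its two factors.\<close>
  have "(\<Sum>z\<in>torus N. \<Sum>x\<in>torus N. f x * f (x + z)) = (\<Sum>x\<in>torus N. f x * (\<Sum>z\<in>torus N. f (z + x)))"
    by (subst sum.swap) (simp add: sum_distrib_left add.commute)
  also have "\<dots> = (\<Sum>x\<in>torus N. f x)\<^sup>2"
    by (simp add: sum_torus_translate[OF f N] power2_eq_square sum_distrib_right)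
  finally have zz: "(\<Sum>z\<in>torus N. \<Sum>x\<in>torus N. f x * f (x + z)) = (\<Sum>x\<in>torus N. f x)\<^sup>2" .
  have "(\<Sum>z\<in>torus N. \<Sum>x\<in>torus N. (f (x + z) - f x)\<^sup>2) =
      2 * (V * (\<Sum>x\<in>torus N. (f x)\<^sup>2) - (\<Sum>x\<in>torus N. f x)\<^sup>2)"
    unfolding z2 sum_subtractf by (simp add: cV zz flip: sum_distrib_left)
  moreover have "(\<Sum>z\<in>torus N. \<Sum>x\<in>torus N. (f (x + z) - f x)\<^sup>2) \<le> V * (2 * (d * real N)\<^sup>2 * energy N f f)"
    unfolding cV[symmetric] by (rule sum_bounded_above[OF z])
  ultimately show ?thesis
    unfolding V_def[symmetric] d_def[symmetric] by (simp add: algebra_simps)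
qed

section \<open>The walk killed on a set\<close>

lemma sum_torus_kill:
  assumes "\<And>x. x \<in> A \<Longrightarrow> f x = 0"
  shows "(\<Sum>x\<in>torus N. f x * kill A g x) = (\<Sum>x\<in>torus N. f x * avg g x)"
  by (intro sum.cong) (auto simp: kill_def assms)

text \<open>Against a function vanishing on \<open>A\<close> the killing is invisible, so symmetry
  is inherited from \<open>energy\<close>.\<close>

lemma kill_self_adjoint:
  assumes f: "periodic N f" and g: "periodic N g" and N: "N > 0"
    and f0: "\<And>x. x \<in> A \<Longrightarrow> f x = 0" and g0: "\<And>x. x \<in> A \<Longrightarrow> g x = 0"
  shows "(\<Sum>x\<in>torus N. f x * kill A g x) = (\<Sum>x\<in>torus N. kill A f x * g x)"
proof -
  have "(\<Sum>x\<in>torus N. f x * (g x - avg g x)) = (\<Sum>x\<in>torus N. g x * (f x - avg f x))"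
    by (simp add: sum_torus_green[OF f g N] sum_torus_green[OF g f N] energy_commute)
  then have "(\<Sum>x\<in>torus N. f x * avg g x) = (\<Sum>x\<in>torus N. g x * avg f x)"
    by (simp add: right_diff_distrib sum_subtractf mult.commute)
  moreover have "(\<Sum>x\<in>torus N. kill A f x * g x) = (\<Sum>x\<in>torus N. g x * kill A f x)"
    by (simp add: mult.commute)
  ultimately show ?thesis
    by (simp add: sum_torus_kill[of A f, OF f0] sum_torus_kill[of A g, OF g0])
qed

lemma periodic_off: "periodic N (\<lambda>x. x \<in> A) \<Longrightarrow> periodic N (\<lambda>x. if x \<in> A then 0 else (1::real))"
  by (simp add: periodic_def)

lemma kill_add: "kill A (\<lambda>x. f x + g x) = (\<lambda>x. kill A f x + kill A g x)"
  by (auto simp: kill_def avg_def fun_eq_iff sum.distrib add_divide_distrib)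

lemma kill_cmult: "kill A (\<lambda>x. c * f x) = (\<lambda>x. c * kill A f x)"
  by (auto simp: kill_def avg_def fun_eq_iff sum_distrib_left algebra_simps)

lemma funpow_kill_periodic:
  "periodic N f \<Longrightarrow> periodic N (\<lambda>x. x \<in> A) \<Longrightarrow> periodic N ((kill A ^^ n) f)"
  by (induction n) (auto intro: periodic_kill)

lemma funpow_kill_zero:
  "(\<And>x. x \<in> A \<Longrightarrow> f x = 0) \<Longrightarrow> x \<in> A \<Longrightarrow> (kill A ^^ n) f x = 0"
  by (induction n) (auto simp: kill_def)

lemma funpow_kill_add: "(kill A ^^ n) (\<lambda>x. f x + g x) = (\<lambda>x. (kill A ^^ n) f x + (kill A ^^ n) g x)"
  by (induction n) (auto simp: kill_add)

lemma funpow_kill_cmult: "(kill A ^^ n) (\<lambda>x. c * f x) = (\<lambda>x. c * (kill A ^^ n) f x)"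
  by (induction n) (auto simp: kill_cmult)

text \<open>By \<open>measure_avoid\<close>, the probability that the jump chain with uniform start
  avoids \<open>A\<close> at times 0 to \<open>n\<close>.\<close>

definition survival :: "nat \<Rightarrow> (int ^ 'd::finite) set \<Rightarrow> nat \<Rightarrow> real" where
  "survival N A n = (\<Sum>x\<in>torus N. (kill A ^^ n) (\<lambda>x. if x \<in> A then 0 else 1) x) / real (N ^ CARD('d))"

text \<open>\<open>h\<close> is the expected hitting time of \<open>A\<close>; only the equations it solves are needed.\<close>

locale killed_walk =
  fixes N :: nat and A :: "(int ^ 'd::finite) set" and h :: "int ^ 'd \<Rightarrow> real"
  assumes N: "N > 0"
    and A: "periodic N (\<lambda>x. x \<in> A)"
    and h: "periodic N h"
    and h0: "\<And>x. x \<in> A \<Longrightarrow> h x = 0"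
    and h1: "\<And>x. x \<notin> A \<Longrightarrow> h x - avg h x = 1"
begin

definition V :: real where "V = real (N ^ CARD('d))"
text \<open>The constant of \<open>torus_Poincare\<close>, called \<open>s\<close> in the later
  estimates. \<open>T\<close> below is the mean hitting time from a uniform start.\<close>

definition \<tau> :: real where "\<tau> = (real CARD('d) * real N)\<^sup>2"
definition T :: real where "T = (\<Sum>x\<in>torus N. h x) / V"

lemma V_pos: "V > 0" using N by (simp add: V_def)

lemma \<tau>_ge_1: "\<tau> \<ge> 1"
proof -
  have "1 \<le> real CARD('d)" "1 \<le> real N" using N by (simp_all add: Suc_leI)
  then have "1 * 1 \<le> real CARD('d) * real N" by (intro mult_mono) auto
  then show ?thesis by (simp add: \<tau>_def)
qed

lemma card_torus_V: "real (card (torus N :: (int ^ 'd) set)) = V"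
  by (simp add: V_def card_torus)

text \<open>The equation for \<open>h\<close> is known only off \<open>A\<close>, and a function
  vanishing on \<open>A\<close> tests it only there. With \<open>h\<close> itself this evaluates its
  energy.\<close>

lemma energy_h:
  assumes "periodic N f" "\<And>x. x \<in> A \<Longrightarrow> f x = 0"
  shows "energy N f h = (\<Sum>x\<in>torus N. f x)"
proof -
  have "(\<Sum>x\<in>torus N. f x * (h x - avg h x)) = (\<Sum>x\<in>torus N. f x)"
    using assms(2) h1 by (intro sum.cong) fastforce+
  then show ?thesis
    by (simp add: sum_torus_green[OF assms(1) h N])
qed

lemma sum_h: "(\<Sum>x\<in>torus N. h x) = V * T"
  using V_pos by (simp add: T_def)

lemma energy_hh: "energy N h h = V * T"
  using energy_h[OF h h0] by (simp add: sum_h)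

lemma T_nonneg: "T \<ge> 0"
  using energy_hh energy_nonneg[of N h] V_pos by (simp add: zero_le_mult_iff)

text \<open>The sum of squares splits into the squared mean, controlled by Cauchy-Schwarz against
  \<open>h\<close>, and the variance, controlled by Poincare.\<close>

lemma Rayleigh:
  assumes f: "periodic N f" and f0: "\<And>x. x \<in> A \<Longrightarrow> f x = 0"
  shows "(\<Sum>x\<in>torus N. (f x)\<^sup>2) \<le> (T + \<tau>) * energy N f f"
proof -
  have "(\<Sum>x\<in>torus N. f x)\<^sup>2 \<le> V * T * energy N f f"
    using energy_Cauchy_Schwarz[of N f h] energy_h[OF f f0] by (simp add: energy_hh mult_ac)
  moreover have "V * (\<Sum>x\<in>torus N. (f x)\<^sup>2) - (\<Sum>x\<in>torus N. f x)\<^sup>2 \<le> V * \<tau> * energy N f f"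
    using torus_Poincare[OF f N] by (simp add: V_def \<tau>_def)
  ultimately have "V * (\<Sum>x\<in>torus N. (f x)\<^sup>2) \<le> V * ((T + \<tau>) * energy N f f)"
    by (simp add: algebra_simps)
  then show ?thesis using V_pos by simp
qed

definition b :: real where "b = 1 - 1 / (T + \<tau>)"

lemma kill_form_le:
  assumes f: "periodic N f" and f0: "\<And>x. x \<in> A \<Longrightarrow> f x = 0"
  shows "(\<Sum>x\<in>torus N. f x * kill A f x) \<le> b * (\<Sum>x\<in>torus N. (f x)\<^sup>2)"
proof -
  have pos: "T + \<tau> > 0" using T_nonneg \<tau>_ge_1 by simp
  have k: "(\<Sum>x\<in>torus N. f x * kill A f x) = (\<Sum>x\<in>torus N. f x * avg f x)"
    by (rule sum_torus_kill) (rule f0)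
  have "(\<Sum>x\<in>torus N. f x * kill A f x) = (\<Sum>x\<in>torus N. (f x)\<^sup>2) - energy N f f"
    unfolding k sum_torus_green[OF f f N, symmetric]
    by (simp add: right_diff_distrib sum_subtractf power2_eq_square)
  moreover have "(\<Sum>x\<in>torus N. (f x)\<^sup>2) / (T + \<tau>) \<le> energy N f f"
    using Rayleigh[OF f f0] pos by (simp add: pos_divide_le_eq mult.commute)
  ultimately show ?thesis by (simp add: b_def algebra_simps)
qed

text \<open>Controls the negative spectrum: the kernel of \<open>kill A\<close> is nonnegative, so
  passing to the absolute value of f only enlarges the form. For even \<open>N\<close> the torus is
  bipartite and negative eigenvalues are as large in modulus as positive ones.\<close>

lemma kill_form_abs_le:
  assumes f: "periodic N f" and f0: "\<And>x. x \<in> A \<Longrightarrow> f x = 0"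
  shows "\<bar>\<Sum>x\<in>torus N. f x * kill A f x\<bar> \<le> b * (\<Sum>x\<in>torus N. (f x)\<^sup>2)"
proof -
  have k: "\<bar>kill A f x\<bar> \<le> kill A (\<lambda>x. \<bar>f x\<bar>) x" for x
    by (auto simp: kill_def avg_def abs_mult intro!: divide_right_mono order.trans[OF sum_abs] sum_mono)
  have "\<bar>\<Sum>x\<in>torus N. f x * kill A f x\<bar> \<le> (\<Sum>x\<in>torus N. \<bar>f x\<bar> * kill A (\<lambda>x. \<bar>f x\<bar>) x)"
    by (intro order.trans[OF sum_abs] sum_mono) (simp add: abs_mult mult_left_mono k)
  also have "\<dots> \<le> b * (\<Sum>x\<in>torus N. \<bar>f x\<bar>\<^sup>2)"
    by (rule kill_form_le[OF periodic_map[OF f]]) (simp add: f0)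
  finally show ?thesis by simp
qed

lemma kill_contraction:
  assumes f: "periodic N f" and f0: "\<And>x. x \<in> A \<Longrightarrow> f x = 0" and b: "b > 0"
  shows "L2_set (kill A f) (torus N) \<le> b * L2_set f (torus N)"
proof -
  \<comment> \<open>Polarisation: bound the bilinear form at \<open>(g, kill A f)\<close>, with \<open>g\<close> the rescaled image of \<open>f\<close>.\<close>
  define g where "g = (\<lambda>x. (1 / b) * kill A f x)"
  have g: "periodic N g" unfolding g_def by (rule periodic_map[OF periodic_kill[OF f A], where h = "(*) (1 / b)"])
  have fg: "periodic N (\<lambda>x. f x + g x)" "periodic N (\<lambda>x. f x - g x)"
    by (rule periodic_map2[OF f g])+
  have g0: "x \<in> A \<Longrightarrow> g x = 0" for x by (simp add: g_def kill_def)
  define S where "S u v = (\<Sum>x\<in>torus N. u x * v x)" for u v :: "int ^ 'd \<Rightarrow> real"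
  have sub: "kill A (\<lambda>x. f x - g x) = (\<lambda>x. kill A f x - kill A g x)"
    using kill_add[of A f "\<lambda>x. (-1) * g x"] kill_cmult[of A "-1" g] by simp
  define F G K where "F = (\<Sum>x\<in>torus N. (f x)\<^sup>2)" and "G = (\<Sum>x\<in>torus N. (g x)\<^sup>2)"
    and "K = (\<Sum>x\<in>torus N. (kill A f x)\<^sup>2)"
  define X Y where "X = S (\<lambda>x. f x + g x) (kill A (\<lambda>x. f x + g x))"
    and "Y = S (\<lambda>x. f x - g x) (kill A (\<lambda>x. f x - g x))"
  have sa: "S f (kill A g) = S g (kill A f)"
    using kill_self_adjoint[OF f g N, of A] f0 g0 unfolding S_def by (simp add: mult.commute)
  have "X = S f (kill A f) + S f (kill A g) + S g (kill A f) + S g (kill A g)"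
    unfolding X_def S_def kill_add by (simp add: distrib_left distrib_right sum.distrib)
  moreover have "Y = S f (kill A f) - S f (kill A g) - S g (kill A f) + S g (kill A g)"
    unfolding Y_def S_def sub by (simp add: left_diff_distrib right_diff_distrib sum_subtractf)
  ultimately have pol: "4 * S g (kill A f) = X - Y"
    using sa by simp
  define P Q where "P = (\<Sum>x\<in>torus N. (f x + g x)\<^sup>2)" and "Q = (\<Sum>x\<in>torus N. (f x - g x)\<^sup>2)"
  have "X \<le> b * P"
    unfolding X_def S_def P_def by (rule kill_form_le[OF fg(1)]) (simp add: f0 g0)
  \<comment> \<open>\<open>Y\<close> enters the polarisation with a minus sign, so a lower bound for
    the form is required here.\<close>
  moreover have "\<bar>Y\<bar> \<le> b * Q"
    unfolding Y_def S_def Q_def by (rule kill_form_abs_le[OF fg(2)]) (simp add: f0 g0)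
  moreover have PQ: "P + Q = 2 * F + 2 * G"
    unfolding F_def G_def P_def Q_def sum_distrib_left sum.distrib[symmetric]
    by (intro sum.cong refl) (simp add: power2_eq_square algebra_simps)
  have bPQ: "b * P + b * Q = b * (2 * F + 2 * G)"
    unfolding PQ[symmetric] by (rule distrib_left[symmetric])
  ultimately have "4 * S g (kill A f) \<le> b * (2 * F + 2 * G)"
    unfolding pol bPQ[symmetric] by linarith
  moreover have "S g (kill A f) = K / b"
    by (simp add: S_def g_def K_def sum_divide_distrib power2_eq_square)
  moreover have "G = K / b\<^sup>2"
    by (simp add: g_def G_def K_def sum_divide_distrib power_divide)
  \<comment> \<open>With \<open>g\<close> scaled by 1 / b, multiplying through by b^2 turns the
    inequality into 4 K <= 2 b^2 F + 2 K.\<close>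
  ultimately have "b * (4 * (K / b)) \<le> b * (b * (2 * F + 2 * (K / b\<^sup>2)))"
    using b by (intro mult_left_mono) auto
  also have "b * (b * (2 * F + 2 * (K / b\<^sup>2))) = 2 * (b\<^sup>2 * F) + 2 * K"
    using b by (simp add: distrib_left power2_eq_square)
  finally have "K \<le> b\<^sup>2 * F" using b by simp
  then have "sqrt K \<le> sqrt (b\<^sup>2 * F)"
    by (rule real_sqrt_le_mono)
  then show ?thesis
    using b by (simp add: L2_set_def real_sqrt_mult K_def F_def)
qed

lemma funpow_kill_contraction:
  assumes f: "periodic N f" and f0: "\<And>x. x \<in> A \<Longrightarrow> f x = 0" and b: "b > 0"
  shows "L2_set ((kill A ^^ n) f) (torus N) \<le> b ^ n * L2_set f (torus N)"
proof (induction n)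
  case (Suc n)
  have "L2_set ((kill A ^^ Suc n) f) (torus N) \<le> b * L2_set ((kill A ^^ n) f) (torus N)"
    using kill_contraction[OF funpow_kill_periodic[OF f A] funpow_kill_zero[of A f, OF f0] b] by simp
  also have "\<dots> \<le> b * (b ^ n * L2_set f (torus N))"
    using Suc b by (intro mult_left_mono) auto
  finally show ?case by simp
qed simp

lemma sum_mult_le_L2_set: "(\<Sum>x\<in>X. f x * g x) \<le> L2_set f X * L2_set g X"
  by (rule order.trans[OF sum_mono L2_set_mult_ineq]) (metis abs_ge_self abs_mult)

text \<open>By self-adjointness and Cauchy-Schwarz the norms of the iterates are log-convex, so
  their successive ratios increase. It suffices that the first ratio is at least 1 - 1 / T, which
  testing with \<open>h\<close> shows.\<close>

lemma funpow_kill_h_ge: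
  assumes T: "T \<ge> 1"
  shows "(1 - 1 / T) ^ n * L2_set h (torus N) \<le> L2_set ((kill A ^^ n) h) (torus N)"
proof -
  define u where "u n = L2_set ((kill A ^^ n) h) (torus N)" for n
  define q where "q = 1 - 1 / T"
  have q: "q \<ge> 0" using T by (simp add: q_def)
  have u_nonneg: "u n \<ge> 0" for n by (simp add: u_def)
  have u2: "(u n)\<^sup>2 = (\<Sum>x\<in>torus N. ((kill A ^^ n) h x)\<^sup>2)" for n
    by (simp add: u_def L2_set_def sum_nonneg)
  have "V * (u 0)\<^sup>2 \<ge> (V * T)\<^sup>2"
    using Cauchy_Schwarz_ineq_sum[of "\<lambda>_. 1" h "torus N"] by (simp add: sum_h card_torus_V u2)
  then have u0: "(u 0)\<^sup>2 \<ge> V * T\<^sup>2"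
    using V_pos by (simp add: power2_eq_square mult_ac)
  have u0pos: "u 0 > 0"
  proof -
    have "V * T\<^sup>2 > 0" using V_pos T by simp
    with u0 have "(u 0)\<^sup>2 > 0" by linarith
    then show ?thesis using u_nonneg[of 0] by simp
  qed
  have k: "(\<Sum>x\<in>torus N. h x * kill A h x) = (\<Sum>x\<in>torus N. h x * avg h x)"
    by (rule sum_torus_kill) (rule h0)
  have "(u 0)\<^sup>2 - V * T = (\<Sum>x\<in>torus N. h x * kill A h x)"
    unfolding k u2 using sum_torus_green[OF h h N]
    by (simp add: right_diff_distrib sum_subtractf energy_hh power2_eq_square)
  also have "\<dots> \<le> u 0 * u 1"
    unfolding u_def by (simp add: sum_mult_le_L2_set)
  finally have "(u 0)\<^sup>2 - V * T \<le> u 0 * u 1" .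
  \<comment> \<open>One killed step costs the form exactly the energy \<open>V * T\<close>, at most
    the fraction 1 / T of the squared norm, since the mean square of \<open>h\<close> is at least
    T^2.\<close>
  moreover have "V * T \<le> (u 0)\<^sup>2 / T"
    using u0 T by (simp add: field_simps power2_eq_square)
  ultimately have "q * (u 0)\<^sup>2 \<le> u 0 * u 1"
    by (simp add: q_def algebra_simps)
  then have q01: "q * u 0 \<le> u 1"
    using u0pos by (simp add: power2_eq_square)
  have logconvex: "(u (Suc n))\<^sup>2 \<le> u n * u (Suc (Suc n))" for n
  proof -
    define f where "f = (kill A ^^ n) h"
    have f: "periodic N f" "\<And>x. x \<in> A \<Longrightarrow> f x = 0"
      unfolding f_def by (auto intro: funpow_kill_periodic h A funpow_kill_zero h0)
    have "(u (Suc n))\<^sup>2 = (\<Sum>x\<in>torus N. kill A f x * kill A f x)"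
      unfolding u2 by (simp add: f_def power2_eq_square)
    also have "\<dots> = (\<Sum>x\<in>torus N. f x * kill A (kill A f) x)"
      by (rule kill_self_adjoint[OF f(1) periodic_kill[OF f(1) A] N f(2), symmetric]) (auto simp: kill_def)
    also have "\<dots> \<le> u n * u (Suc (Suc n))"
      unfolding u_def by (simp add: sum_mult_le_L2_set f_def)
    finally show ?thesis .
  qed
  have step: "q * u n \<le> u (Suc n)" for n
  proof (induction n)
    case (Suc n)
    show ?case
    proof (cases "u (Suc n) = 0")
      case False
      then have pos: "u (Suc n) > 0" using u_nonneg[of "Suc n"] by simp
      have "q * u n * u (Suc n) \<le> u (Suc n) * u (Suc n)"
        using Suc pos by (intro mult_right_mono) auto
      also have "\<dots> \<le> u n * u (Suc (Suc n))"
        using logconvex[of n] by (simp add: power2_eq_square)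
      finally have "u n * (q * u (Suc n)) \<le> u n * u (Suc (Suc n))" by (simp add: mult_ac)
      \<comment> \<open>If \<open>u n\<close> were 0, log-convexity would force
        \<open>u (Suc n)\<close> to be 0.\<close>
      moreover have "u n > 0"
        using logconvex[of n] pos u_nonneg[of n] by (cases "u n = 0") auto
      ultimately show ?thesis by simp
    qed (simp add: u_nonneg)
  qed (use q01 in simp)
  have "q ^ n * u 0 \<le> u n"
  proof (induction n)
    case (Suc n)
    have "q ^ Suc n * u 0 \<le> q * u n" using Suc q by (simp add: mult_left_mono mult.assoc)
    then show ?case using step[of n] by simp
  qed simp
  then show ?thesis by (simp add: u_def q_def)
qed

lemma survival_double:
  "survival N A (2 * n) = (L2_set ((kill A ^^ n) (\<lambda>x. if x \<in> A then 0 else 1)) (torus N))\<^sup>2 / V"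
proof -
  define u where "u n = (kill A ^^ n) (\<lambda>x. if x \<in> A then 0 else 1)" for n
  have per: "periodic N (u n)" for n
    unfolding u_def by (intro funpow_kill_periodic periodic_off A)
  have z: "x \<in> A \<Longrightarrow> u n x = 0" for n x
    unfolding u_def by (rule funpow_kill_zero) auto
  have "(\<Sum>x\<in>torus N. u m x * u k x) = (\<Sum>x\<in>torus N. u 0 x * u (m + k) x)" for m k
  proof (induction m arbitrary: k)
    case (Suc m)
    have "(\<Sum>x\<in>torus N. u (Suc m) x * u k x) = (\<Sum>x\<in>torus N. u m x * u (Suc k) x)"
      using kill_self_adjoint[OF per[of m] per[of k] N z[of _ m] z[of _ k]] by (simp add: u_def)
    then show ?case using Suc[of "Suc k"] by simp
  qed simp
  from this[of n n] have "(\<Sum>x\<in>torus N. (u n x)\<^sup>2) = (\<Sum>x\<in>torus N. u 0 x * u (2 * n) x)"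
    by (simp add: power2_eq_square mult_2)
  also have "\<dots> = (\<Sum>x\<in>torus N. u (2 * n) x)"
  proof (intro sum.cong refl)
    fix x
    have "u 0 x = (if x \<in> A then 0 else 1)" by (simp add: u_def)
    then show "u 0 x * u (2 * n) x = u (2 * n) x" by (simp add: z)
  qed
  finally have "(\<Sum>x\<in>torus N. u (2 * n) x) = (\<Sum>x\<in>torus N. (u n x)\<^sup>2)" by simp
  then show ?thesis
    by (simp add: survival_def V_def u_def L2_set_def sum_nonneg)
qed

lemma survival_le:
  assumes b: "b > 0"
  shows "survival N A (2 * n) \<le> b ^ (2 * n)"
proof -
  let ?one = "\<lambda>x. if x \<in> A then 0 else (1::real)"
  have "L2_set ?one (torus N) \<le> L2_set (\<lambda>_. 1) (torus N :: (int ^ 'd) set)"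
    by (rule L2_set_mono) auto
  also have "\<dots> = sqrt V"
    by (simp add: L2_set_constant card_torus_V)
  finally have 1: "L2_set ?one (torus N) \<le> sqrt V" .
  have "L2_set ((kill A ^^ n) ?one) (torus N) \<le> b ^ n * L2_set ?one (torus N)"
    by (rule funpow_kill_contraction) (use A b in \<open>auto intro: periodic_off\<close>)
  also have "\<dots> \<le> b ^ n * sqrt V" using 1 b by (intro mult_left_mono) auto
  finally have "(L2_set ((kill A ^^ n) ?one) (torus N))\<^sup>2 \<le> (b ^ n * sqrt V)\<^sup>2"
    by (intro power_mono) auto
  also have "\<dots> = b ^ (2 * n) * V"
    using V_pos by (simp add: power_mult_distrib power_mult[symmetric] mult.commute)
  finally show ?thesis
    unfolding survival_double using V_pos by (simp add: pos_divide_le_eq)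
qed

text \<open>The constant 1 is compared with \<open>h / T\<close>, whose variance is small by the Poincare inequality.\<close>

lemma survival_ge:
  assumes b: "b > 0" and T: "T \<ge> 1"
  shows "(1 - 1 / T) ^ n - b ^ n * sqrt (\<tau> / T) \<le> sqrt (survival N A (2 * n))"
proof -
  let ?one = "\<lambda>x. if x \<in> A then 0 else (1::real)"
  have Tpos: "T > 0" using T by simp
  define f where "f = (\<lambda>x. (1 / T) * h x)"
  define r where "r = (\<lambda>x. (if x \<in> A then 0 else 1) + (-1) * f x)"
  have f: "periodic N f" unfolding f_def by (rule periodic_map[OF h, where h = "(*) (1 / T)"])
  have f0: "x \<in> A \<Longrightarrow> f x = 0" for x by (simp add: f_def h0)
  have r: "periodic N r" unfolding r_def using A f unfolding periodic_def by simp
  have r0: "x \<in> A \<Longrightarrow> r x = 0" for x by (simp add: r_def f0)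
  have Sf: "(\<Sum>x\<in>torus N. f x) = V"
    using Tpos by (simp add: f_def sum_h flip: sum_divide_distrib)
  have Ef: "energy N f f = V / T"
  proof -
    have "energy N f f = energy N h h / T\<^sup>2"
      by (simp add: energy_def f_def power2_eq_square flip: diff_divide_distrib sum_divide_distrib)
    then show ?thesis using Tpos by (simp add: energy_hh power2_eq_square)
  qed
  have fsq: "(\<Sum>x\<in>torus N. (f x)\<^sup>2) \<ge> V"
  proof -
    have "V * V \<le> V * (\<Sum>x\<in>torus N. (f x)\<^sup>2)"
      using Cauchy_Schwarz_ineq_sum[of "\<lambda>_. 1" f "torus N"] by (simp add: Sf card_torus_V power2_eq_square)
    then show ?thesis using V_pos by simp
  qed
  have fsq': "(\<Sum>x\<in>torus N. (f x)\<^sup>2) - V \<le> \<tau> * (V / T)"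
  proof -
    have "V * ((\<Sum>x\<in>torus N. (f x)\<^sup>2) - V) \<le> V * (\<tau> * (V / T))"
      using torus_Poincare[OF f N] unfolding Sf Ef V_def[symmetric] \<tau>_def[symmetric]
      by (simp add: algebra_simps power2_eq_square)
    then show ?thesis using V_pos by (simp only: mult_le_cancel_left_pos)
  qed
  \<comment> \<open>Equality holds off \<open>A\<close>; on \<open>A\<close> the left term is 0 and
    the right one is 1.\<close>
  have "(\<Sum>x\<in>torus N. (r x)\<^sup>2) \<le> (\<Sum>x\<in>torus N. (1 - f x)\<^sup>2)"
    by (intro sum_mono) (auto simp: r_def f0)
  also have "\<dots> = (\<Sum>x\<in>torus N. (f x)\<^sup>2) - V"
    by (simp add: power2_diff sum.distrib sum_subtractf card_torus_V Sf flip: sum_distrib_left)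
  also note fsq'
  finally have "L2_set r (torus N) \<le> sqrt (\<tau> * (V / T))"
    unfolding L2_set_def by simp
  then have rn: "L2_set r (torus N) \<le> sqrt (\<tau> / T) * sqrt V"
    by (simp add: real_sqrt_mult[symmetric])
  have fn: "sqrt V \<le> L2_set f (torus N)"
    unfolding L2_set_def using fsq by simp
  have hf: "L2_set ((kill A ^^ n) f) (torus N) = (1 / T) * L2_set ((kill A ^^ n) h) (torus N)" for n
    unfolding f_def funpow_kill_cmult using Tpos by (subst L2_set_right_distrib) auto
  have "(1 - 1 / T) ^ n * sqrt V \<le> (1 - 1 / T) ^ n * L2_set f (torus N)"
    using fn T by (intro mult_left_mono) auto
  also have "\<dots> \<le> L2_set ((kill A ^^ n) f) (torus N)"
  proof -
    have eq: "L2_set h (torus N) = T * L2_set f (torus N)"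
      "L2_set ((kill A ^^ n) h) (torus N) = T * L2_set ((kill A ^^ n) f) (torus N)"
      using hf[of 0] hf[of n] Tpos by simp_all
    have "T * ((1 - 1 / T) ^ n * L2_set f (torus N)) \<le> T * L2_set ((kill A ^^ n) f) (torus N)"
      using funpow_kill_h_ge[OF T, of n] unfolding eq by (simp only: mult_ac)
    then show ?thesis using Tpos by (simp only: mult_le_cancel_left_pos)
  qed
  \<comment> \<open>Writing \<open>f\<close> as the indicator minus \<open>r\<close>, the triangle
    inequality gives a lower bound for the iterate of the indicator; the contraction makes the
    iterate of \<open>r\<close> small.\<close>
  also have "(kill A ^^ n) f = (\<lambda>x. (kill A ^^ n) ?one x + (-1) * (kill A ^^ n) r x)"
  proof -
    have "f = (\<lambda>x. ?one x + (-1) * r x)" by (auto simp: r_def)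
    then have "(kill A ^^ n) f = (kill A ^^ n) (\<lambda>x. ?one x + (-1) * r x)" by (rule arg_cong)
    then show ?thesis unfolding funpow_kill_add funpow_kill_cmult .
  qed
  also have "L2_set \<dots> (torus N) \<le> L2_set ((kill A ^^ n) ?one) (torus N) + L2_set (\<lambda>x. (-1) * (kill A ^^ n) r x) (torus N)"
    by (rule L2_set_triangle_ineq)
  also have "L2_set (\<lambda>x. (-1) * (kill A ^^ n) r x) (torus N) = L2_set ((kill A ^^ n) r) (torus N)"
    by (simp add: L2_set_def)
  also have "L2_set ((kill A ^^ n) r) (torus N) \<le> b ^ n * (sqrt (\<tau> / T) * sqrt V)"
    by (rule order.trans[OF funpow_kill_contraction[OF r r0 b] mult_left_mono[OF rn]]) (use b in auto)
  also have "L2_set ((kill A ^^ n) ?one) (torus N) = sqrt (survival N A (2 * n)) * sqrt V"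
    unfolding survival_double using V_pos by (simp add: real_sqrt_divide)
  finally have "((1 - 1 / T) ^ n - b ^ n * sqrt (\<tau> / T)) * sqrt V \<le> sqrt (survival N A (2 * n)) * sqrt V"
    by (simp add: algebra_simps)
  then show ?thesis using V_pos by simp
qed

end

section \<open>The law of the jump chain\<close>

lemma sum_unit_steps:
  fixes F :: "int ^ 'd::finite \<Rightarrow> 'b::comm_monoid_add"
  shows "(\<Sum>s\<in>unit_steps. F s) = (\<Sum>i\<in>UNIV. F (axis i 1) + F (- axis i 1))"
proof -
  have ne: "axis i (1::int) \<noteq> - axis j 1" for i j :: 'd
  proof
    assume "axis i (1::int) = - axis j 1"
    then have "axis i (1::int) $ i = (- axis j 1) $ i" by simp
    then show False by (auto simp: axis_def split: if_splits)
  qed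
  have inj: "inj (\<lambda>i::'d. axis i (1::int))" "inj (\<lambda>i::'d. - axis i (1::int))"
    by (auto simp: inj_def axis_eq_axis)
  have "(\<Sum>s\<in>unit_steps. F s) = (\<Sum>s\<in>range (\<lambda>i. axis i 1). F s) + (\<Sum>s\<in>range (\<lambda>i. - axis i 1). F s)"
    unfolding unit_steps_def using ne by (intro sum.union_disjoint) auto
  then show ?thesis
    by (simp add: sum.reindex[OF inj(1)] sum.reindex[OF inj(2)] sum.distrib)
qed

lemma finite_unit_steps: "finite (unit_steps :: (int ^ 'd::finite) set)"
  by (simp add: unit_steps_def)

lemma card_unit_steps: "card (unit_steps :: (int ^ 'd::finite) set) = 2 * CARD('d)"
  using sum_unit_steps[of "\<lambda>_ :: int ^ 'd. 1 :: nat"] by simp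

lemma unit_steps_nonempty: "unit_steps \<noteq> ({} :: (int ^ 'd::finite) set)"
  by (simp add: unit_steps_def)

lemma avg_unit_steps:
  fixes x :: "int ^ 'd::finite"
  shows "avg f x = (\<Sum>s\<in>unit_steps. f (x + s)) / real (card (unit_steps :: (int ^ 'd) set))"
  unfolding sum_unit_steps card_unit_steps by (simp add: avg_def)

definition steps :: "(nat \<Rightarrow> int ^ 'd::finite) measure" where
  "steps = (\<Pi>\<^sub>M n\<in>UNIV. measure_pmf (pmf_of_set unit_steps))"

definition holding :: "(nat \<Rightarrow> real) measure" where
  "holding = (\<Pi>\<^sub>M n\<in>UNIV. density lborel (exponential_density 1))"

lemma srw_space_eq: "srw_space N = measure_pmf (pmf_of_set (torus N)) \<Otimes>\<^sub>M (steps \<Otimes>\<^sub>M holding)"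
  by (simp add: srw_space_def steps_def holding_def)

lemma prob_space_steps: "prob_space steps"
  unfolding steps_def by (intro prob_space_PiM prob_space_measure_pmf)

lemma prob_space_holding: "prob_space holding"
  unfolding holding_def by (intro prob_space_PiM prob_space_exponential_density) simp

lemma prob_space_srw: "prob_space (srw_space N)"
  unfolding srw_space_eq by (intro prob_space_pair prob_space_steps prob_space_holding prob_space_measure_pmf)

lemma space_steps [simp]: "space steps = UNIV"
  by (auto simp: steps_def space_PiM)

lemma measurable_partial_sum:
  "(\<lambda>\<xi>. x + (\<Sum>m<n. \<xi> m)) \<in> steps \<rightarrow>\<^sub>M count_space (UNIV :: (int ^ 'd::finite) set)"
proof (induction n)
  case (Suc n)
  have [measurable]: "(\<lambda>\<xi>. \<xi> n) \<in> steps \<rightarrow>\<^sub>M count_space (UNIV :: (int ^ 'd) set)"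
    unfolding steps_def by (rule measurable_compose[OF measurable_component_singleton]) auto
  have "(\<lambda>\<xi>. (\<lambda>(a, b). a + b) (x + (\<Sum>m<n. \<xi> m), \<xi> n)) \<in> steps \<rightarrow>\<^sub>M count_space (UNIV :: (int ^ 'd) set)"
  proof (rule measurable_compose[where g = "\<lambda>(a, b). a + b"])
    show "(\<lambda>\<xi>. (x + (\<Sum>m<n. \<xi> m), \<xi> n)) \<in> steps \<rightarrow>\<^sub>M count_space (UNIV :: (int ^ 'd) set) \<Otimes>\<^sub>M count_space UNIV"
      using Suc by measurable
  qed (simp add: pair_measure_countable[OF countableI_type countableI_type])
  then show ?case by (simp add: add.assoc)
qed simp

lemma steps_avoid_sets:
  "{\<xi>. \<forall>m\<le>n. x + (\<Sum>j<m. \<xi> j) \<notin> A} \<in> sets (steps :: (nat \<Rightarrow> int ^ 'd::finite) measure)"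
proof -
  note [measurable] = measurable_partial_sum
  have "{\<xi> \<in> space steps. \<forall>m\<in>{..n}. x + (\<Sum>j<m. \<xi> j) \<notin> A} \<in> sets (steps :: (nat \<Rightarrow> int ^ 'd) measure)"
    by measurable
  then show ?thesis by (simp add: Ball_def)
qed

lemma kill_nonneg: "(\<And>x. f x \<ge> 0) \<Longrightarrow> (kill A ^^ n) f x \<ge> 0"
  by (induction n arbitrary: x) (auto simp: kill_def avg_def intro!: divide_nonneg_pos sum_nonneg)

text \<open>Markov property at the first step: \<open>PiM_iter\<close> presents the step sequence as
  a fresh step followed by an independent copy, which shifts the start from x to x + s and costs one
  application of \<open>kill A\<close>.\<close>

lemma steps_avoid:
  fixes A :: "(int ^ 'd::finite) set"
  shows "emeasure steps {\<xi>. \<forall>m\<le>n. x + (\<Sum>j<m. \<xi> j) \<notin> A} =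
    ennreal ((kill A ^^ n) (\<lambda>x. if x \<in> A then 0 else 1) x)"
proof (induction n arbitrary: x)
  case 0
  have "emeasure steps (UNIV :: (nat \<Rightarrow> int ^ 'd) set) = 1"
    using prob_space.emeasure_space_1[OF prob_space_steps] by simp
  then show ?case by simp
next
  case (Suc n)
  let ?M = "measure_pmf (pmf_of_set (unit_steps :: (int ^ 'd) set))"
  let ?u = "(kill A ^^ n) (\<lambda>x. if x \<in> A then 0 else 1)"
  interpret sequence_space ?M by unfold_locales
  interpret S: prob_space "steps :: (nat \<Rightarrow> int ^ 'd) measure" by (rule prob_space_steps)
  define E where "E = {\<xi>. \<forall>m\<le>Suc n. x + (\<Sum>j<m. \<xi> j) \<notin> A}"
  show ?case
  proof (cases "x \<in> A")
    case True
    then have "E = {}" by (force simp: E_def)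
    then show ?thesis unfolding E_def[symmetric] using True by (simp add: kill_def)
  next
    case False
    have E: "E \<in> sets steps" unfolding E_def by (rule steps_avoid_sets)
    have m: "(\<lambda>(s, \<omega>). case_nat s \<omega>) \<in> ?M \<Otimes>\<^sub>M steps \<rightarrow>\<^sub>M steps"
      unfolding steps_def by measurable
    have vim: "Pair s -` ((\<lambda>(s, \<omega>). case_nat s \<omega>) -` E \<inter> space (?M \<Otimes>\<^sub>M steps)) =
        {\<xi>. \<forall>m\<le>n. (x + s) + (\<Sum>j<m. \<xi> j) \<notin> A}" for s
    proof -
      have "case_nat s \<xi> \<in> E \<longleftrightarrow> (\<forall>m\<le>n. (x + s) + (\<Sum>j<m. \<xi> j) \<notin> A)" for \<xi>
      proof -
        have *: "(\<forall>m\<le>Suc n. P m) \<longleftrightarrow> P 0 \<and> (\<forall>m\<le>n. P (Suc m))" for P :: "nat \<Rightarrow> bool"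
          by (metis Suc_le_mono le0 not0_implies_Suc)
        show ?thesis
          unfolding E_def mem_Collect_eq * using False
          by (simp add: sum.lessThan_Suc_shift add.assoc del: sum.lessThan_Suc)
      qed
      then show ?thesis by (auto simp: space_pair_measure)
    qed
    have "emeasure steps E = emeasure (distr (?M \<Otimes>\<^sub>M steps) steps (\<lambda>(s, \<omega>). case_nat s \<omega>)) E"
      using PiM_iter by (simp add: steps_def)
    also have "\<dots> = emeasure (?M \<Otimes>\<^sub>M steps) ((\<lambda>(s, \<omega>). case_nat s \<omega>) -` E \<inter> space (?M \<Otimes>\<^sub>M steps))"
      by (rule emeasure_distr[OF m E])
    also have "\<dots> = (\<integral>\<^sup>+ s. emeasure steps {\<xi>. \<forall>m\<le>n. (x + s) + (\<Sum>j<m. \<xi> j) \<notin> A} \<partial>?M)"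
      by (subst S.emeasure_pair_measure_alt[OF measurable_sets[OF m E]]) (simp only: vim)
    also have "\<dots> = (\<Sum>s\<in>unit_steps. ennreal (?u (x + s))) / card (unit_steps :: (int ^ 'd) set)"
      unfolding Suc.IH by (rule nn_integral_pmf_of_set[OF unit_steps_nonempty finite_unit_steps])
    also have "\<dots> = ennreal (avg ?u x)"
      unfolding avg_unit_steps
      by (simp add: kill_nonneg sum_ennreal card_unit_steps divide_ennreal sum_nonneg
          ennreal_of_nat_eq_real_of_nat)
    finally show ?thesis unfolding E_def using False by (simp add: kill_def[of A _ x])
  qed
qed

text \<open>The chain lives on the full lattice, without reduction modulo \<open>N\<close>; hitting
  a torus vertex means hitting one of its lattice copies.\<close>

definition jump_chain :: "('d::finite) srw_sample \<Rightarrow> nat \<Rightarrow> int ^ 'd" where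
  "jump_chain \<omega> n = fst \<omega> + (\<Sum>m<n. fst (snd \<omega>) m)"

lemma measurable_jump_chain: "(\<lambda>\<omega>. jump_chain \<omega> n) \<in> srw_space N \<rightarrow>\<^sub>M count_space (UNIV :: (int ^ 'd::finite) set)"
proof -
  have 1: "(\<lambda>\<omega>. fst \<omega>) \<in> srw_space N \<rightarrow>\<^sub>M count_space (UNIV :: (int ^ 'd) set)"
    unfolding srw_space_def by (rule measurable_compose[OF measurable_fst]) simp
  have 2: "(\<lambda>\<omega>. x + (\<Sum>m<n. fst (snd \<omega>) m)) \<in> srw_space N \<rightarrow>\<^sub>M count_space (UNIV :: (int ^ 'd) set)" for x
    unfolding srw_space_eq
    by (rule measurable_compose[OF _ measurable_partial_sum]) measurable
  show ?thesis
    unfolding jump_chain_def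
    by (rule measurable_compose_countable'[OF 2 1]) auto
qed

lemma avoid_sets:
  "{\<omega> \<in> space (srw_space N). \<forall>m\<le>n. jump_chain \<omega> m \<notin> A} \<in> sets (srw_space N :: ('d::finite) srw_sample measure)"
proof -
  note [measurable] = measurable_jump_chain
  have "{\<omega> \<in> space (srw_space N). \<forall>m\<in>{..n}. jump_chain \<omega> m \<notin> A} \<in> sets (srw_space N :: 'd srw_sample measure)"
    by measurable
  then show ?thesis by simp
qed

lemma measure_avoid:
  fixes A :: "(int ^ 'd::finite) set"
  assumes N: "N > 0"
  shows "measure (srw_space N) {\<omega> \<in> space (srw_space N). \<forall>m\<le>n. jump_chain \<omega> m \<notin> A} = survival N A n"
proof -
  let ?u = "(kill A ^^ n) (\<lambda>x. if x \<in> A then 0 else 1)"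
  interpret S: prob_space "steps :: (nat \<Rightarrow> int ^ 'd) measure" by (rule prob_space_steps)
  interpret H: prob_space holding by (rule prob_space_holding)
  interpret SH: prob_space "steps \<Otimes>\<^sub>M holding :: ((nat \<Rightarrow> int ^ 'd) \<times> _) measure"
    by (rule prob_space_pair[OF prob_space_steps prob_space_holding])
  let ?E = "{\<omega> \<in> space (srw_space N). \<forall>m\<le>n. jump_chain \<omega> m \<notin> A}"
  have ne: "torus N \<noteq> ({} :: (int ^ 'd) set)" using torus_proj_in_torus[OF N] by blast
  have "emeasure (srw_space N) ?E = (\<integral>\<^sup>+ x. emeasure (steps \<Otimes>\<^sub>M holding) (Pair x -` ?E) \<partial>measure_pmf (pmf_of_set (torus N)))"
    using avoid_sets[of N n A] unfolding srw_space_eq by (rule SH.emeasure_pair_measure_alt)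
  also have "\<dots> = (\<integral>\<^sup>+ x. ennreal (?u x) \<partial>measure_pmf (pmf_of_set (torus N)))"
  proof (rule nn_integral_cong)
    fix x :: "int ^ 'd"
    have "Pair x -` ?E = {\<xi>. \<forall>m\<le>n. x + (\<Sum>j<m. \<xi> j) \<notin> A} \<times> space holding"
      by (auto simp: srw_space_eq space_pair_measure jump_chain_def)
    then show "emeasure (steps \<Otimes>\<^sub>M holding) (Pair x -` ?E) = ennreal (?u x)"
      by (simp add: H.emeasure_pair_measure_Times steps_avoid_sets steps_avoid H.emeasure_space_1)
  qed
  also have "\<dots> = (\<Sum>x\<in>torus N. ennreal (?u x)) / card (torus N :: (int ^ 'd) set)"
    by (rule nn_integral_pmf_of_set[OF ne finite_torus])
  also have "\<dots> = ennreal (survival N A n)"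
    unfolding survival_def using N
    by (simp add: kill_nonneg sum_ennreal card_torus divide_ennreal sum_nonneg
        ennreal_of_nat_eq_real_of_nat del: of_nat_power)
  finally show ?thesis
    by (intro measure_eq_emeasure_eq_ennreal) (auto simp: survival_def kill_nonneg intro!: divide_nonneg_nonneg sum_nonneg)
qed

text \<open>Positive holding times make the jump times strictly increasing, so that entrance times
  are ordered like the discoveries of the jump chain.\<close>

lemma AE_holding_pos: "AE \<tau> in holding. \<tau> n > 0"
proof -
  have "AE t in density lborel (exponential_density 1). t > 0"
  proof -
    have "AE t in lborel. t \<noteq> (0::real)" by (rule AE_lborel_singleton)
    then show ?thesis
      by (subst AE_density) (auto simp: exponential_density_def elim!: eventually_mono)
  qed
  then show ?thesis
    unfolding holding_def
    by (intro AE_PiM_component[of UNIV "\<lambda>_. density lborel (exponential_density 1)" n "\<lambda>t. t > 0"])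
      (auto intro: prob_space_exponential_density)
qed

lemma AE_srw_holding_pos:
  "AE \<omega> in (srw_space N :: ('d::finite) srw_sample measure). \<forall>n. snd (snd \<omega>) n > 0"
proof -
  let ?M = "measure_pmf (pmf_of_set (torus N :: (int ^ 'd) set))"
  let ?S = "steps :: (nat \<Rightarrow> int ^ 'd) measure"
  interpret H: prob_space holding by (rule prob_space_holding)
  interpret SH: prob_space "?S \<Otimes>\<^sub>M holding"
    by (rule prob_space_pair[OF prob_space_steps prob_space_holding])
  have "AE \<omega> in (srw_space N :: 'd srw_sample measure). snd (snd \<omega>) n > 0" for n
  proof (rule AE_I)
    let ?Z = "{\<tau>\<in>space holding. \<not> \<tau> n > 0}"
    have m: "?Z \<in> sets holding"
      unfolding holding_def by measurable
    then have z: "emeasure holding ?Z = 0"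
      using AE_holding_pos[of n] by (simp add: AE_iff_measurable[OF _ refl])
    show "{\<omega>\<in>space (srw_space N :: 'd srw_sample measure). \<not> snd (snd \<omega>) n > 0} \<subseteq> space ?M \<times> (space ?S \<times> ?Z)"
      by (auto simp: srw_space_eq space_pair_measure)
    show "emeasure (srw_space N) (space ?M \<times> (space ?S \<times> ?Z)) = 0"
      unfolding srw_space_eq
      by (subst SH.emeasure_pair_measure_Times[OF sets.top pair_measureI[OF sets.top m]],
          subst H.emeasure_pair_measure_Times[OF sets.top m]) (simp add: z)
    show "space ?M \<times> (space ?S \<times> ?Z) \<in> sets (srw_space N)"
      unfolding srw_space_eq by (intro pair_measureI sets.top m)
  qed
  then show ?thesis
    by (simp add: AE_all_countable)
qed

section \<open>Order of entrance\<close>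

definition unvisited :: "nat \<Rightarrow> ('d::finite) srw_sample \<Rightarrow> nat \<Rightarrow> (int ^ 'd) set" where
  "unvisited N \<omega> n = {x \<in> torus N. \<forall>m\<le>n. torus_proj N (jump_chain \<omega> m) \<noteq> x}"

definition first_visit :: "nat \<Rightarrow> ('d::finite) srw_sample \<Rightarrow> int ^ 'd \<Rightarrow> nat" where
  "first_visit N \<omega> x = (LEAST n. torus_proj N (jump_chain \<omega> n) = x)"

text \<open>
  The holding times need not have infinite sum here: all entrances happen after finitely many jumps.
\<close>

locale covering_sample =
  fixes N :: nat and \<omega> :: "('d::finite) srw_sample"
  assumes N: "N > 0"
    and pos: "\<And>m. snd (snd \<omega>) m > 0"
    and cover: "\<And>x. x \<in> torus N \<Longrightarrow> \<exists>n. torus_proj N (jump_chain \<omega> n) = x"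
begin

definition S :: "nat \<Rightarrow> real" where "S n = (\<Sum>m<n. snd (snd \<omega>) m)"

lemma S_strict_mono: "strict_mono S"
  by (rule strict_monoI_Suc) (simp add: S_def pos)

lemma S_Suc: "(\<Sum>m\<le>n. snd (snd \<omega>) m) = S (Suc n)"
  by (simp add: S_def lessThan_Suc_atMost)

lemma jump_count_S: "jump_count (snd (snd \<omega>)) (S n) = n"
  unfolding jump_count_def S_Suc
  by (rule Least_equality) (auto simp: strict_mono_less[OF S_strict_mono])

lemma walk_eq: "walk N t \<omega> = torus_proj N (jump_chain \<omega> (jump_count (snd (snd \<omega>)) t))"
  by (simp add: walk_def jump_chain_def case_prod_unfold)

lemma jump_chain_first_visit: "x \<in> torus N \<Longrightarrow> torus_proj N (jump_chain \<omega> (first_visit N \<omega> x)) = x"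
  unfolding first_visit_def using cover by (rule LeastI_ex)

text \<open>The infimum is attained: at the n-th jump time the walk has made exactly n jumps, and at
  any earlier time fewer.\<close>

lemma entrance_time_eq:
  assumes x: "x \<in> torus N"
  shows "entrance_time N x \<omega> = ereal (S (first_visit N \<omega> x))"
  unfolding entrance_time_def
proof (rule Inf_eqI)
  fix y assume "y \<in> ereal ` {t. 0 \<le> t \<and> walk N t \<omega> = x}"
  then obtain t where t: "y = ereal t" "0 \<le> t" "walk N t \<omega> = x" by auto
  have "S (first_visit N \<omega> x) \<le> t"
  proof (rule ccontr)
    assume "\<not> ?thesis"
    then have lt: "t < S (first_visit N \<omega> x)" by simp
    \<comment> \<open>The first visit cannot be at index 0, because \<open>S 0\<close> is 0 and
      \<open>t\<close> is nonnegative.\<close>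
    obtain n where n: "first_visit N \<omega> x = Suc n"
      using lt t(2) by (cases "first_visit N \<omega> x") (auto simp: S_def)
    have "jump_count (snd (snd \<omega>)) t \<le> n"
      unfolding jump_count_def S_Suc using lt n by (intro Least_le) simp
    then have "jump_count (snd (snd \<omega>)) t < first_visit N \<omega> x" using n by simp
    then show False
      using not_less_Least[of "jump_count (snd (snd \<omega>)) t" "\<lambda>n. torus_proj N (jump_chain \<omega> n) = x"] t(3)
      by (simp add: walk_eq first_visit_def)
  qed
  then show "ereal (S (first_visit N \<omega> x)) \<le> y" by (simp add: t)
next
  fix y assume y: "\<And>z. z \<in> ereal ` {t. 0 \<le> t \<and> walk N t \<omega> = x} \<Longrightarrow> y \<le> z"
  have "0 \<le> S (first_visit N \<omega> x)"
    unfolding S_def by (intro sum_nonneg less_imp_le pos)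
  moreover have "walk N (S (first_visit N \<omega> x)) \<omega> = x"
    by (simp add: walk_eq jump_count_S jump_chain_first_visit x)
  ultimately show "y \<le> ereal (S (first_visit N \<omega> x))"
    by (intro y) auto
qed

lemma entrance_time_less:
  "x \<in> torus N \<Longrightarrow> y \<in> torus N \<Longrightarrow>
    entrance_time N x \<omega> < entrance_time N y \<omega> \<longleftrightarrow> first_visit N \<omega> x < first_visit N \<omega> y"
  by (simp add: entrance_time_eq strict_mono_less[OF S_strict_mono])

lemma inj_first_visit: "inj_on (first_visit N \<omega>) (torus N)"
  by (metis inj_onI jump_chain_first_visit)

text \<open>The choice in the definition of \<open>last_visited\<close> is meaningful once one
  enumeration exists; sorting the distinct first-visit indices supplies it.\<close>

lemma last_visited:
  "bij_betw (last_visited N \<omega>) {1..N ^ CARD('d)} (torus N) \<and>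
    (\<forall>i\<in>{1..N ^ CARD('d)}. \<forall>j\<in>{1..N ^ CARD('d)}. i < j \<longrightarrow>
       entrance_time N (last_visited N \<omega> i) \<omega> > entrance_time N (last_visited N \<omega> j) \<omega>)"
proof -
  let ?n = "N ^ CARD('d)" and ?f = "first_visit N \<omega>"
  have fin: "finite (?f ` torus N)" by (simp add: finite_torus)
  have card: "card (?f ` torus N) = ?n" by (simp add: card_image inj_first_visit card_torus)
  obtain h where h: "bij_betw h {..<?n} (?f ` torus N)" "strict_mono_on {..<?n} h"
    using ex_bij_betw_strict_mono_card[OF fin] unfolding card by blast
  \<comment> \<open>\<open>h\<close> lists the first-visit indices increasingly from position 0.
    Reflecting by \<open>?n - i\<close> sends 1 to the largest and \<open>?n\<close> to the
    smallest.\<close>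
  define z where "z i = inv_into (torus N) ?f (h (?n - i))" for i
  have "bij_betw (\<lambda>i. ?n - i) {1..?n} {..<?n}"
    by (rule bij_betw_byWitness[where f' = "\<lambda>i. ?n - i"]) auto
  from bij_betw_trans[OF bij_betw_trans[OF this h(1)] bij_betw_inv_into[OF inj_on_imp_bij_betw[OF inj_first_visit]]]
  have z: "bij_betw z {1..?n} (torus N)"
    by (simp add: z_def[abs_def] o_def)
  have fz: "?f (z i) = h (?n - i)" if "i \<in> {1..?n}" for i
  proof -
    have "h (?n - i) \<in> ?f ` torus N"
      using h(1) that by (intro bij_betwE[THEN bspec, OF h(1)]) auto
    then show ?thesis unfolding z_def by (rule f_inv_into_f)
  qed
  have "entrance_time N (z i) \<omega> > entrance_time N (z j) \<omega>"
    if ij: "i \<in> {1..?n}" "j \<in> {1..?n}" "i < j" for i j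
  proof -
    have "z i \<in> torus N" "z j \<in> torus N" using z ij bij_betwE by blast+
    moreover have "h (?n - j) < h (?n - i)"
      by (rule strict_mono_onD[OF h(2)]) (use ij in auto)
    ultimately show ?thesis by (simp add: entrance_time_less fz[OF ij(1)] fz[OF ij(2)])
  qed
  with z have "\<exists>z. bij_betw z {1..?n} (torus N) \<and>
     (\<forall>i\<in>{1..?n}. \<forall>j\<in>{1..?n}. i < j \<longrightarrow> entrance_time N (z i) \<omega> > entrance_time N (z j) \<omega>)"
    by blast
  then show ?thesis
    unfolding last_visited_def by (rule someI_ex)
qed

text \<open>If the vertex of rank i is already visited, every unvisited vertex is entered later and
  has a smaller rank, leaving room for at most i - 1 of them.\<close>

lemma last_visited_unvisited:
  assumes i: "1 \<le> i" "i \<le> card (unvisited N \<omega> n)"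
  shows "last_visited N \<omega> i \<in> unvisited N \<omega> n"
proof (rule ccontr)
  let ?Z = "last_visited N \<omega>" and ?F = "unvisited N \<omega> n" and ?n = "N ^ CARD('d)"
  assume nin: "?Z i \<notin> ?F"
  have bij: "bij_betw ?Z {1..?n} (torus N)" using last_visited by blast
  have sub: "?F \<subseteq> torus N" by (auto simp: unvisited_def)
  have "card ?F \<le> ?n" using card_mono[OF finite_torus sub] by (simp add: card_torus)
  then have in': "i \<in> {1..?n}" using i by simp
  have Zi: "?Z i \<in> torus N" using bij in' bij_betwE by blast
  have le: "first_visit N \<omega> (?Z i) \<le> n"
    using nin Zi unfolding unvisited_def first_visit_def by (auto intro: Least_le order.trans)
  have "?F \<subseteq> ?Z ` {1..<i}"
  proof
    fix x assume x: "x \<in> ?F"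
    then have xt: "x \<in> torus N" using sub by blast
    then obtain l where l: "l \<in> {1..?n}" "x = ?Z l" using bij by (metis bij_betw_imp_surj_on imageE)
    have "torus_proj N (jump_chain \<omega> m) \<noteq> x" if "m \<le> n" for m
      using x that by (auto simp: unvisited_def)
    then have "n < first_visit N \<omega> x"
      using jump_chain_first_visit[OF xt] by (meson not_le)
    with le have lt: "entrance_time N (?Z i) \<omega> < entrance_time N (?Z l) \<omega>"
      by (simp add: entrance_time_less Zi xt flip: l(2))
    have "\<not> i < l"
    proof
      assume "i < l"
      with last_visited in' l(1) have "entrance_time N (?Z l) \<omega> < entrance_time N (?Z i) \<omega>" by blast
      with lt show False by simp
    qed
    moreover have "i \<noteq> l" using lt by auto
    ultimately show "x \<in> ?Z ` {1..<i}" using l by auto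
  qed
  then have "card ?F \<le> card (?Z ` {1..<i})" by (intro card_mono) auto
  also have "\<dots> \<le> i - 1" using card_image_le[of "{1..<i}" ?Z] by simp
  finally show False using i by simp
qed

lemma close_pair_cases:
  assumes "k \<le> N ^ CARD('d)" and ij: "1 \<le> i" "i < j" "j \<le> k"
    and d: "torus_dist N (last_visited N \<omega> i) (last_visited N \<omega> j) \<le> r"
  shows "card (unvisited N \<omega> n) < k \<or>
    (\<exists>x\<in>unvisited N \<omega> n. \<exists>y\<in>unvisited N \<omega> n. x \<noteq> y \<and> torus_dist N x y \<le> r)"
  unfolding disj_imp
proof (rule impI)
  assume "\<not> card (unvisited N \<omega> n) < k"
  then have "last_visited N \<omega> i \<in> unvisited N \<omega> n" "last_visited N \<omega> j \<in> unvisited N \<omega> n"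
    using ij by (auto intro!: last_visited_unvisited)
  \<comment> \<open>Distinctness relies on \<open>k\<close> not exceeding the volume: the
    enumeration is injective only on ranks up to there.\<close>
  moreover have "last_visited N \<omega> i \<noteq> last_visited N \<omega> j"
    using last_visited assms(1) ij unfolding bij_betw_def
    by (auto dest: inj_onD)
  ultimately show "\<exists>x\<in>unvisited N \<omega> n. \<exists>y\<in>unvisited N \<omega> n. x \<noteq> y \<and> torus_dist N x y \<le> r"
    using d by blast
qed

end

text \<open>Transfers a set of torus vertices to the lattice, where the unreduced
  \<open>jump_chain\<close> and the operator \<open>kill\<close> act.\<close>

definition copies :: "nat \<Rightarrow> (int ^ 'd::finite) set \<Rightarrow> (int ^ 'd) set" where
  "copies N B = {y. torus_proj N y \<in> B}"

lemma periodic_copies: "N > 0 \<Longrightarrow> periodic N (\<lambda>x. x \<in> copies N B)"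
  by (simp add: periodic_def copies_def torus_proj_id)

text \<open>The events of missing x decrease in time, so survival along even times already bounds
  the probability of never visiting x.\<close>

lemma AE_covering_sample:
  assumes N: "N > 0" and surv: "\<And>x :: int ^ 'd::finite. x \<in> torus N \<Longrightarrow>
     (\<lambda>n. survival N (copies N {x}) (2 * n)) \<longlonglongrightarrow> 0"
  shows "AE \<omega> in (srw_space N :: 'd srw_sample measure). covering_sample N \<omega>"
proof -
  let ?M = "srw_space N :: 'd srw_sample measure"
  interpret prob_space ?M by (rule prob_space_srw)
  have "AE \<omega> in ?M. \<exists>n. torus_proj N (jump_chain \<omega> n) = x" if x: "x \<in> torus N" for x
  proof (rule AE_I)
    let ?B = "\<lambda>n. {\<omega> \<in> space ?M. \<forall>m\<le>n. jump_chain \<omega> m \<notin> copies N {x}}"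
    show "{\<omega> \<in> space ?M. \<not> (\<exists>n. torus_proj N (jump_chain \<omega> n) = x)} \<subseteq> (\<Inter>n. ?B n)"
      by (auto simp: copies_def)
    show sets: "(\<Inter>n. ?B n) \<in> sets ?M"
      by (intro sets.countable_INT) (auto intro: avoid_sets)
    have "measure ?M (\<Inter>n. ?B n) \<le> survival N (copies N {x}) (2 * n)" for n
      unfolding measure_avoid[OF N, symmetric] by (intro finite_measure_mono avoid_sets) auto
    then have "measure ?M (\<Inter>n. ?B n) \<le> 0"
      by (intro LIMSEQ_le_const[OF surv[OF x]]) auto
    then show "emeasure ?M (\<Inter>n. ?B n) = 0"
      using measure_nonneg[of ?M "\<Inter>n. ?B n"] by (simp add: emeasure_eq_measure)
  qed
  then have "AE \<omega> in ?M. \<forall>x\<in>torus N. \<exists>n. torus_proj N (jump_chain \<omega> n) = x"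
    by (simp add: AE_ball_countable countable_finite finite_torus)
  with AE_srw_holding_pos[of N, where 'd = 'd] show ?thesis
    by eventually_elim (auto simp: covering_sample_def N)
qed

text \<open>With X the number of unvisited vertices after n jumps, \<open>s\<close> is E X,
  \<open>p\<close> is E X(X - 1), and \<open>c\<close> is the expected number of ordered close
  unvisited pairs. Chebyshev is centred at M instead of E X, so the first numerator is E (X - M)^2
  and \<open>s\<close> must be known from both sides.\<close>

lemma prob_last_visited_close_le:
  fixes k n N :: nat and r M :: real
  defines "s \<equiv> (\<Sum>x\<in>(torus N :: (int ^ 'd::finite) set). survival N (copies N {x}) n)"
  defines "p \<equiv> (\<Sum>x\<in>(torus N :: (int ^ 'd) set). \<Sum>y\<in>torus N - {x}. survival N (copies N {x, y}) n)"
  defines "c \<equiv> (\<Sum>x\<in>(torus N :: (int ^ 'd) set). \<Sum>y\<in>{y\<in>torus N - {x}. torus_dist N x y \<le> r}. survival N (copies N {x, y}) n)"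
  assumes N: "N > 0" and k: "k \<le> N ^ CARD('d)" and M: "real k < M"
    and surv: "\<And>x :: int ^ 'd. x \<in> torus N \<Longrightarrow> (\<lambda>n. survival N (copies N {x}) (2 * n)) \<longlonglongrightarrow> 0"
  shows "\<P>(\<omega> in (srw_space N :: 'd srw_sample measure). \<exists>i j. 1 \<le> i \<and> i < j \<and> j \<le> k \<and>
      torus_dist N (last_visited N \<omega> i) (last_visited N \<omega> j) \<le> r)
    \<le> (s + p - 2 * M * s + M\<^sup>2) / (M - real k)\<^sup>2 + c"
proof -
  let ?M = "srw_space N :: 'd srw_sample measure"
  interpret prob_space ?M by (rule prob_space_srw)
  define E where "E B = {\<omega> \<in> space ?M. \<forall>m\<le>n. jump_chain \<omega> m \<notin> copies N B}" for B
  have E [measurable]: "E B \<in> sets ?M" for B unfolding E_def by (rule avoid_sets)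
  have PE: "measure ?M (E B) = survival N (copies N B) n" for B
    unfolding E_def by (rule measure_avoid[OF N])
  have EE: "E {x} \<inter> E {y} = E {x, y}" for x y by (auto simp: E_def copies_def)
  have unv: "x \<in> unvisited N \<omega> n \<longleftrightarrow> \<omega> \<in> E {x}" if "x \<in> torus N" "\<omega> \<in> space ?M" for x \<omega>
    using that by (auto simp: unvisited_def E_def copies_def)
  define X where "X \<omega> = (\<Sum>x\<in>torus N. indicator (E {x}) \<omega> :: real)" for \<omega>
  have X: "X \<omega> = real (card (unvisited N \<omega> n))" if "\<omega> \<in> space ?M" for \<omega>
  proof -
    have "unvisited N \<omega> n = {x \<in> torus N. \<omega> \<in> E {x}}"
      using that unv unfolding unvisited_def by blast
    then show ?thesis
      by (simp add: X_def indicator_def sum.If_cases finite_torus Int_def)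
  qed
  have [measurable]: "X \<in> borel_measurable ?M" unfolding X_def[abs_def] by measurable
  have int: "integrable ?M (indicator (E B) :: _ \<Rightarrow> real)" for B
    by (intro integrable_real_indicator E) (simp add: less_top[symmetric])
  have Xsq: "(X \<omega> - M)\<^sup>2 = (\<Sum>x\<in>torus N. indicator (E {x}) \<omega>) +
     (\<Sum>x\<in>torus N. \<Sum>y\<in>torus N - {x}. indicator (E {x, y}) \<omega>) - 2 * M * (\<Sum>x\<in>torus N. indicator (E {x}) \<omega>) + M\<^sup>2" for \<omega>
  proof -
    have "X \<omega> * X \<omega> = (\<Sum>x\<in>torus N. \<Sum>y\<in>torus N. indicator (E {x}) \<omega> * indicator (E {y}) \<omega>)"
      by (simp add: X_def sum_product)
    also have "\<dots> = (\<Sum>x\<in>torus N. indicator (E {x}) \<omega> + (\<Sum>y\<in>torus N - {x}. indicator (E {x, y}) \<omega>))"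
      by (intro sum.cong refl) (simp add: sum.remove[OF finite_torus] EE flip: indicator_inter_arith)
    finally show ?thesis
      by (simp add: power2_diff X_def power2_eq_square sum.distrib algebra_simps)
  qed
  have "expectation (\<lambda>\<omega>. (X \<omega> - M)\<^sup>2) = s + p - 2 * M * s + M\<^sup>2"
    unfolding Xsq s_def p_def
    by (simp add: int prob_space PE)
  moreover have "integrable ?M (\<lambda>\<omega>. (X \<omega> - M)\<^sup>2)"
    unfolding Xsq by (intro Bochner_Integration.integrable_add Bochner_Integration.integrable_diff
        integrable_mult_right Bochner_Integration.integrable_sum int) auto
  ultimately have markov: "\<P>(\<omega> in ?M. (X \<omega> - M)\<^sup>2 \<ge> (M - real k)\<^sup>2) \<le> (s + p - 2 * M * s + M\<^sup>2) / (M - real k)\<^sup>2"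
    using M integral_Markov_inequality_measure[of ?M "\<lambda>\<omega>. (X \<omega> - M)\<^sup>2" "{}" "(M - real k)\<^sup>2"] by simp
  let ?C = "\<Union>x\<in>torus N. \<Union>y\<in>{y\<in>torus N - {x}. torus_dist N x y \<le> r}. E {x, y}"
  have "measure ?M ?C \<le> (\<Sum>x\<in>torus N. measure ?M (\<Union>y\<in>{y\<in>torus N - {x}. torus_dist N x y \<le> r}. E {x, y}))"
    by (intro finite_measure_subadditive_finite finite_torus) (auto intro!: sets.finite_UN simp: finite_torus)
  also have "\<dots> \<le> (\<Sum>x\<in>torus N. \<Sum>y\<in>{y\<in>torus N - {x}. torus_dist N x y \<le> r}. measure ?M (E {x, y}))"
    by (intro sum_mono finite_measure_subadditive_finite) (auto simp: finite_torus)
  finally have C: "measure ?M ?C \<le> c" unfolding c_def PE .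
  have Csets: "?C \<in> sets ?M" by (intro sets.finite_UN) (auto simp: finite_torus)
  have cs: "AE \<omega> in ?M. covering_sample N \<omega>"
    by (rule AE_covering_sample[OF N]) (rule surv)
  have "AE \<omega> in ?M. \<omega> \<in> {\<omega> \<in> space ?M. \<exists>i j. 1 \<le> i \<and> i < j \<and> j \<le> k \<and>
      torus_dist N (last_visited N \<omega> i) (last_visited N \<omega> j) \<le> r} \<longrightarrow>
    \<omega> \<in> {\<omega> \<in> space ?M. (X \<omega> - M)\<^sup>2 \<ge> (M - real k)\<^sup>2} \<union> ?C"
    using cs AE_space
  proof eventually_elim
    case (elim \<omega>)
    interpret covering_sample N \<omega> by (rule elim)
    show ?case
    proof
      assume "\<omega> \<in> {\<omega> \<in> space ?M. \<exists>i j. 1 \<le> i \<and> i < j \<and> j \<le> k \<and>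
        torus_dist N (last_visited N \<omega> i) (last_visited N \<omega> j) \<le> r}"
      then obtain i j where "1 \<le> i" "i < j" "j \<le> k" "torus_dist N (last_visited N \<omega> i) (last_visited N \<omega> j) \<le> r"
        by blast
      from close_pair_cases[OF k this, of n]
      show "\<omega> \<in> {\<omega> \<in> space ?M. (X \<omega> - M)\<^sup>2 \<ge> (M - real k)\<^sup>2} \<union> ?C"
      proof
        assume "card (unvisited N \<omega> n) < k"
        then have "M - real k \<le> M - X \<omega>" by (simp add: X elim)
        then have "(M - real k)\<^sup>2 \<le> (M - X \<omega>)\<^sup>2" using M by (intro power_mono) auto
        then show ?thesis using elim by (simp add: power2_commute)
      next
        assume "\<exists>x\<in>unvisited N \<omega> n. \<exists>y\<in>unvisited N \<omega> n. x \<noteq> y \<and> torus_dist N x y \<le> r"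
        then obtain x y where xy: "x \<in> unvisited N \<omega> n" "y \<in> unvisited N \<omega> n" "x \<noteq> y" "torus_dist N x y \<le> r"
          by blast
        moreover have t: "x \<in> torus N" "y \<in> torus N" using xy by (auto simp: unvisited_def)
        moreover have "\<omega> \<in> E {x, y}"
          using xy unv[OF t(1) elim(2)] unv[OF t(2) elim(2)] EE[of x y] by blast
        ultimately show ?thesis by blast
      qed
    qed
  qed
  then have "\<P>(\<omega> in ?M. \<exists>i j. 1 \<le> i \<and> i < j \<and> j \<le> k \<and>
      torus_dist N (last_visited N \<omega> i) (last_visited N \<omega> j) \<le> r)
    \<le> measure ?M ({\<omega> \<in> space ?M. (X \<omega> - M)\<^sup>2 \<ge> (M - real k)\<^sup>2} \<union> ?C)"
    by (rule finite_measure_mono_AE) (intro sets.Un Csets, measurable)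
  also have "\<dots> \<le> \<P>(\<omega> in ?M. (X \<omega> - M)\<^sup>2 \<ge> (M - real k)\<^sup>2) + measure ?M ?C"
    by (intro measure_Un_le Csets) measurable
  also have "\<dots> \<le> (s + p - 2 * M * s + M\<^sup>2) / (M - real k)\<^sup>2 + c"
    by (intro add_mono markov C)
  finally show ?thesis .
qed

section \<open>The Green function of the torus\<close>

definition cyc :: "nat \<Rightarrow> int \<Rightarrow> nat" where
  "cyc N k = nat (min (k mod int N) (int N - k mod int N))"

text \<open>The sup-norm distance to the lattice of multiples of \<open>N\<close>;
  \<open>cyc\<close> is its one-dimensional version. Balls for the sup norm are products, hence easy
  to count.\<close>

definition snorm :: "nat \<Rightarrow> int ^ 'd::finite \<Rightarrow> nat" where
  "snorm N x = Max (range (\<lambda>i. cyc N (x $ i)))"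

lemma cyc_attained:
  assumes "N > 0"
  obtains z where "int (cyc N k) = \<bar>k - int N * z\<bar>"
proof (cases "k mod int N \<le> int N - k mod int N")
  case True
  have "int (cyc N k) = \<bar>k - int N * (k div int N)\<bar>"
    using True assms by (simp add: cyc_def minus_mult_div_eq_mod)
  then show ?thesis by (rule that)
next
  case False
  have "k mod int N < int N" using assms by simp
  have "k - int N * (k div int N + 1) = k mod int N - int N"
    by (simp add: algebra_simps minus_mult_div_eq_mod[symmetric])
  then have "int (cyc N k) = \<bar>k - int N * (k div int N + 1)\<bar>"
    using False \<open>k mod int N < int N\<close> by (simp add: cyc_def)
  then show ?thesis by (rule that)
qed

lemma cyc_le:
  assumes N: "N > 0"
  shows "int (cyc N k) \<le> \<bar>k - int N * z\<bar>"
proof -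
  define r where "r = k mod int N"
  define q where "q = k div int N - z"
  have r: "0 \<le> r" "r < int N" using N by (auto simp: r_def)
  have k: "k - int N * z = r + int N * q"
    by (simp add: r_def q_def algebra_simps)
  have "min r (int N - r) \<le> \<bar>r + int N * q\<bar>"
  proof (cases "q \<ge> 0")
    case True
    then have "int N * q \<ge> 0" by simp
    then show ?thesis using r by simp
  next
    case False
    then have "int N * q \<le> int N * (-1)" by (intro mult_left_mono) auto
    then show ?thesis using r by simp
  qed
  then show ?thesis unfolding k using r by (simp add: cyc_def r_def[symmetric])
qed

lemma cyc_le_N: "N > 0 \<Longrightarrow> 2 * cyc N k \<le> N"
  by (auto simp: cyc_def min_def)

lemma cyc_eq_0_iff:
  assumes "N > 0"
  shows "cyc N k = 0 \<longleftrightarrow> int N dvd k"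
proof -
  have "0 \<le> k mod int N" "k mod int N < int N" using assms by simp_all
  then show ?thesis by (auto simp: cyc_def min_def dvd_eq_mod_eq_0)
qed

lemma cyc_Lipschitz:
  assumes "N > 0"
  shows "int (cyc N k) \<le> int (cyc N l) + \<bar>k - l\<bar>"
proof -
  obtain z where "int (cyc N l) = \<bar>l - int N * z\<bar>" using cyc_attained[OF assms] by blast
  then show ?thesis using cyc_le[OF assms, of k z] by linarith
qed

lemma cyc_le_snorm: "cyc N (x $ i) \<le> snorm N x"
  unfolding snorm_def by (intro Max_ge) auto

lemma snorm_attained: obtains i where "snorm N x = cyc N (x $ i)"
proof -
  have "snorm N x \<in> range (\<lambda>i. cyc N (x $ i))"
    unfolding snorm_def by (intro Max_in) auto
  then show ?thesis using that by auto
qed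

lemma snorm_le_iff: "snorm N x \<le> r \<longleftrightarrow> (\<forall>i. cyc N (x $ i) \<le> r)"
  unfolding snorm_def by (subst Max_le_iff) auto

lemma snorm_le_N:
  assumes "N > 0"
  shows "snorm N x \<le> N"
proof -
  obtain i where "snorm N x = cyc N (x $ i)" by (rule snorm_attained)
  then show ?thesis using cyc_le_N[OF assms, of "x $ i"] by simp
qed

lemma torus_proj_0 [simp]: "torus_proj N 0 = 0"
  by (simp add: torus_proj_def vec_eq_iff)

lemma zero_in_torus: "N > 0 \<Longrightarrow> 0 \<in> torus N"
  by (simp add: torus_def)

lemma snorm_eq_0_iff: "N > 0 \<Longrightarrow> snorm N x = 0 \<longleftrightarrow> torus_proj N x = 0"
  using snorm_le_iff[of N x 0] torus_proj_eq_iff[of N x 0] by (simp add: cyc_eq_0_iff)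

lemma snorm_add_axis:
  assumes N: "N > 0"
  shows "snorm N x \<le> snorm N (x + axis i 1) + 1"
  unfolding snorm_le_iff
proof
  fix j
  have "int (cyc N (x $ j)) \<le> int (cyc N ((x + axis i 1) $ j)) + \<bar>x $ j - (x + axis i 1) $ j\<bar>"
    by (rule cyc_Lipschitz[OF N])
  also have "\<bar>x $ j - (x + axis i 1) $ j\<bar> \<le> 1" by (simp add: axis_def)
  finally show "cyc N (x $ j) \<le> snorm N (x + axis i 1) + 1"
    using cyc_le_snorm[of N "x + axis i 1" j] by linarith
qed

text \<open>The box is a product of d cyclic intervals, each contained in the image of {-r..r}
  modulo \<open>N\<close>.\<close>

lemma card_box_le:
  fixes x :: "int ^ 'd::finite"
  assumes N: "N > 0"
  shows "card {y \<in> torus N. snorm N (y - x) \<le> r} \<le> (2 * r + 1) ^ CARD('d)"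
proof -
  define B where "B i = {k. 0 \<le> k \<and> k < int N \<and> cyc N (k - x $ i) \<le> r}" for i
  have fin: "finite (B i)" for i
    by (rule finite_subset[of _ "{0..<int N}"]) (auto simp: B_def)
  have B: "card (B i) \<le> 2 * r + 1" for i
  proof -
    have "B i \<subseteq> (\<lambda>j. (x $ i + j) mod int N) ` {- int r..int r}"
    proof
      fix k assume k: "k \<in> B i"
      obtain z where z: "int (cyc N (k - x $ i)) = \<bar>k - x $ i - int N * z\<bar>"
        using cyc_attained[OF N] by blast
      have "(k + (- z) * int N) mod int N = k"
        using k by (simp only: B_def mem_Collect_eq mod_mult_self1) simp
      then have "k = (x $ i + (k - x $ i - int N * z)) mod int N"
        by (simp add: algebra_simps)
      moreover have "k - x $ i - int N * z \<in> {- int r..int r}"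
        using z k by (auto simp: B_def)
      ultimately show "k \<in> (\<lambda>j. (x $ i + j) mod int N) ` {- int r..int r}" by blast
    qed
    then have "card (B i) \<le> card {- int r..int r}"
      by (rule surj_card_le[rotated]) simp
    then show ?thesis by simp
  qed
  have "{y \<in> torus N. snorm N (y - x) \<le> r} = {y. \<forall>i. y $ i \<in> B i}"
    by (auto simp: torus_def snorm_le_iff B_def)
  then have "card {y \<in> torus N. snorm N (y - x) \<le> r} = (\<Prod>i\<in>UNIV. card (B i))"
    by (simp add: card_vec_product fin)
  also have "\<dots> \<le> (\<Prod>i\<in>(UNIV::'d set). 2 * r + 1)"
    using B by (intro prod_mono) auto
  finally show ?thesis by simp
qed

text \<open>For every lift the Euclidean norm dominates each coordinate. Euclidean balls thus sit
  inside boxes, which \<open>card_box_le\<close> counts.\<close>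

lemma snorm_le_torus_dist:
  assumes N: "N > 0"
  shows "real (snorm N (y - x)) \<le> torus_dist N x y"
  unfolding torus_dist_def
proof (rule cINF_greatest)
  fix z :: "int ^ 'a"
  obtain i where i: "snorm N (y - x) = cyc N ((y - x) $ i)" by (rule snorm_attained)
  have "int (cyc N ((y - x) $ i)) \<le> \<bar>x $ i - y $ i + int N * z $ i\<bar>"
    using cyc_le[OF N, of "(y - x) $ i" "z $ i"] by (simp add: algebra_simps abs_minus_commute)
  then have "real (snorm N (y - x)) \<le> \<bar>real_of_int (x $ i - y $ i + int N * z $ i)\<bar>"
    unfolding i by linarith
  also have "\<dots> \<le> norm (\<chi> i. real_of_int (x $ i - y $ i + int N * z $ i))"
    using component_le_norm_cart[of "\<chi> i. real_of_int (x $ i - y $ i + int N * z $ i)" i] by simp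
  finally show "real (snorm N (y - x)) \<le> norm (\<chi> i. real_of_int (x $ i - y $ i + int N * z $ i))" .
qed simp

text \<open>From sin x >= x - x^3 / 6 and x <= pi / 2 < 2. The constant 1 / 3 is good enough because
  pi / 3 >= 1, which leaves \<open>abs_sin_ge_cyc\<close> without a constant.\<close>

lemma sin_ge_third:
  fixes x :: real
  assumes "0 \<le> x" "x \<le> pi / 2"
  shows "x / 3 \<le> sin x"
proof -
  have "\<bar>sin x - (\<Sum>m<3. sin_coeff m * x ^ m)\<bar> \<le> inverse (fact 3) * \<bar>x\<bar> ^ 3"
    by (rule Maclaurin_sin_bound)
  moreover have "(\<Sum>m<3. sin_coeff m * x ^ m) = x"
    by (simp add: eval_nat_numeral sin_coeff_def)
  moreover have "inverse (fact 3) * \<bar>x\<bar> ^ 3 = x * x\<^sup>2 / 6"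
    using assms by (simp add: eval_nat_numeral)
  moreover have "x * x\<^sup>2 \<le> x * 2\<^sup>2"
    using assms pi_less_4 by (intro mult_left_mono power_mono) linarith+
  moreover have "x * 2\<^sup>2 = 4 * x" by simp
  ultimately show ?thesis by linarith
qed

lemma abs_sin_ge_cyc:
  assumes N: "N > 0"
  shows "real (cyc N k) / real N \<le> \<bar>sin (pi * real_of_int k / real N)\<bar>"
proof -
  obtain z where z: "int (cyc N k) = \<bar>k - int N * z\<bar>" using cyc_attained[OF N] by blast
  define c where "c = cyc N k"
  have "k = int N * z + int c \<or> k = int N * z - int c"
    using z by (auto simp: c_def abs_if split: if_splits)
  then have "pi * real_of_int k / real N = pi * real_of_int z + pi * real c / real N \<or>
      pi * real_of_int k / real N = pi * real_of_int z - pi * real c / real N"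
    using N by (elim disj_forward) (simp_all add: add_divide_distrib diff_divide_distrib distrib_left right_diff_distrib)
  moreover have "\<bar>sin (pi * real_of_int z + y)\<bar> = \<bar>sin y\<bar>" "\<bar>sin (pi * real_of_int z - y)\<bar> = \<bar>sin y\<bar>" for y
  proof -
    have s: "sin (pi * real_of_int z) = 0"
      by (metis mult.commute sin_zero_iff_int2)
    then have "\<bar>cos (pi * real_of_int z)\<bar> = 1"
      by (metis sin_zero_abs_cos_one)
    with s show "\<bar>sin (pi * real_of_int z + y)\<bar> = \<bar>sin y\<bar>" "\<bar>sin (pi * real_of_int z - y)\<bar> = \<bar>sin y\<bar>"
      by (simp_all add: sin_add sin_diff abs_mult)
  qed
  ultimately have eq: "\<bar>sin (pi * real_of_int k / real N)\<bar> = \<bar>sin (pi * real c / real N)\<bar>"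
    by auto
  have "2 * real c \<le> real N" using cyc_le_N[OF N, of k] unfolding c_def by linarith
  then have "pi * real c / real N \<le> pi / 2"
    using N by (simp add: field_simps)
  then have "pi * real c / real N / 3 \<le> sin (pi * real c / real N)"
    by (intro sin_ge_third) auto
  moreover have "real c / real N \<le> pi * real c / real N / 3"
    using mult_right_mono[of 3 pi "real c"] pi_gt3 N by (simp add: field_simps)
  ultimately show ?thesis unfolding eq c_def[symmetric] by linarith
qed

section \<open>Fourier analysis of the walk\<close>

definition symb :: "nat \<Rightarrow> int ^ 'd::finite \<Rightarrow> real" where
  "symb N \<xi> = (\<Sum>i\<in>UNIV. (sin (pi * real_of_int (\<xi> $ i) / real N))\<^sup>2)"

text \<open>
  For \<open>\<xi> = 0\<close> the division by zero gives 0, so that \<open>green\<close> below has no zero mode.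
\<close>

definition invsymb :: "nat \<Rightarrow> int ^ 'd::finite \<Rightarrow> real" where
  "invsymb N \<xi> = real CARD('d) / (2 * symb N \<xi>)"

definition phase :: "nat \<Rightarrow> int ^ 'd::finite \<Rightarrow> int ^ 'd \<Rightarrow> real" where
  "phase N \<xi> y = 2 * pi * real_of_int (\<Sum>i\<in>UNIV. \<xi> $ i * y $ i) / real N"

text \<open>The Green function of mean zero: the inverse of I - P on functions orthogonal to
  constants, expanded in characters. The cosines alone suffice since \<open>invsymb\<close> is
  even.\<close>

definition green :: "nat \<Rightarrow> int ^ 'd::finite \<Rightarrow> real" where
  "green N y = (\<Sum>\<xi>\<in>torus N. invsymb N \<xi> * cos (phase N \<xi> y)) / real (N ^ CARD('d))"

lemma phase_commute: "phase N \<xi> y = phase N y \<xi>"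
  by (simp add: phase_def mult.commute)

lemma phase_add_axis: "phase N \<xi> (y + axis i 1) = phase N \<xi> y + 2 * (pi * real_of_int (\<xi> $ i) / real N)"
proof -
  have "(\<Sum>j\<in>UNIV. \<xi> $ j * (y + axis i 1) $ j) = (\<Sum>j\<in>UNIV. \<xi> $ j * y $ j) + \<xi> $ i"
  proof -
    have "(\<Sum>j\<in>UNIV. \<xi> $ j * (y + axis i 1) $ j) = (\<Sum>j\<in>UNIV. \<xi> $ j * y $ j + (if j = i then \<xi> $ j else 0))"
      by (intro sum.cong) (auto simp: axis_def algebra_simps)
    also have "\<dots> = (\<Sum>j\<in>UNIV. \<xi> $ j * y $ j) + \<xi> $ i"
      unfolding sum.distrib by simp
    finally show ?thesis .
  qed
  then show ?thesis
    unfolding phase_def by (simp add: distrib_left add_divide_distrib del: of_int_sum)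
qed

lemma phase_diff_axis: "phase N \<xi> (y - axis i 1) = phase N \<xi> y - 2 * (pi * real_of_int (\<xi> $ i) / real N)"
  using phase_add_axis[of N \<xi> "y - axis i 1" i] by simp

lemma phase_minus: "phase N \<xi> (- y) = - phase N \<xi> y"
  by (simp add: phase_def sum_negf)

lemma phase_zero [simp]: "phase N \<xi> 0 = 0" "phase N 0 \<xi> = 0"
  by (simp_all add: phase_def)

lemma phase_torus_proj:
  assumes N: "N > 0"
  obtains q :: int where "phase N \<xi> (torus_proj N y) = phase N \<xi> y + 2 * pi * real_of_int q"
proof -
  have e: "torus_proj N y $ i = y $ i - int N * (y $ i div int N)" for i
    by (simp add: torus_proj_def minus_mult_div_eq_mod)
  have "(\<Sum>i\<in>UNIV. \<xi> $ i * torus_proj N y $ i) = (\<Sum>i\<in>UNIV. \<xi> $ i * y $ i) + int N * - (\<Sum>i\<in>UNIV. \<xi> $ i * (y $ i div int N))"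
    unfolding e by (simp add: right_diff_distrib sum_subtractf sum_distrib_left mult_ac)
  moreover have "2 * pi * real_of_int (a + int N * q) / real N = 2 * pi * real_of_int a / real N + 2 * pi * real_of_int q"
    for a q :: int
    using N by (simp add: field_simps)
  ultimately have "phase N \<xi> (torus_proj N y) = phase N \<xi> y + 2 * pi * real_of_int (- (\<Sum>i\<in>UNIV. \<xi> $ i * (y $ i div int N)))"
    unfolding phase_def by metis
  then show ?thesis by (rule that)
qed

lemma sin_add_2pi_int: "sin (x + 2 * pi * real_of_int q) = sin x" for x :: real
  by (simp add: sin_add)

lemma cos_add_2pi_int: "cos (x + 2 * pi * real_of_int q) = cos x" for x :: real
  by (simp add: cos_add)

lemma periodic_cos_phase:
  assumes N: "N > 0"
  shows "periodic N (\<lambda>y. cos (phase N \<xi> y))"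
  unfolding periodic_def by (metis phase_torus_proj[OF N] cos_add_2pi_int)

lemma periodic_sin_phase:
  assumes N: "N > 0"
  shows "periodic N (\<lambda>y. sin (phase N \<xi> y + c))"
  unfolding periodic_def
proof
  fix y
  obtain q :: int where "phase N \<xi> (torus_proj N y) = phase N \<xi> y + 2 * pi * real_of_int q"
    using phase_torus_proj[OF N] by blast
  then show "sin (phase N \<xi> (torus_proj N y) + c) = sin (phase N \<xi> y + c)"
    using sin_add_2pi_int[of "phase N \<xi> y + c" q] by (simp add: algebra_simps)
qed

text \<open>Summation by parts in the frequency: 2 sin t cos a = sin (a + t) - sin (a - t), and
  shifting the frequency by a unit vector turns the second sine into the first. A difference of f is
  thus exchanged for a factor of order |y_i| / N.\<close>

lemma sum_by_parts_phase:
  fixes f :: "int ^ 'd::finite \<Rightarrow> real"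
  assumes f: "periodic N f" and N: "N > 0"
  shows "2 * sin (pi * real_of_int (y $ i) / real N) * (\<Sum>\<xi>\<in>torus N. f \<xi> * cos (phase N \<xi> y)) =
    (\<Sum>\<xi>\<in>torus N. (f \<xi> - f (\<xi> + axis i 1)) * sin (phase N \<xi> y + pi * real_of_int (y $ i) / real N))"
proof -
  let ?t = "pi * real_of_int (y $ i) / real N"
  have "periodic N (\<lambda>\<xi>. sin (phase N y \<xi> + (- ?t)))" by (rule periodic_sin_phase[OF N])
  then have per: "periodic N (\<lambda>\<xi>. f \<xi> * sin (phase N y \<xi> + (- ?t)))"
    by (rule periodic_map2[OF f])
  have shift: "(\<Sum>\<xi>\<in>torus N. f \<xi> * sin (phase N \<xi> y - ?t)) = (\<Sum>\<xi>\<in>torus N. f (\<xi> + axis i 1) * sin (phase N \<xi> y + ?t))"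
    using sum_torus_translate[OF per N, of "axis i 1", symmetric]
    by (simp add: phase_commute[of N _ y] phase_add_axis algebra_simps)
  have "2 * sin ?t * (f \<xi> * cos (phase N \<xi> y)) = f \<xi> * sin (phase N \<xi> y + ?t) - f \<xi> * sin (phase N \<xi> y - ?t)" for \<xi>
    by (simp add: sin_add sin_diff algebra_simps)
  then show ?thesis
    unfolding sum_distrib_left left_diff_distrib sum_subtractf shift[symmetric] by (simp only: sum_subtractf)
qed

lemma sin_eq_0_dvd:
  assumes N: "N > 0" and "sin (pi * real_of_int k / real N) = 0"
  shows "int N dvd k"
  using abs_sin_ge_cyc[OF N, of k] assms by (simp add: divide_le_0_iff flip: cyc_eq_0_iff)

text \<open>Orthogonality of characters: for constant f, summation by parts has right side 0 while
  some sine factor on the left is nonzero.\<close>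

lemma sum_cos_phase:
  fixes y :: "int ^ 'd::finite"
  assumes N: "N > 0"
  shows "(\<Sum>\<xi>\<in>torus N. cos (phase N \<xi> y)) = (if torus_proj N y = 0 then real (N ^ CARD('d)) else 0)"
proof (cases "torus_proj N y = 0")
  case True
  have "cos (phase N \<xi> y) = 1" for \<xi>
    using periodic_cos_phase[OF N, of \<xi>] True unfolding periodic_def by (metis cos_zero phase_zero(1))
  then show ?thesis using True by (simp add: card_torus)
next
  case False
  then obtain i where i: "\<not> int N dvd y $ i"
    using torus_proj_eq_iff[of N y 0] by auto
  then have "sin (pi * real_of_int (y $ i) / real N) \<noteq> 0"
    using sin_eq_0_dvd[OF N] by blast
  moreover have "2 * sin (pi * real_of_int (y $ i) / real N) * (\<Sum>\<xi>\<in>torus N. cos (phase N \<xi> y)) = 0"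
    using sum_by_parts_phase[of N "\<lambda>_. 1" y i] N by (simp add: periodic_const)
  ultimately show ?thesis using False by simp
qed

lemma snorm_le_symb:
  assumes N: "N > 0"
  shows "(real (snorm N \<xi>) / real N)\<^sup>2 \<le> symb N \<xi>"
proof -
  obtain i where i: "snorm N \<xi> = cyc N (\<xi> $ i)" by (rule snorm_attained)
  have "(real (snorm N \<xi>) / real N)\<^sup>2 \<le> \<bar>sin (pi * real_of_int (\<xi> $ i) / real N)\<bar>\<^sup>2"
    unfolding i by (intro power_mono abs_sin_ge_cyc N) simp
  also have "\<dots> \<le> symb N \<xi>"
    unfolding symb_def power2_abs by (intro member_le_sum) auto
  finally show ?thesis .
qed

lemma symb_nonneg: "symb N \<xi> \<ge> 0"
  by (simp add: symb_def sum_nonneg)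

lemma symb_le: "symb N (\<xi> :: int ^ 'd::finite) \<le> real CARD('d)"
  unfolding symb_def using sum_mono[of UNIV "\<lambda>i. (sin (pi * real_of_int (\<xi> $ i) / real N))\<^sup>2" "\<lambda>_. 1"]
  by (simp add: abs_square_le_1)

lemma symb_pos: "N > 0 \<Longrightarrow> torus_proj N \<xi> \<noteq> 0 \<Longrightarrow> symb N \<xi> > 0"
  using snorm_le_symb[of N \<xi>] snorm_eq_0_iff[of N \<xi>]
  by (smt (verit) divide_eq_0_iff of_nat_0_eq_iff zero_less_power2 not_gr_zero)

lemma periodic_symb:
  assumes N: "N > 0"
  shows "periodic N (symb N :: int ^ 'd::finite \<Rightarrow> real)"
  unfolding periodic_def
proof
  fix x :: "int ^ 'd"
  have "(sin (pi * real_of_int (torus_proj N x $ i) / real N))\<^sup>2 = (sin (pi * real_of_int (x $ i) / real N))\<^sup>2" for i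
  proof -
    have sq: "2 * (sin (pi * real_of_int (u $ i) / real N))\<^sup>2 = 1 - cos (phase N (axis i 1) u)" for u :: "int ^ 'd"
      using cos_double_sin[of "pi * real_of_int (u $ i) / real N"]
      by (simp add: phase_def axis_def if_distrib if_distribR mult.assoc cong: if_cong)
    have "cos (phase N (axis i 1) (torus_proj N x)) = cos (phase N (axis i 1) x)"
      using periodic_cos_phase[OF N] unfolding periodic_def by blast
    then show ?thesis using sq[of "torus_proj N x"] sq[of x] by simp
  qed
  then show "symb N (torus_proj N x) = symb N x" by (simp add: symb_def)
qed

lemma symb_zero [simp]: "symb N 0 = 0" by (simp add: symb_def)

lemma symb_eq_0: "N > 0 \<Longrightarrow> torus_proj N \<xi> = 0 \<Longrightarrow> symb N \<xi> = 0"
  using periodic_symb[of N] unfolding periodic_def by (metis symb_zero)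

text \<open>Characters diagonalise the walk. Off the zero mode the eigenvalue of I - P is the
  reciprocal of \<open>invsymb\<close>.\<close>

lemma cos_phase_minus_avg:
  fixes \<xi> :: "int ^ 'd::finite"
  shows "cos (phase N \<xi> y) - avg (\<lambda>y. cos (phase N \<xi> y)) y = 2 * symb N \<xi> / real CARD('d) * cos (phase N \<xi> y)"
proof -
  have *: "cos (a + 2 * t) + cos (a - 2 * t) = 2 * cos a - 4 * (cos a * (sin t)\<^sup>2)" for a t :: real
  proof -
    have "cos (a + 2 * t) + cos (a - 2 * t) = 2 * cos a * cos (2 * t)"
      by (simp add: cos_add cos_diff)
    then show ?thesis unfolding cos_double_sin by (simp add: algebra_simps)
  qed
  then have "avg (\<lambda>y. cos (phase N \<xi> y)) y = (2 * real CARD('d) * cos (phase N \<xi> y) - 4 * (cos (phase N \<xi> y) * symb N \<xi>)) / (2 * real CARD('d))"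
    unfolding avg_def phase_add_axis phase_diff_axis symb_def *
    by (simp add: sum_subtractf sum_distrib_left)
  then show ?thesis by (simp add: field_simps)
qed

lemma avg_sum_scale: "avg (\<lambda>y. (\<Sum>\<xi>\<in>I. c \<xi> * f \<xi> y) / v) y = (\<Sum>\<xi>\<in>I. c \<xi> * avg (f \<xi>) y) / v"
proof -
  have "(\<Sum>i\<in>UNIV. (\<Sum>\<xi>\<in>I. c \<xi> * f \<xi> (y + axis i 1)) / v + (\<Sum>\<xi>\<in>I. c \<xi> * f \<xi> (y - axis i 1)) / v) =
      (\<Sum>i\<in>UNIV. \<Sum>\<xi>\<in>I. c \<xi> * (f \<xi> (y + axis i 1) + f \<xi> (y - axis i 1))) / v"
    by (simp add: sum.distrib distrib_left add_divide_distrib flip: sum_divide_distrib)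
  also have "\<dots> = (\<Sum>\<xi>\<in>I. c \<xi> * (\<Sum>i\<in>UNIV. f \<xi> (y + axis i 1) + f \<xi> (y - axis i 1))) / v"
    by (subst sum.swap) (simp add: sum_distrib_left)
  finally have eq: "(\<Sum>i\<in>UNIV. (\<Sum>\<xi>\<in>I. c \<xi> * f \<xi> (y + axis i 1)) / v + (\<Sum>\<xi>\<in>I. c \<xi> * f \<xi> (y - axis i 1)) / v) =
      (\<Sum>\<xi>\<in>I. c \<xi> * (\<Sum>i\<in>UNIV. f \<xi> (y + axis i 1) + f \<xi> (y - axis i 1))) / v" .
  show ?thesis unfolding avg_def eq by (simp add: mult.commute flip: sum_divide_distrib)
qed

text \<open>Applying I - P cancels \<open>invsymb\<close> mode by mode and leaves the Fourier series
  of the point mass at 0 without its zero mode, whose absence is the term -1 / V.\<close>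

lemma green_minus_avg:
  fixes y :: "int ^ 'd::finite"
  assumes N: "N > 0"
  shows "green N y - avg (green N) y = (if torus_proj N y = 0 then 1 else 0) - 1 / real (N ^ CARD('d))"
proof -
  have z: "(0 :: int ^ 'd) \<in> torus N" using N by (rule zero_in_torus)
  have "green N y - avg (green N) y = (\<Sum>\<xi>\<in>torus N. invsymb N \<xi> * (cos (phase N \<xi> y) - avg (\<lambda>y. cos (phase N \<xi> y)) y)) / real (N ^ CARD('d))"
    unfolding green_def[abs_def] avg_sum_scale by (simp add: right_diff_distrib sum_subtractf diff_divide_distrib)
  also have "(\<Sum>\<xi>\<in>torus N. invsymb N \<xi> * (cos (phase N \<xi> y) - avg (\<lambda>y. cos (phase N \<xi> y)) y)) =
      (\<Sum>\<xi>\<in>torus N - {0}. cos (phase N \<xi> y))"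
  proof (rule sum.mono_neutral_cong_right[OF finite_torus])
    show "torus N - {0} \<subseteq> torus N" by blast
    show "\<forall>\<xi>\<in>torus N - (torus N - {0}). invsymb N \<xi> * (cos (phase N \<xi> y) - avg (\<lambda>y. cos (phase N \<xi> y)) y) = 0"
      by (auto simp: invsymb_def)
    fix \<xi> :: "int ^ 'd" assume "\<xi> \<in> torus N - {0}"
    then have "symb N \<xi> > 0" by (intro symb_pos N) (auto simp: torus_proj_id)
    then show "invsymb N \<xi> * (cos (phase N \<xi> y) - avg (\<lambda>y. cos (phase N \<xi> y)) y) = cos (phase N \<xi> y)"
      unfolding cos_phase_minus_avg by (simp add: invsymb_def)
  qed
  also have "\<dots> = (if torus_proj N y = 0 then real (N ^ CARD('d)) else 0) - 1"
    using sum_cos_phase[OF N, of y] sum.remove[OF finite_torus z, of "\<lambda>\<xi>. cos (phase N \<xi> y)"] by simp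
  finally show ?thesis using N by (simp add: diff_divide_distrib)
qed

lemma periodic_green:
  assumes N: "N > 0"
  shows "periodic N (green N)"
  unfolding green_def[abs_def] periodic_def
  by (simp add: periodic_cos_phase[OF N, unfolded periodic_def, rule_format])

lemma green_minus: "green N (- y) = green N y"
  by (simp add: green_def phase_minus)

lemma sum_green:
  assumes N: "N > 0"
  shows "(\<Sum>y\<in>torus N. green N (y :: int ^ 'd::finite)) = 0"
proof -
  have "(\<Sum>y\<in>torus N. \<Sum>\<xi>\<in>torus N. invsymb N \<xi> * cos (phase N \<xi> (y :: int ^ 'd))) =
      (\<Sum>\<xi>\<in>torus N. invsymb N \<xi> * (\<Sum>y\<in>torus N. cos (phase N \<xi> (y :: int ^ 'd))))"
    by (subst sum.swap) (simp add: sum_distrib_left)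
  also have "\<dots> = (\<Sum>\<xi>\<in>torus N. invsymb N \<xi> * (\<Sum>y\<in>torus N. cos (phase N y (\<xi> :: int ^ 'd))))"
    by (simp only: phase_commute)
  also have "\<dots> = 0"
    by (intro sum.neutral ballI) (auto simp: sum_cos_phase[OF N] invsymb_def symb_eq_0[OF N])
  finally show ?thesis
    unfolding green_def by (simp flip: sum_divide_distrib)
qed

text \<open>Eigenvalues of I - P are at most 2, so each nonzero mode has weight at least 1 / 2, and
  1 - cos averages to 1 over the frequencies.\<close>

lemma green_gap:
  fixes y :: "int ^ 'd::finite"
  assumes N: "N > 0" and y: "torus_proj N y \<noteq> 0"
  shows "green N (0 :: int ^ 'd) - green N y \<ge> 1 / 2"
proof -
  define V where "V = real (N ^ CARD('d))"
  have V: "V > 0" using N by (simp add: V_def)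
  have "V / 2 = (\<Sum>\<xi>\<in>torus N. (1 - cos (phase N \<xi> y)) / 2)"
    using sum_cos_phase[OF N, of y] y by (simp add: sum_subtractf card_torus V_def flip: sum_divide_distrib)
  also have "\<dots> \<le> (\<Sum>\<xi>\<in>torus N. invsymb N \<xi> * (1 - cos (phase N \<xi> y)))"
  proof (rule sum_mono)
    fix \<xi> :: "int ^ 'd" assume \<xi>: "\<xi> \<in> torus N"
    show "(1 - cos (phase N \<xi> y)) / 2 \<le> invsymb N \<xi> * (1 - cos (phase N \<xi> y))"
    proof (cases "\<xi> = 0")
      case False
      then have "symb N \<xi> > 0" using \<xi> by (intro symb_pos N) (auto simp: torus_proj_id)
      then have "1 / 2 \<le> invsymb N \<xi>"
        using symb_le[of N \<xi>] by (simp add: invsymb_def field_simps)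
      then have "1 / 2 * (1 - cos (phase N \<xi> y)) \<le> invsymb N \<xi> * (1 - cos (phase N \<xi> y))"
        by (rule mult_right_mono) simp
      then show ?thesis by simp
    qed simp
  qed
  also have "\<dots> = V * (green N (0 :: int ^ 'd) - green N y)"
    unfolding green_def V_def[symmetric] using V by (simp add: right_diff_distrib sum_subtractf)
  finally show ?thesis using V by simp
qed

text \<open>Sum the gap over y: as \<open>green\<close> has mean zero, V g(0) is at least (V - 1) /
  2.\<close>

lemma green_0_ge:
  assumes N: "N \<ge> 2"
  shows "green N (0 :: int ^ 'd::finite) \<ge> 1 / 4"
proof -
  have N0: "N > 0" using N by simp
  define V where "V = real (N ^ CARD('d))"
  have V: "V \<ge> 2"
  proof -
    have "N ^ 1 \<le> N ^ CARD('d)" using N by (intro power_increasing) (auto simp: Suc_leI)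
    then have "2 \<le> N ^ CARD('d)" using N by simp
    then show ?thesis unfolding V_def by linarith
  qed
  have z: "(0 :: int ^ 'd) \<in> torus N" using N0 by (rule zero_in_torus)
  have "(\<Sum>y\<in>torus N - {0 :: int ^ 'd}. 1 / 2) \<le> (\<Sum>y\<in>torus N - {0}. green N (0 :: int ^ 'd) - green N (y :: int ^ 'd))"
    by (intro sum_mono green_gap N0) (auto simp: torus_proj_id)
  also have "\<dots> = (\<Sum>y\<in>torus N. green N (0 :: int ^ 'd) - green N (y :: int ^ 'd))"
    by (simp add: sum.remove[OF finite_torus z])
  also have "\<dots> = V * green N (0 :: int ^ 'd)"
    using sum_green[OF N0, where 'd = 'd] by (simp add: sum_subtractf card_torus V_def)
  also have "(\<Sum>y\<in>torus N - {0 :: int ^ 'd}. 1 / 2) = (V - 1) / (2 :: real)"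
    using z N0 by (simp add: card_Diff_singleton card_torus V_def of_nat_diff Suc_leI)
  finally have "(V - 1) / 2 \<le> V * green N (0 :: int ^ 'd)" .
  moreover have "V * (1 / 4) \<le> (V - 1) / 2" using V by simp
  ultimately have "V * (1 / 4) \<le> V * green N (0 :: int ^ 'd)" by linarith
  then show ?thesis using V by (simp only: mult_le_cancel_left_pos)
qed

section \<open>Inverse-power sums over the torus\<close>

lemma inverse_power_step:
  assumes "n \<ge> 1"
  shows "1 / real n ^ p \<le> real p / real n ^ (p + 1) + 1 / real (Suc n) ^ p"
proof -
  have n: "real n > 0" using assms by simp
  have "1 - real p / real n \<le> 1 + real p * (- 1 / real (Suc n))"
    using n by (simp add: frac_le)
  also have "\<dots> \<le> (1 + (- 1 / real (Suc n))) ^ p"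
    by (intro Bernoulli_inequality) simp
  also have "1 + (- 1 / real (Suc n)) = real n / real (Suc n)"
    by (simp add: field_simps)
  finally have "(1 - real p / real n) / real n ^ p \<le> (real n / real (Suc n)) ^ p / real n ^ p"
    by (rule divide_right_mono) simp
  also have "\<dots> = 1 / real (Suc n) ^ p"
    using n by (simp add: power_divide)
  finally show ?thesis
    using n by (simp add: diff_divide_distrib)
qed

lemma inverse_power_tail:
  assumes "1 \<le> m" "m \<le> n"
  shows "1 / real m ^ p \<le> (\<Sum>r\<in>{m..<n}. real p / real r ^ (p + 1)) + 1 / real n ^ p"
  using assms(2)
proof (induction n rule: dec_induct)
  case (step n)
  then show ?case using inverse_power_step[of n p] assms(1) by simp
qed simp

text \<open>A layer-cake argument: telescoping bounds each inverse power by a sum over radii r at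
  least the norm, and exchanging the sums leaves only box counts. The origin contributes nothing
  because 1 / 0 is 0.\<close>

lemma sum_inverse_snorm_power:
  assumes N: "N > 0" and p: "p \<ge> 1"
  shows "(\<Sum>\<xi>\<in>torus N. 1 / real (snorm N (\<xi> :: int ^ 'd::finite)) ^ p) \<le>
    (\<Sum>r\<in>{1..<N}. real p / real r ^ (p + 1) * real ((2 * r + 1) ^ CARD('d))) + real (N ^ CARD('d)) / real N ^ p"
proof -
  let ?a = "\<lambda>r. real p / real r ^ (p + 1)"
  have "1 / real (snorm N \<xi>) ^ p \<le> (\<Sum>r\<in>{1..<N}. if snorm N \<xi> \<le> r then ?a r else 0) + 1 / real N ^ p" for \<xi> :: "int ^ 'd"
  proof (cases "snorm N \<xi> = 0")
    case True
    then show ?thesis using p by (simp add: power_0_left sum_nonneg)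
  next
    case False
    have "(\<Sum>r\<in>{1..<N}. if snorm N \<xi> \<le> r then ?a r else 0) = (\<Sum>r\<in>{snorm N \<xi>..<N}. ?a r)"
      using False by (intro sum.mono_neutral_cong_right) auto
    then show ?thesis
      using inverse_power_tail[OF _ snorm_le_N[OF N], of \<xi> p] False by simp
  qed
  then have "(\<Sum>\<xi>\<in>torus N. 1 / real (snorm N (\<xi> :: int ^ 'd)) ^ p) \<le>
      (\<Sum>\<xi>\<in>torus N. (\<Sum>r\<in>{1..<N}. if snorm N (\<xi> :: int ^ 'd) \<le> r then ?a r else 0) + 1 / real N ^ p)"
    by (rule sum_mono)
  also have "\<dots> = (\<Sum>r\<in>{1..<N}. \<Sum>\<xi>\<in>torus N. if snorm N (\<xi> :: int ^ 'd) \<le> r then ?a r else 0) + real (N ^ CARD('d)) / real N ^ p"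
    unfolding sum.distrib by (subst sum.swap) (simp add: card_torus)
  also have "(\<Sum>r\<in>{1..<N}. \<Sum>\<xi>\<in>torus N. if snorm N (\<xi> :: int ^ 'd) \<le> r then ?a r else 0) \<le>
      (\<Sum>r\<in>{1..<N}. ?a r * real ((2 * r + 1) ^ CARD('d)))"
  proof (rule sum_mono)
    fix r
    have "(\<Sum>\<xi>\<in>torus N. if snorm N (\<xi> :: int ^ 'd) \<le> r then ?a r else 0) =
        real (card {\<xi>\<in>torus N. snorm N (\<xi> :: int ^ 'd) \<le> r}) * ?a r"
      by (simp add: sum.If_cases finite_torus Int_def)
    also have "\<dots> \<le> real ((2 * r + 1) ^ CARD('d)) * ?a r"
      using card_box_le[OF N, of "0 :: int ^ 'd" r] by (intro mult_right_mono) (simp_all del: of_nat_power)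
    finally show "(\<Sum>\<xi>\<in>torus N. if snorm N (\<xi> :: int ^ 'd) \<le> r then ?a r else 0) \<le> ?a r * real ((2 * r + 1) ^ CARD('d))"
      by (simp add: mult.commute)
  qed
  finally show ?thesis by simp
qed

text \<open>Reduces every dimension to the case d = 3: the surplus r^(d - 3) is traded for N^(d -
  3), so the radial sums become sums of r^3 / r^3 or r^3 / r^4.\<close>

lemma card_box_scaled:
  assumes d: "d \<ge> 3" and r: "1 \<le> r" "r \<le> N"
  shows "real ((2 * r + 1) ^ d) \<le> 3 ^ d * real N ^ (d - 3) * real r ^ 3"
proof -
  have "real ((2 * r + 1) ^ d) \<le> (3 * real r) ^ d"
    unfolding of_nat_power using r by (intro power_mono) auto
  also have "\<dots> = 3 ^ d * (real r ^ (d - 3) * real r ^ 3)"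
    using d by (simp add: power_mult_distrib flip: power_add)
  also have "\<dots> \<le> 3 ^ d * (real N ^ (d - 3) * real r ^ 3)"
    using r by (intro mult_left_mono mult_right_mono power_mono) auto
  finally show ?thesis by simp
qed

lemma sum_inverse_le_ln: "N \<ge> 1 \<Longrightarrow> (\<Sum>r\<in>{1..<N}. 1 / real r) \<le> 1 + ln (real N)"
proof -
  assume N: "N \<ge> 1"
  have "(\<Sum>r\<in>{1..<N}. 1 / real r) \<le> (\<Sum>r\<in>{1..N}. 1 / real r)"
    by (intro sum_mono2) auto
  also have "\<dots> = harm N" by (simp add: harm_def inverse_eq_divide)
  also have "\<dots> \<le> 1 + ln (real N)"
    using euler_mascheroni_sequence_decreasing[of 1 N] N by (simp add: harm_expand)
  finally show ?thesis .
qed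

lemma sum_inverse_snorm_2:
  assumes N: "N > 0" and d: "CARD('d::finite) \<ge> 3"
  shows "(\<Sum>\<xi>\<in>torus N. 1 / real (snorm N (\<xi> :: int ^ 'd)) ^ 2) \<le> 3 * 3 ^ CARD('d) * real N ^ (CARD('d) - 3) * real N"
proof -
  let ?K = "3 ^ CARD('d) * real N ^ (CARD('d) - 3)"
  have "(\<Sum>r\<in>{1..<N}. real 2 / real r ^ (2 + 1) * real ((2 * r + 1) ^ CARD('d))) \<le> (\<Sum>r\<in>{1..<N}. 2 * ?K)"
  proof (rule sum_mono)
    fix r assume r: "r \<in> {1..<N}"
    have "real 2 / real r ^ (2 + 1) * real ((2 * r + 1) ^ CARD('d)) \<le> real 2 / real r ^ (2 + 1) * (?K * real r ^ 3)"
      using card_box_scaled[OF d, of r N] r by (intro mult_left_mono) auto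
    also have "\<dots> = 2 * ?K" using r by (simp add: field_simps eval_nat_numeral)
    finally show "real 2 / real r ^ (2 + 1) * real ((2 * r + 1) ^ CARD('d)) \<le> 2 * ?K" .
  qed
  also have "\<dots> \<le> 2 * ?K * real N" using N by (simp add: mult.commute[of _ "real N"] mult_right_mono of_nat_diff algebra_simps)
  finally have 1: "(\<Sum>r\<in>{1..<N}. real 2 / real r ^ (2 + 1) * real ((2 * r + 1) ^ CARD('d))) \<le> 2 * ?K * real N" .
  have "CARD('d) = (CARD('d) - 3) + 1 + 2" using d by simp
  then have "real (N ^ CARD('d)) = real N ^ (CARD('d) - 3) * real N * real N ^ 2"
    by (metis of_nat_power power_add power_one_right)
  then have "real (N ^ CARD('d)) / real N ^ 2 = 1 * real N ^ (CARD('d) - 3) * real N"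
    using N by simp
  also have "\<dots> \<le> ?K * real N"
    by (intro mult_right_mono) auto
  finally show ?thesis
    using 1 sum_inverse_snorm_power[OF N, of 2, where 'd = 'd] by simp
qed

text \<open>The logarithm is the harmonic sum of r^3 / r^4. It is genuine for d = 3 and an artefact
  of \<open>card_box_scaled\<close> for d > 3.\<close>

lemma sum_inverse_snorm_3:
  assumes N: "N > 0" and d: "CARD('d::finite) \<ge> 3"
  shows "(\<Sum>\<xi>\<in>torus N. 1 / real (snorm N (\<xi> :: int ^ 'd)) ^ 3) \<le> 4 * 3 ^ CARD('d) * real N ^ (CARD('d) - 3) * (1 + ln (real N))"
proof -
  let ?K = "3 ^ CARD('d) * real N ^ (CARD('d) - 3)"
  have "(\<Sum>r\<in>{1..<N}. real 3 / real r ^ (3 + 1) * real ((2 * r + 1) ^ CARD('d))) \<le> (\<Sum>r\<in>{1..<N}. 3 * ?K * (1 / real r))"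
  proof (rule sum_mono)
    fix r assume r: "r \<in> {1..<N}"
    have "real 3 / real r ^ (3 + 1) * real ((2 * r + 1) ^ CARD('d)) \<le> real 3 / real r ^ (3 + 1) * (?K * real r ^ 3)"
      using card_box_scaled[OF d, of r N] r by (intro mult_left_mono) auto
    also have "\<dots> = 3 * ?K * (1 / real r)" using r by (simp add: field_simps eval_nat_numeral)
    finally show "real 3 / real r ^ (3 + 1) * real ((2 * r + 1) ^ CARD('d)) \<le> 3 * ?K * (1 / real r)" .
  qed
  also have "\<dots> = 3 * ?K * (\<Sum>r\<in>{1..<N}. 1 / real r)" by (rule sum_distrib_left[symmetric])
  also have "\<dots> \<le> 3 * ?K * (1 + ln (real N))"
    using sum_inverse_le_ln[of N] N by (intro mult_left_mono) auto
  finally have 1: "(\<Sum>r\<in>{1..<N}. real 3 / real r ^ (3 + 1) * real ((2 * r + 1) ^ CARD('d))) \<le> 3 * ?K * (1 + ln (real N))" .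
  have "CARD('d) = (CARD('d) - 3) + 3" using d by simp
  then have "real (N ^ CARD('d)) = real N ^ (CARD('d) - 3) * real N ^ 3"
    by (metis of_nat_power power_add)
  then have "real (N ^ CARD('d)) / real N ^ 3 = 1 * real N ^ (CARD('d) - 3) * 1"
    using N by simp
  also have "\<dots> \<le> ?K * (1 + ln (real N))"
    using N by (intro mult_mono) auto
  finally show ?thesis
    using 1 sum_inverse_snorm_power[OF N, of 3, where 'd = 'd] by simp
qed

section \<open>Size, regularity and decay of the Green function\<close>

lemma invsymb_le:
  assumes N: "N > 0"
  shows "invsymb N (\<xi> :: int ^ 'd::finite) \<le> real CARD('d) * real N ^ 2 / 2 * (1 / real (snorm N \<xi>) ^ 2)"
proof (cases "snorm N \<xi> = 0")
  case True
  then have "symb N \<xi> = 0" using symb_eq_0[OF N] snorm_eq_0_iff[OF N] by blast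
  then show ?thesis by (simp add: invsymb_def True)
next
  case False
  then have "symb N \<xi> > 0" using symb_pos[OF N, of \<xi>] snorm_eq_0_iff[OF N, of \<xi>] by simp
  then have "real CARD('d) / (2 * symb N \<xi>) \<le> real CARD('d) / (2 * (real (snorm N \<xi>) / real N)\<^sup>2)"
    using snorm_le_symb[OF N, of \<xi>] False N by (intro divide_left_mono mult_pos_pos) auto
  then show ?thesis by (simp add: invsymb_def power_divide field_simps)
qed

lemma invsymb_nonneg: "invsymb N \<xi> \<ge> 0"
  by (simp add: invsymb_def symb_nonneg)

text \<open>Only one coordinate changes, and the difference of squared sines factors. The sum factor
  is small where \<open>symb\<close> is small, reflecting the quadratic zero at the origin.\<close>

lemma symb_diff:
  "\<bar>symb N (\<xi> + axis i 1) - symb N \<xi>\<bar> \<le> pi / real N * (2 * sqrt (symb N \<xi>) + pi / real N)"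
proof -
  define a where "a = pi * real_of_int (\<xi> $ i) / real N"
  define t where "t = pi / real N"
  have t: "t \<ge> 0" by (simp add: t_def)
  let ?s = "\<lambda>x j. (sin (pi * real_of_int (x $ j) / real N))\<^sup>2"
  have "symb N (\<xi> + axis i 1) - symb N \<xi> = (\<Sum>j\<in>UNIV. ?s (\<xi> + axis i 1) j - ?s \<xi> j)"
    by (simp add: symb_def sum_subtractf)
  also have "\<dots> = (\<Sum>j\<in>{i}. ?s (\<xi> + axis i 1) j - ?s \<xi> j)"
    by (rule sum.mono_neutral_right) (auto simp: axis_def)
  also have "\<dots> = (sin (a + t))\<^sup>2 - (sin a)\<^sup>2"
    by (simp add: a_def t_def distrib_left add_divide_distrib)
  also have "\<dots> = (sin (a + t) - sin a) * (sin (a + t) + sin a)"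
    by (simp add: power2_eq_square algebra_simps)
  finally have eq: "\<bar>symb N (\<xi> + axis i 1) - symb N \<xi>\<bar> = \<bar>sin (a + t) - sin a\<bar> * \<bar>sin (a + t) + sin a\<bar>"
    by (simp add: abs_mult)
  have 1: "\<bar>sin (a + t) - sin a\<bar> \<le> t"
  proof -
    have "sin (a + t) - sin a = 2 * sin (t / 2) * cos (a + t / 2)"
      using sin_diff_sin[of "a + t" a] by (simp add: add_divide_distrib algebra_simps)
    then have "\<bar>sin (a + t) - sin a\<bar> \<le> 2 * \<bar>sin (t / 2)\<bar> * 1"
      by (simp add: abs_mult mult_left_le)
    also have "\<dots> \<le> t" using abs_sin_x_le_abs_x[of "t / 2"] t by simp
    finally show ?thesis .
  qed
  have "\<bar>sin a\<bar> = sqrt ((sin a)\<^sup>2)" by simp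
  also have "\<dots> \<le> sqrt (symb N \<xi>)"
    unfolding symb_def a_def
    by (intro real_sqrt_le_mono member_le_sum[of i UNIV "\<lambda>i. (sin (pi * real_of_int (\<xi> $ i) / real N))\<^sup>2"]) auto
  finally have "\<bar>sin a\<bar> \<le> sqrt (symb N \<xi>)" .
  with 1 have "\<bar>sin (a + t) + sin a\<bar> \<le> 2 * sqrt (symb N \<xi>) + t" by linarith
  with 1 show ?thesis unfolding eq t_def[symmetric] by (intro mult_mono) (use t in auto)
qed

text \<open>The discrete gradient of a function like |x|^(-2) is of order |x|^(-3). The constant is
  4 * 6 from \<open>symb_diff\<close> with pi < 4, times 4 from the neighbour's norm, times 1 / 2
  from \<open>invsymb\<close>.\<close>

lemma invsymb_diff:
  fixes \<xi> :: "int ^ 'd::finite"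
  assumes N: "N > 0" and m: "snorm N \<xi> > 0"
  shows "\<bar>invsymb N \<xi> - invsymb N (\<xi> + axis i 1)\<bar> \<le> 48 * real CARD('d) * real N ^ 2 * (1 / real (snorm N \<xi>) ^ 3)"
proof -
  let ?d = "real CARD('d)" and ?m = "real (snorm N \<xi>)"
  let ?w = "symb N \<xi>" and ?w' = "symb N (\<xi> + axis i 1)"
  have m1: "?m \<ge> 1" using m by simp
  have Npos: "real N > 0" using N by simp
  show ?thesis
  proof (cases "snorm N (\<xi> + axis i 1) = 0")
    \<comment> \<open>The neighbour is the zero mode, where \<open>invsymb\<close> has the default
      value 0; then the norm of the frequency is 1 and the plain size bound suffices.\<close>
    case True
    then have "?m = 1" using snorm_add_axis[OF N, of \<xi> i] m by simp
    moreover have "?w' = 0" using True symb_eq_0[OF N] snorm_eq_0_iff[OF N] by blast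
    moreover have "?d * real N ^ 2 / 2 \<le> 48 * ?d * real N ^ 2" by simp
    ultimately show ?thesis
      using invsymb_le[OF N, of \<xi>] invsymb_nonneg[of N \<xi>] by (simp add: invsymb_def)
  next
    case False
    \<comment> \<open>A nonzero neighbour has norm at least 1, so losing 1 at most halves the
      norm.\<close>
    have m': "?m \<le> 2 * real (snorm N (\<xi> + axis i 1))"
      using snorm_add_axis[OF N, of \<xi> i] False by linarith
    have w: "(?m / real N)\<^sup>2 \<le> ?w" by (rule snorm_le_symb[OF N])
    have w': "(?m / real N)\<^sup>2 / 4 \<le> ?w'"
    proof -
      have "(?m / real N)\<^sup>2 \<le> (2 * real (snorm N (\<xi> + axis i 1)) / real N)\<^sup>2"
        using m' by (intro power_mono divide_right_mono) auto
      also have "\<dots> = 4 * (real (snorm N (\<xi> + axis i 1)) / real N)\<^sup>2"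
        by (simp add: power_divide power_mult_distrib)
      also have "\<dots> \<le> 4 * ?w'" using snorm_le_symb[OF N, of "\<xi> + axis i 1"] by simp
      finally show ?thesis by simp
    qed
    have mN: "?m / real N > 0" using m1 Npos by simp
    then have pos: "?w > 0" "?w' > 0"
      using w w' by (smt (verit) zero_less_power divide_pos_pos)+
    have sq: "?m / real N \<le> sqrt ?w" using w by (intro real_le_rsqrt)
    then have "1 / real N \<le> sqrt ?w" using m1 Npos by (smt (verit) divide_right_mono)
    then have "pi / real N \<le> 4 * sqrt ?w"
      using pi_less_4 Npos mult_mono[of pi 4 "1 / real N" "sqrt ?w"] by simp
    then have "2 * sqrt ?w + pi / real N \<le> 6 * sqrt ?w" by simp
    then have "pi / real N * (2 * sqrt ?w + pi / real N) \<le> pi / real N * (6 * sqrt ?w)"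
      by (rule mult_left_mono) simp
    with symb_diff[of N \<xi> i] have "\<bar>?w' - ?w\<bar> \<le> pi / real N * (6 * sqrt ?w)"
      by (rule order.trans)
    also have "\<dots> \<le> 4 / real N * (6 * sqrt ?w)"
      using pi_less_4 pos by (intro mult_right_mono divide_right_mono) auto
    finally have dw: "\<bar>?w' - ?w\<bar> \<le> 24 * sqrt ?w / real N" by simp
    have "invsymb N \<xi> - invsymb N (\<xi> + axis i 1) = ?d / 2 * ((?w' - ?w) / (?w * ?w'))"
      using pos by (simp add: invsymb_def field_simps)
    then have "\<bar>invsymb N \<xi> - invsymb N (\<xi> + axis i 1)\<bar> = ?d / 2 * (\<bar>?w' - ?w\<bar> / (?w * ?w'))"
      using pos by (simp add: abs_mult)
    also have "\<dots> \<le> ?d / 2 * ((24 * sqrt ?w / real N) / (?w * ?w'))"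
      using dw pos by (intro mult_left_mono divide_right_mono) auto
    also have "(24 * sqrt ?w / real N) / (?w * ?w') = 24 / real N / (sqrt ?w * ?w')"
    proof -
      have "?w = sqrt ?w * sqrt ?w" using pos by simp
      then show ?thesis using pos by (simp add: divide_simps) 
    qed
    also have "\<dots> \<le> 24 / real N / (?m / real N * ((?m / real N)\<^sup>2 / 4))"
      using sq w' mN pos Npos m by (intro divide_left_mono mult_mono mult_pos_pos) auto
    also have "\<dots> = 96 * real N ^ 2 * (1 / ?m ^ 3)"
      using m1 Npos by (simp add: field_simps power2_eq_square power3_eq_cube)
    finally show ?thesis by simp
  qed
qed

text \<open>Transience: for d >= 3 the sum of |x|^(-2) over the frequencies is of order V / N^2, so
  g(0) stays bounded in \<open>N\<close>.\<close>

lemma green_0_le: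
  assumes N: "N > 0" and d: "CARD('d::finite) \<ge> 3"
  shows "green N (0 :: int ^ 'd) \<le> 2 * real CARD('d) * 3 ^ CARD('d)"
proof -
  have V: "real (N ^ CARD('d)) = real N ^ (CARD('d) - 3) * real N * real N ^ 2"
  proof -
    have "CARD('d) = (CARD('d) - 3) + 1 + 2" using d by simp
    then show ?thesis by (metis of_nat_power power_add power_one_right)
  qed
  have "(\<Sum>\<xi>\<in>torus N. invsymb N (\<xi> :: int ^ 'd)) \<le> (\<Sum>\<xi>\<in>torus N. real CARD('d) * real N ^ 2 / 2 * (1 / real (snorm N (\<xi> :: int ^ 'd)) ^ 2))"
    by (intro sum_mono invsymb_le N)
  also have "\<dots> = real CARD('d) * real N ^ 2 / 2 * (\<Sum>\<xi>\<in>torus N. 1 / real (snorm N (\<xi> :: int ^ 'd)) ^ 2)"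
    by (simp only: sum_distrib_left)
  also have "\<dots> \<le> real CARD('d) * real N ^ 2 / 2 * (3 * 3 ^ CARD('d) * real N ^ (CARD('d) - 3) * real N)"
    by (intro mult_left_mono sum_inverse_snorm_2 N d) simp
  also have "\<dots> = 3 / 2 * real CARD('d) * 3 ^ CARD('d) * real (N ^ CARD('d))"
    unfolding V by simp
  finally have "green N (0 :: int ^ 'd) \<le> 3 / 2 * real CARD('d) * 3 ^ CARD('d)"
    unfolding green_def using N by (simp add: divide_le_eq)
  also have "\<dots> \<le> 2 * real CARD('d) * 3 ^ CARD('d)"
    by (intro mult_right_mono) auto
  finally show ?thesis .
qed

text \<open>One summation by parts along the coordinate realising \<open>snorm N y\<close>. The sine
  gains |y| / N, and the total variation of \<open>invsymb\<close> costs the sum of |x|^(-3), which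
  brings in the logarithm.\<close>

lemma green_decay:
  fixes y :: "int ^ 'd::finite"
  assumes N: "N > 0" and d: "CARD('d) \<ge> 3"
  shows "\<bar>green N y\<bar> * real (snorm N y) \<le> 120 * real CARD('d) * 3 ^ CARD('d) * (1 + ln (real N))"
proof -
  define K where "K = 3 ^ CARD('d) * real N ^ (CARD('d) - 3) * (1 + ln (real N))"
  have Npos: "real N > 0" using N by simp
  have V: "real (N ^ CARD('d)) = real N ^ (CARD('d) - 3) * real N ^ 3"
  proof -
    have "CARD('d) = (CARD('d) - 3) + 3" using d by simp
    then show ?thesis by (metis of_nat_power power_add)
  qed
  have K1: "K \<ge> 1"
  proof -
    have "1 * 1 * 1 \<le> K" unfolding K_def using N by (intro mult_mono) (auto simp: one_le_power)
    then show ?thesis by simp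
  qed
  obtain i where i: "snorm N y = cyc N (y $ i)" by (rule snorm_attained)
  let ?s = "sin (pi * real_of_int (y $ i) / real N)"
  have per: "periodic N (invsymb N :: int ^ 'd \<Rightarrow> real)"
    unfolding invsymb_def[abs_def] by (rule periodic_map[OF periodic_symb[OF N]])
  have z: "(0 :: int ^ 'd) \<in> torus N" using N by (rule zero_in_torus)
  \<comment> \<open>The missing zero mode makes \<open>invsymb\<close> jump at the origin, outside
    the reach of \<open>invsymb_diff\<close>; the 48 merely matches the other terms.\<close>
  have z0: "\<bar>invsymb N (0 :: int ^ 'd) - invsymb N (0 + axis i 1)\<bar> \<le> 48 * real CARD('d) * real N ^ 2"
  proof -
    have "1 / real (snorm N (axis i 1 :: int ^ 'd)) ^ 2 \<le> 1"
      by (cases "snorm N (axis i 1 :: int ^ 'd)") (auto simp: divide_le_eq one_le_power)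
    then have "real CARD('d) * real N ^ 2 / 2 * (1 / real (snorm N (axis i 1 :: int ^ 'd)) ^ 2) \<le> real CARD('d) * real N ^ 2 / 2 * 1"
      by (rule mult_left_mono) simp
    also have "\<dots> \<le> 48 * real CARD('d) * real N ^ 2" by simp
    finally show ?thesis
      using invsymb_le[OF N, of "axis i 1 :: int ^ 'd"] invsymb_nonneg[of N "axis i 1 :: int ^ 'd"] by (simp add: invsymb_def)
  qed
  have "(\<Sum>\<xi>\<in>torus N. \<bar>invsymb N \<xi> - invsymb N (\<xi> + axis i 1)\<bar>) =
     \<bar>invsymb N (0 :: int ^ 'd) - invsymb N (0 + axis i 1)\<bar> + (\<Sum>\<xi>\<in>torus N - {0}. \<bar>invsymb N \<xi> - invsymb N (\<xi> + axis i 1)\<bar>)"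
    by (rule sum.remove[OF finite_torus z])
  also have "\<dots> \<le> 48 * real CARD('d) * real N ^ 2 +
      (\<Sum>\<xi>\<in>torus N - {0}. 48 * real CARD('d) * real N ^ 2 * (1 / real (snorm N (\<xi> :: int ^ 'd)) ^ 3))"
  proof (intro add_mono z0 sum_mono invsymb_diff N)
    fix \<xi> :: "int ^ 'd" assume "\<xi> \<in> torus N - {0}"
    then show "0 < snorm N \<xi>" using snorm_eq_0_iff[OF N, of \<xi>] by (auto simp: torus_proj_id)
  qed
  also have "(\<Sum>\<xi>\<in>torus N - {0}. 48 * real CARD('d) * real N ^ 2 * (1 / real (snorm N (\<xi> :: int ^ 'd)) ^ 3)) \<le>
      (\<Sum>\<xi>\<in>torus N. 48 * real CARD('d) * real N ^ 2 * (1 / real (snorm N (\<xi> :: int ^ 'd)) ^ 3))"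
    by (intro sum_mono2 finite_torus) auto
  also have "\<dots> = 48 * real CARD('d) * real N ^ 2 * (\<Sum>\<xi>\<in>torus N. 1 / real (snorm N (\<xi> :: int ^ 'd)) ^ 3)"
    by (simp only: sum_distrib_left)
  also have "\<dots> \<le> 48 * real CARD('d) * real N ^ 2 * (4 * 3 ^ CARD('d) * real N ^ (CARD('d) - 3) * (1 + ln (real N)))"
    by (intro mult_left_mono sum_inverse_snorm_3 N d) simp
  also have "\<dots> = 48 * real CARD('d) * real N ^ 2 * (4 * K)"
    by (simp add: K_def)
  also have "48 * real CARD('d) * real N ^ 2 + 48 * real CARD('d) * real N ^ 2 * (4 * K) = 48 * real CARD('d) * real N ^ 2 * (1 + 4 * K)"
    by (simp add: algebra_simps)
  also have "\<dots> \<le> 48 * real CARD('d) * real N ^ 2 * (5 * K)"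
    using K1 by (intro mult_left_mono) auto
  finally have total: "(\<Sum>\<xi>\<in>torus N. \<bar>invsymb N \<xi> - invsymb N (\<xi> + axis i 1)\<bar>) \<le> 240 * real CARD('d) * real N ^ 2 * K"
    by simp
  have "\<bar>2 * ?s * (\<Sum>\<xi>\<in>torus N. invsymb N \<xi> * cos (phase N \<xi> y))\<bar> \<le>
      (\<Sum>\<xi>\<in>torus N. \<bar>invsymb N \<xi> - invsymb N (\<xi> + axis i 1)\<bar>)"
    unfolding sum_by_parts_phase[OF per N]
    by (intro order.trans[OF sum_abs] sum_mono) (simp add: abs_mult mult_left_le)
  then have "2 * \<bar>?s\<bar> * \<bar>\<Sum>\<xi>\<in>torus N. invsymb N \<xi> * cos (phase N \<xi> y)\<bar> \<le> 240 * real CARD('d) * real N ^ 2 * K"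
    unfolding abs_mult abs_numeral using total by (rule order.trans)
  moreover have "\<bar>\<Sum>\<xi>\<in>torus N. invsymb N \<xi> * cos (phase N \<xi> y)\<bar> = \<bar>green N y\<bar> * real (N ^ CARD('d))"
    using Npos by (simp add: green_def abs_divide)
  moreover have "240 * real CARD('d) * real N ^ 2 * K = 240 * real CARD('d) * 3 ^ CARD('d) * (1 + ln (real N)) / real N * real (N ^ CARD('d))"
    unfolding V K_def using Npos by (simp add: field_simps power2_eq_square power3_eq_cube)
  ultimately have "(2 * \<bar>?s\<bar> * \<bar>green N y\<bar>) * real (N ^ CARD('d)) \<le> 240 * real CARD('d) * 3 ^ CARD('d) * (1 + ln (real N)) / real N * real (N ^ CARD('d))"
    by (simp only: mult_ac)
  then have "2 * \<bar>?s\<bar> * \<bar>green N y\<bar> \<le> 240 * real CARD('d) * 3 ^ CARD('d) * (1 + ln (real N)) / real N"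
    using Npos by (simp only: mult_le_cancel_right_pos of_nat_0_less_iff zero_less_power N)
  moreover have "2 * (real (snorm N y) / real N) * \<bar>green N y\<bar> \<le> 2 * \<bar>?s\<bar> * \<bar>green N y\<bar>"
    unfolding i by (intro mult_right_mono mult_left_mono abs_sin_ge_cyc N) auto
  ultimately have "2 * (real (snorm N y) / real N) * \<bar>green N y\<bar> \<le> 240 * real CARD('d) * 3 ^ CARD('d) * (1 + ln (real N)) / real N"
    by linarith
  then have "2 * real (snorm N y) * \<bar>green N y\<bar> \<le> 240 * real CARD('d) * 3 ^ CARD('d) * (1 + ln (real N))"
    using Npos by (simp add: divide_le_cancel)
  then show ?thesis by (simp add: mult_ac)
qed

section \<open>Survival estimates\<close>

lemma avg_translate: "avg (\<lambda>z. f (z - x)) z = avg f (z - x)"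
  by (simp add: avg_def algebra_simps)

lemma avg_plus: "avg (\<lambda>z. f z + g z) z = avg f z + avg g z"
  by (simp add: avg_def sum.distrib add_divide_distrib)

lemma avg_affine: "avg (\<lambda>z. a * (c - f z)) (z :: int ^ 'd::finite) = a * (c - avg f z)"
proof -
  have "(\<Sum>i\<in>UNIV. a * (c - f (z + axis i 1)) + a * (c - f (z - axis i 1))) =
      a * (2 * real CARD('d) * c - (\<Sum>i\<in>UNIV. f (z + axis i 1) + f (z - axis i 1)))"
  proof -
    have "(\<Sum>i\<in>UNIV. a * (c - f (z + axis i 1)) + a * (c - f (z - axis i 1))) =
        (\<Sum>i\<in>UNIV. 2 * a * c - a * (f (z + axis i 1) + f (z - axis i 1)))"
      by (intro sum.cong) (simp_all add: algebra_simps)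
    then show ?thesis
      unfolding sum_subtractf sum_distrib_left[symmetric] by (simp add: algebra_simps)
  qed
  then show ?thesis by (simp add: avg_def diff_divide_distrib right_diff_distrib)
qed

lemma torus_proj_diff_eq_0: "torus_proj N (z - x) = 0 \<longleftrightarrow> torus_proj N z = torus_proj N x"
  using torus_proj_eq_iff[of N "z - x" 0] torus_proj_eq_iff[of N z x] by simp

lemma one_less_dim_times_side_sq:
  assumes "N \<ge> 2" "CARD('d::finite) \<ge> 3"
  shows "(real CARD('d) * real N)\<^sup>2 > 1"
proof -
  have "2 * 2 \<le> real CARD('d) * real N" using assms by (intro mult_mono) auto
  then have "1\<^sup>2 < (real CARD('d) * real N)\<^sup>2" by (intro power_strict_mono) auto
  then show ?thesis by simp
qed

lemma volume_ge:
  assumes "N \<ge> 1" "CARD('d::finite) \<ge> 3"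
  shows "real (N ^ CARD('d)) \<ge> real N ^ 3"
  using assms by (simp add: power_increasing)

text \<open>Subtracting V times the translated Green function makes \<open>h\<close> vanish at x and
  turns the term -1 / V into the right side 1. Since \<open>green\<close> has mean zero, the mean of
  \<open>h\<close> is V g(0).\<close>

lemma survival_single:
  fixes x :: "int ^ 'd::finite"
  assumes N: "N \<ge> 2" and d: "CARD('d) \<ge> 3" and x: "x \<in> torus N"
  defines "t \<equiv> real (N ^ CARD('d)) * green N (0 :: int ^ 'd)" and "s \<equiv> (real CARD('d) * real N)\<^sup>2"
  shows "survival N (copies N {x}) (2 * n) \<le> (1 - 1 / (t + s)) ^ (2 * n)"
    and "(1 - 1 / t) ^ n - (1 - 1 / (t + s)) ^ n * sqrt (s / t) \<le> sqrt (survival N (copies N {x}) (2 * n))"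
proof -
  have N0: "N > 0" using N by simp
  define v where "v = real (N ^ CARD('d))"
  have v: "v > 0" using N0 by (simp add: v_def)
  define h where "h = (\<lambda>z. v * (green N (0 :: int ^ 'd) - green N (z - x)))"
  have xp: "torus_proj N x = x" using x by (rule torus_proj_id)
  have in_copies: "z \<in> copies N {x} \<longleftrightarrow> torus_proj N (z - x) = 0" for z
    by (simp add: copies_def torus_proj_diff_eq_0 xp)
  interpret K: killed_walk N "copies N {x}" h
  proof
    show "periodic N (\<lambda>z. z \<in> copies N {x})" by (rule periodic_copies[OF N0])
    show "periodic N h"
      unfolding h_def by (rule periodic_map[OF periodic_diff[OF periodic_green[OF N0]]])
    show "h z = 0" if "z \<in> copies N {x}" for z
      using that periodic_cong[OF periodic_green[OF N0], of "z - x" 0] by (simp add: h_def in_copies)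
    show "h z - avg h z = 1" if "z \<notin> copies N {x}" for z
    proof -
      have "h z - avg h z = - v * (green N (z - x) - avg (green N) (z - x))"
        unfolding h_def avg_affine avg_translate by (simp add: algebra_simps)
      then show ?thesis using that v unfolding in_copies green_minus_avg[OF N0] v_def[symmetric] by simp
    qed
  qed (rule N0)
  have "(\<Sum>z\<in>torus N. green N (z - x)) = 0"
    using sum_torus_translate[OF periodic_green[OF N0] N0, of "- x"] sum_green[OF N0, where 'd = 'd] by simp
  then have "(\<Sum>z\<in>torus N. h z) = v * (v * green N (0 :: int ^ 'd))"
    unfolding h_def sum_distrib_left[symmetric] by (simp add: sum_subtractf card_torus v_def)
  then have T: "K.T = t" using v by (simp add: K.T_def K.V_def v_def t_def)
  have S: "K.\<tau> = s" by (simp add: K.\<tau>_def s_def)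
  have t1: "t \<ge> 1"
  proof -
    have "8 \<le> real N ^ 3" using power_mono[of 2 "real N" 3] N by simp
    moreover have "real N ^ 3 \<le> real (N ^ CARD('d))" by (rule volume_ge) (use N d in auto)
    ultimately have "8 \<le> real (N ^ CARD('d))" by linarith
    then have "8 * (1 / 4) \<le> t" unfolding t_def by (intro mult_mono green_0_ge N) auto
    then show ?thesis by simp
  qed
  have s1: "s > 1" unfolding s_def by (rule one_less_dim_times_side_sq[OF N d])
  have b: "K.b > 0" using t1 s1 by (simp add: K.b_def T S divide_less_eq)
  show "survival N (copies N {x}) (2 * n) \<le> (1 - 1 / (t + s)) ^ (2 * n)"
    using K.survival_le[OF b, of n] by (simp add: K.b_def T S)
  show "(1 - 1 / t) ^ n - (1 - 1 / (t + s)) ^ n * sqrt (s / t) \<le> sqrt (survival N (copies N {x}) (2 * n))"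
    using K.survival_ge[OF b, of n] t1 by (simp add: K.b_def T S)
qed

text \<open>Evenness of \<open>green\<close> lets one constant make \<open>h\<close> vanish at both
  points. Two sources contribute -1 / V each, hence the factor 1 / 2. As g(y - x) may be negative,
  nonnegativity of \<open>t\<close> comes from the energy of \<open>h\<close>.\<close>

lemma survival_pair:
  fixes x y :: "int ^ 'd::finite"
  assumes N: "N \<ge> 2" and d: "CARD('d) \<ge> 3" and x: "x \<in> torus N" and y: "y \<in> torus N" and ne: "x \<noteq> y"
  defines "t \<equiv> real (N ^ CARD('d)) * (green N (0 :: int ^ 'd) + green N (y - x)) / 2"
    and "s \<equiv> (real CARD('d) * real N)\<^sup>2"
  shows "survival N (copies N {x, y}) (2 * n) \<le> (1 - 1 / (t + s)) ^ (2 * n)" and "t \<ge> 0"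
proof -
  have N0: "N > 0" using N by simp
  define v where "v = real (N ^ CARD('d))"
  have v: "v > 0" using N0 by (simp add: v_def)
  define h where "h = (\<lambda>z. v / 2 * ((green N (0 :: int ^ 'd) + green N (y - x)) - (green N (z - x) + green N (z - y))))"
  have xp: "torus_proj N x = x" "torus_proj N y = y" using x y by (auto intro: torus_proj_id)
  have in_copies: "z \<in> copies N {x, y} \<longleftrightarrow> torus_proj N (z - x) = 0 \<or> torus_proj N (z - y) = 0" for z
    by (auto simp: copies_def torus_proj_diff_eq_0 xp)
  have sym: "green N (x - y) = green N (y - x)" using green_minus[of N "y - x"] by simp
  interpret K: killed_walk N "copies N {x, y}" h
  proof
    show "periodic N (\<lambda>z. z \<in> copies N {x, y})" by (rule periodic_copies[OF N0])
    show "periodic N h"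
      unfolding h_def
      by (rule periodic_map[OF periodic_map2[OF periodic_diff[OF periodic_green[OF N0]] periodic_diff[OF periodic_green[OF N0]]]])
    show "h z = 0" if "z \<in> copies N {x, y}" for z
    proof -
      have cong: "green N (z - w) = green N (u - w)" if "torus_proj N (z - u) = 0" for u w :: "int ^ 'd"
      proof (rule periodic_cong[OF periodic_green[OF N0]])
        show "torus_proj N (z - w) = torus_proj N (u - w)"
          using that torus_proj_eq_iff[of N "z - w" "u - w"] torus_proj_eq_iff[of N "z - u" 0] by simp
      qed
      from that show ?thesis unfolding in_copies
      proof
        assume "torus_proj N (z - x) = 0"
        from cong[OF this, of x] cong[OF this, of y] show ?thesis by (simp add: h_def sym)
      next
        assume "torus_proj N (z - y) = 0"
        from cong[OF this, of x] cong[OF this, of y] show ?thesis by (simp add: h_def)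
      qed
    qed
    show "h z - avg h z = 1" if "z \<notin> copies N {x, y}" for z
    proof -
      have "h z - avg h z = - v / 2 * ((green N (z - x) - avg (green N) (z - x)) + (green N (z - y) - avg (green N) (z - y)))"
        unfolding h_def avg_affine avg_plus avg_translate by (simp add: algebra_simps)
      then show ?thesis using that v unfolding in_copies green_minus_avg[OF N0] v_def[symmetric] by simp
    qed
  qed (rule N0)
  have z: "(\<Sum>z\<in>torus N. green N (z - w)) = 0" for w :: "int ^ 'd"
    using sum_torus_translate[OF periodic_green[OF N0] N0, of "- w"] sum_green[OF N0, where 'd = 'd] by simp
  have "(\<Sum>z\<in>torus N. h z) = v * (v * (green N (0 :: int ^ 'd) + green N (y - x)) / 2)"
    unfolding h_def sum_distrib_left[symmetric] sum_subtractf sum.distrib z by (simp add: card_torus v_def distrib_left)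
  then have T: "K.T = t" using v by (simp add: K.T_def K.V_def v_def t_def)
  have S: "K.\<tau> = s" by (simp add: K.\<tau>_def s_def)
  show t: "t \<ge> 0" using K.T_nonneg by (simp add: T)
  have s1: "s > 1" unfolding s_def by (rule one_less_dim_times_side_sq[OF N d])
  have b: "K.b > 0" using t s1 by (simp add: K.b_def T S divide_less_eq)
  show "survival N (copies N {x, y}) (2 * n) \<le> (1 - 1 / (t + s)) ^ (2 * n)"
    using K.survival_le[OF b, of n] by (simp add: K.b_def T S)
qed

lemma one_minus_inverse_power_le:
  assumes "W \<ge> (1::real)" "real m \<ge> a"
  shows "(1 - 1 / W) ^ m \<le> exp (- a / W)"
proof -
  have "(1 - 1 / W) ^ m \<le> exp (- (1 / W)) ^ m"
    using assms exp_ge_add_one_self[of "- (1 / W)"] by (intro power_mono) auto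
  also have "\<dots> = exp (- real m / W)" by (simp add: exp_of_nat_mult[symmetric])
  also have "\<dots> \<le> exp (- a / W)" using assms by (simp add: divide_right_mono)
  finally show ?thesis .
qed

lemma one_minus_inverse_power_ge:
  assumes t: "t \<ge> (2::real)" and "real m \<le> a"
  shows "exp (- a / t * (1 + 2 / t)) \<le> (1 - 1 / t) ^ m"
proof -
  have "- (1 / t) - 2 * (1 / t)\<^sup>2 \<le> ln (1 - 1 / t)"
    by (rule ln_one_minus_pos_lower_bound) (use t in auto)
  then have "exp (- (1 / t) - 2 * (1 / t)\<^sup>2) \<le> 1 - 1 / t"
    using t by (subst (asm) ln_ge_iff) auto
  then have "exp (- (1 / t) - 2 * (1 / t)\<^sup>2) ^ m \<le> (1 - 1 / t) ^ m"
    by (intro power_mono) auto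
  moreover have "exp (- (1 / t) - 2 * (1 / t)\<^sup>2) ^ m = exp (- real m / t * (1 + 2 / t))"
    using t by (simp add: exp_of_nat_mult[symmetric] power2_eq_square field_simps)
  moreover have "- a / t * (1 + 2 / t) \<le> - real m / t * (1 + 2 / t)"
    using assms by (intro mult_right_mono divide_right_mono) auto
  ultimately show ?thesis by (smt (verit) exp_le_cancel_iff)
qed

lemma survival_nonneg: "survival N A n \<ge> 0"
  unfolding survival_def by (intro divide_nonneg_nonneg sum_nonneg kill_nonneg) auto

lemma survival_single_tendsto_0:
  fixes x :: "int ^ 'd::finite"
  assumes N: "N \<ge> 2" and d: "CARD('d) \<ge> 3" and x: "x \<in> torus N"
  shows "(\<lambda>n. survival N (copies N {x}) (2 * n)) \<longlonglongrightarrow> 0"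
proof -
  define T where "T = real (N ^ CARD('d)) * green N (0 :: int ^ 'd) + (real CARD('d) * real N)\<^sup>2"
  have "0 + 1 < T"
    unfolding T_def using green_0_ge[OF N, where 'd = 'd] one_less_dim_times_side_sq[OF N d]
    by (intro add_le_less_mono mult_nonneg_nonneg) auto
  then have "\<bar>1 - 1 / T\<bar> < 1" by simp
  then have "(\<lambda>n. ((1 - 1 / T)\<^sup>2) ^ n) \<longlonglongrightarrow> 0"
    by (intro LIMSEQ_realpow_zero) (simp_all only: abs_square_less_1 zero_le_power2)
  then show ?thesis
    by (rule tendsto_sandwich[OF _ _ tendsto_const, rotated 2])
       (auto simp: survival_nonneg power_mult[symmetric] T_def simp del: of_nat_power
         intro!: always_eventually survival_single(1)[OF N d x])
qed

text \<open>The even time 2n is V g \<Lambda> up to rounding, so one vertex survives with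
  probability about exp (- \<Lambda>) = M / V. A far pair has half the mean hitting time, giving the
  square; a near pair has it shortened by a fixed factor, giving a power slightly above 1.\<close>

lemma survival_estimates:
  fixes x :: "int ^ 'd::finite"
  assumes N: "N \<ge> 2" and d: "CARD('d) \<ge> 3" and x: "x \<in> torus N"
  defines "V \<equiv> real (N ^ CARD('d))" and "s \<equiv> (real CARD('d) * real N)\<^sup>2" and "g \<equiv> green N (0 :: int ^ 'd)"
  assumes \<Lambda>: "V * g * \<Lambda> \<ge> 2" "exp (- \<Lambda>) = M / V"
    and n: "n = nat \<lfloor>V * g * \<Lambda> / 2\<rfloor>"
  shows survival_single_upper: "survival N (copies N {x}) (2 * n) \<le> M / V * exp (4 * ((\<Lambda> * s + 2) / V))" (is ?A)
    and survival_single_lower: "sqrt (M / V) * (exp (- (4 * (\<Lambda> / V))) - exp (2 * ((\<Lambda> * s + 2) / V)) * sqrt (4 * (s / V)))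
      \<le> sqrt (survival N (copies N {x}) (2 * n))" (is ?B)
    and survival_pair_far: "\<lbrakk>y \<in> torus N; x \<noteq> y; green N (y - x) \<le> \<eta>; \<eta> \<ge> 0\<rbrakk> \<Longrightarrow>
      survival N (copies N {x, y}) (2 * n) \<le> (M / V)\<^sup>2 * exp (8 * (\<Lambda> * \<eta> + 2 * ((\<Lambda> * s + 2) / V)))" (is "PROP ?C")
    and survival_pair_near: "\<lbrakk>y \<in> torus N; x \<noteq> y; s \<le> V / 8; g \<le> C\<rbrakk> \<Longrightarrow>
      survival N (copies N {x, y}) (2 * n) \<le> exp (- \<Lambda> * (1 + 1 / (8 * C)) + 16 / V)" (is "PROP ?D")
proof -
  define t where "t = V * g"
  have g: "g \<ge> 1 / 4" unfolding g_def by (rule green_0_ge[OF N])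
  have V8: "V \<ge> 8"
  proof -
    have "8 \<le> real N ^ 3" using power_mono[of 2 "real N" 3] N by simp
    moreover have "real N ^ 3 \<le> V" unfolding V_def by (rule volume_ge) (use N d in auto)
    ultimately show ?thesis by linarith
  qed
  have t: "t \<ge> V / 4" using mult_left_mono[OF g, of V] V8 by (simp add: t_def)
  then have t2: "t \<ge> 2" using V8 by simp
  have s: "s \<ge> 1" using one_less_dim_times_side_sq[OF N d] by (simp add: s_def)
  have \<Lambda>0: "\<Lambda> \<ge> 0"
  proof (rule ccontr)
    assume "\<not> \<Lambda> \<ge> 0"
    then have "t * \<Lambda> \<le> 0" using t2 by (intro mult_nonneg_nonpos) auto
    then show False using \<Lambda>(1) by (simp add: t_def)
  qed
  \<comment> \<open>Rounding down loses less than 1 in \<open>n\<close>, hence less than 2 in the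
    number of jumps: the 2 in the error terms (\<Lambda> s + 2) / V.\<close>
  have nu: "real n \<le> t * \<Lambda> / 2" and nl: "t * \<Lambda> / 2 - 1 \<le> real n"
    using \<Lambda> unfolding n t_def[symmetric] by linarith+
  have nl2: "t * \<Lambda> - 2 \<le> real (2 * n)" using nl by simp
  have err: "(\<Lambda> * s + 2) / (t + s) \<le> 4 * ((\<Lambda> * s + 2) / V)"
  proof -
    have "(\<Lambda> * s + 2) / (t + s) \<le> (\<Lambda> * s + 2) / (V / 4)"
      using t s V8 \<Lambda>0 by (intro divide_left_mono mult_pos_pos add_nonneg_nonneg mult_nonneg_nonneg) auto
    then show ?thesis by (simp add: algebra_simps)
  qed
  have eq: "(t * \<Lambda> - 2) / (t + s) = \<Lambda> - (\<Lambda> * s + 2) / (t + s)"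
    using t2 s by (simp add: field_simps)
  show ?A
  proof -
    have "survival N (copies N {x}) (2 * n) \<le> (1 - 1 / (t + s)) ^ (2 * n)"
      using survival_single(1)[OF N d x] by (simp add: t_def V_def g_def s_def)
    also have "\<dots> \<le> exp (- (t * \<Lambda> - 2) / (t + s))"
      using t2 s by (intro one_minus_inverse_power_le nl2) auto
    also have "\<dots> \<le> exp (- \<Lambda> + 4 * ((\<Lambda> * s + 2) / V))"
      unfolding exp_le_cancel_iff minus_divide_left[symmetric] eq using err by linarith
    also have "\<dots> = M / V * exp (4 * ((\<Lambda> * s + 2) / V))"
      unfolding exp_add \<Lambda>(2) by simp
    finally show ?thesis .
  qed
  have sqrtM: "sqrt (M / V) = exp (- \<Lambda> / 2)"
  proof -
    have "M / V = (exp (- \<Lambda> / 2))\<^sup>2" unfolding \<Lambda>(2)[symmetric] by (simp flip: exp_double)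
    then show ?thesis by (simp only: real_sqrt_abs abs_exp_cancel)
  qed
  show ?B
  proof -
    have "exp (- (t * \<Lambda> / 2) / t * (1 + 2 / t)) \<le> (1 - 1 / t) ^ n"
      by (rule one_minus_inverse_power_ge[OF t2 nu])
    moreover have "- (t * \<Lambda> / 2) / t * (1 + 2 / t) = - \<Lambda> / 2 - \<Lambda> / t"
      using t2 by (simp add: field_simps)
    moreover have "\<Lambda> / t \<le> 4 * (\<Lambda> / V)"
    proof -
      have "\<Lambda> / t \<le> \<Lambda> / (V / 4)" using t V8 \<Lambda>0 by (intro divide_left_mono) auto
      then show ?thesis by (simp add: mult.commute)
    qed
    ultimately have q: "sqrt (M / V) * exp (- (4 * (\<Lambda> / V))) \<le> (1 - 1 / t) ^ n"
      unfolding sqrtM exp_add[symmetric] by (smt (verit) exp_le_cancel_iff)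
    have "(1 - 1 / (t + s)) ^ n \<le> exp (- (t * \<Lambda> / 2 - 1) / (t + s))"
      using t2 s by (intro one_minus_inverse_power_le nl) auto
    also have "- (t * \<Lambda> / 2 - 1) / (t + s) = - ((t * \<Lambda> - 2) / (t + s)) / 2"
      by (simp add: field_simps)
    also have "exp \<dots> \<le> exp (- \<Lambda> / 2 + 2 * ((\<Lambda> * s + 2) / V))"
      using err eq by simp
    finally have b: "(1 - 1 / (t + s)) ^ n \<le> sqrt (M / V) * exp (2 * ((\<Lambda> * s + 2) / V))"
      unfolding sqrtM exp_add .
    have "s / t \<le> s / (V / 4)" using t s V8 by (intro divide_left_mono) auto
    then have r: "sqrt (s / t) \<le> sqrt (4 * (s / V))" by (simp add: mult.commute)
    have "(1 - 1 / (t + s)) ^ n * sqrt (s / t) \<le> sqrt (M / V) * exp (2 * ((\<Lambda> * s + 2) / V)) * sqrt (4 * (s / V))"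
      using b r t2 s by (intro mult_mono) (auto simp: sqrtM)
    then have "sqrt (M / V) * (exp (- (4 * (\<Lambda> / V))) - exp (2 * ((\<Lambda> * s + 2) / V)) * sqrt (4 * (s / V)))
        \<le> (1 - 1 / t) ^ n - (1 - 1 / (t + s)) ^ n * sqrt (s / t)"
      using q by (simp only: right_diff_distrib mult.assoc)
    also have "\<dots> \<le> sqrt (survival N (copies N {x}) (2 * n))"
      using survival_single(2)[OF N d x] by (simp add: t_def V_def g_def s_def)
    finally show ?thesis .
  qed
  \<comment> \<open>Survival bounds worsen as the mean hitting time grows, so any upper bound
    \<open>W\<close> may replace it.\<close>
  have pair: "survival N (copies N {x, y}) (2 * n) \<le> exp (- ((t * \<Lambda> - 2) / W))"
    if y: "y \<in> torus N" "x \<noteq> y" and W: "V * (g + green N (y - x)) / 2 + s \<le> W" for y W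
  proof -
    define T where "T = V * (g + green N (y - x)) / 2"
    have T: "T \<ge> 0" using survival_pair(2)[OF N d x y] by (simp add: T_def V_def g_def)
    have "survival N (copies N {x, y}) (2 * n) \<le> (1 - 1 / (T + s)) ^ (2 * n)"
      using survival_pair(1)[OF N d x y] by (simp add: T_def V_def g_def s_def)
    also have "\<dots> \<le> exp (- (t * \<Lambda> - 2) / (T + s))"
      using T s by (intro one_minus_inverse_power_le nl2) auto
    also have "\<dots> \<le> exp (- ((t * \<Lambda> - 2) / W))"
      using W T s \<Lambda>(1) unfolding T_def[symmetric] t_def[symmetric] exp_le_cancel_iff minus_divide_left[symmetric]
      by (intro le_imp_neg_le divide_left_mono mult_pos_pos) auto
    finally show ?thesis .
  qed
  show "PROP ?C"
  proof -
    assume y: "y \<in> torus N" "x \<noteq> y" and \<eta>: "green N (y - x) \<le> \<eta>" "\<eta> \<ge> 0"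
    define W where "W = V * (g + \<eta>) / 2 + s"
    have W: "W \<ge> V / 8"
    proof -
      have "V * (1 / 4) \<le> V * (g + \<eta>)" using g \<eta> V8 by (intro mult_left_mono) auto
      then show ?thesis using s unfolding W_def by simp
    qed
    have "survival N (copies N {x, y}) (2 * n) \<le> exp (- ((t * \<Lambda> - 2) / W))"
      by (rule pair[OF y]) (use \<eta> V8 in \<open>simp add: W_def\<close>)
    also have "(t * \<Lambda> - 2) / W = 2 * \<Lambda> - (\<Lambda> * (V * \<eta> + 2 * s) + 2) / W"
    proof -
      have "t * \<Lambda> - 2 = 2 * \<Lambda> * W - (\<Lambda> * (V * \<eta> + 2 * s) + 2)"
        by (simp add: W_def t_def algebra_simps)
      then show ?thesis using W V8 by (simp only: diff_divide_distrib) simp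
    qed
    also have "exp (- (2 * \<Lambda> - (\<Lambda> * (V * \<eta> + 2 * s) + 2) / W)) \<le> exp (- \<Lambda> + - \<Lambda> + 8 * (\<Lambda> * \<eta> + 2 * ((\<Lambda> * s + 2) / V)))"
    proof -
      have "(\<Lambda> * (V * \<eta> + 2 * s) + 2) / W \<le> (\<Lambda> * (V * \<eta> + 2 * s) + 2) / (V / 8)"
        using W V8 \<Lambda>0 \<eta> s by (intro divide_left_mono mult_pos_pos add_nonneg_nonneg mult_nonneg_nonneg) auto
      also have "\<dots> = 8 * (\<Lambda> * \<eta> + (2 * (\<Lambda> * s) + 2) / V)"
        using V8 by (simp add: field_simps)
      also have "\<dots> \<le> 8 * (\<Lambda> * \<eta> + 2 * ((\<Lambda> * s + 2) / V))"
        using V8 by (simp add: divide_right_mono)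
      finally show ?thesis by simp
    qed
    also have "\<dots> = (M / V)\<^sup>2 * exp (8 * (\<Lambda> * \<eta> + 2 * ((\<Lambda> * s + 2) / V)))"
      unfolding exp_add \<Lambda>(2) by (simp add: power2_eq_square)
    finally show "survival N (copies N {x, y}) (2 * n) \<le> (M / V)\<^sup>2 * exp (8 * (\<Lambda> * \<eta> + 2 * ((\<Lambda> * s + 2) / V)))" .
  qed
  show "PROP ?D"
  proof -
    assume y: "y \<in> torus N" "x \<noteq> y" and sV: "s \<le> V / 8" and C: "g \<le> C"
    have "torus_proj N (y - x) \<noteq> 0"
      using y x by (auto simp: torus_proj_diff_eq_0 torus_proj_id)
    then have gap: "g + green N (y - x) \<le> 2 * g - 1 / 2"
      using green_gap[of N "y - x"] N unfolding g_def by simp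
    \<comment> \<open>Half the gap 1 / 2 lowers the mean hitting time by V / 4; the Poincare error
      \<open>s\<close> takes back at most V / 8.\<close>
    have "survival N (copies N {x, y}) (2 * n) \<le> exp (- ((t * \<Lambda> - 2) / (V * (g - 1 / 8))))"
    proof (rule pair[OF y])
      have "V * (g + green N (y - x)) \<le> V * (2 * g - 1 / 2)"
        using gap V8 by (intro mult_left_mono) auto
      moreover have "V * (2 * g - 1 / 2) = 2 * (V * (g - 1 / 8)) - V / 4"
        by (simp add: algebra_simps)
      ultimately show "V * (g + green N (y - x)) / 2 + s \<le> V * (g - 1 / 8)"
        using sV by linarith
    qed
    also have "(t * \<Lambda> - 2) / (V * (g - 1 / 8)) = \<Lambda> * (g / (g - 1 / 8)) - 2 / (V * (g - 1 / 8))"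
      using V8 by (simp add: t_def diff_divide_distrib)
    also have "exp (- (\<Lambda> * (g / (g - 1 / 8)) - 2 / (V * (g - 1 / 8)))) \<le> exp (- \<Lambda> * (1 + 1 / (8 * C)) + 16 / V)"
    proof -
      have "1 / (8 * C) \<le> 1 / (8 * (g - 1 / 8))" using C g by (intro divide_left_mono mult_pos_pos) auto
      also have "1 / (8 * (g - 1 / 8)) = g / (g - 1 / 8) - 1" using g by (simp add: field_simps)
      finally have "\<Lambda> * (1 + 1 / (8 * C)) \<le> \<Lambda> * (g / (g - 1 / 8))" using \<Lambda>0 by (intro mult_left_mono) auto
      moreover have "2 / (V * (g - 1 / 8)) \<le> 2 / (V * (1 / 8))"
        using g V8 by (intro divide_left_mono mult_left_mono mult_pos_pos) auto
      ultimately show ?thesis by simp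
    qed
    finally show "survival N (copies N {x, y}) (2 * n) \<le> exp (- \<Lambda> * (1 + 1 / (8 * C)) + 16 / V)" .
  qed
qed

section \<open>Summation over pairs and passage to the limit\<close>

lemma sum_near_far_le:
  fixes x :: "int ^ 'd::finite"
  assumes N: "N > 0" and S: "S \<subseteq> torus N"
    and far: "\<And>y. y \<in> S \<Longrightarrow> snorm N (y - x) > L \<Longrightarrow> F y \<le> (a::real)"
    and near: "\<And>y. y \<in> S \<Longrightarrow> snorm N (y - x) \<le> L \<Longrightarrow> F y \<le> b"
    and nn: "a \<ge> 0" "b \<ge> 0"
  shows "(\<Sum>y\<in>S. F y) \<le> real (card S) * a + real ((2 * L + 1) ^ CARD('d)) * b"
proof -
  have fin: "finite S" using S finite_torus finite_subset by blast
  have "(\<Sum>y\<in>S. F y) \<le> (\<Sum>y\<in>S. a + (if snorm N (y - x) \<le> L then b else 0))"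
  proof (rule sum_mono)
    fix y assume "y \<in> S"
    then show "F y \<le> a + (if snorm N (y - x) \<le> L then b else 0)"
      using far[of y] near[of y] nn by (cases "snorm N (y - x) \<le> L") auto
  qed
  also have "\<dots> = real (card S) * a + real (card {y\<in>S. snorm N (y - x) \<le> L}) * b"
    using fin by (simp add: sum.distrib sum.If_cases Int_def)
  also have "\<dots> \<le> real (card S) * a + real ((2 * L + 1) ^ CARD('d)) * b"
  proof -
    have "card {y\<in>S. snorm N (y - x) \<le> L} \<le> card {y\<in>torus N. snorm N (y - x) \<le> L}"
      using S by (intro card_mono) (auto simp: finite_torus)
    also have "\<dots> \<le> (2 * L + 1) ^ CARD('d)" by (rule card_box_le[OF N])
    finally show ?thesis using nn by (intro add_left_mono mult_right_mono of_nat_mono) auto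
  qed
  finally show ?thesis .
qed

lemma card_close_le:
  fixes x :: "int ^ 'd::finite"
  assumes N: "N > 0" and r: "r \<ge> 0"
  shows "real (card {y \<in> torus N - {x}. torus_dist N x y \<le> r}) \<le> (2 * r + 1) ^ CARD('d)"
proof -
  have "card {y \<in> torus N - {x}. torus_dist N x y \<le> r} \<le> card {y \<in> torus N. snorm N (y - x) \<le> nat \<lfloor>r\<rfloor>}"
  proof (rule card_mono)
    show "{y \<in> torus N - {x}. torus_dist N x y \<le> r} \<subseteq> {y \<in> torus N. snorm N (y - x) \<le> nat \<lfloor>r\<rfloor>}"
      by (auto intro!: le_nat_floor order.trans[OF snorm_le_torus_dist[OF N]])
  qed (simp add: finite_torus)
  also have "\<dots> \<le> (2 * nat \<lfloor>r\<rfloor> + 1) ^ CARD('d)" by (rule card_box_le[OF N])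
  finally have "real (card {y \<in> torus N - {x}. torus_dist N x y \<le> r}) \<le> real ((2 * nat \<lfloor>r\<rfloor> + 1) ^ CARD('d))"
    by (rule of_nat_mono)
  also have "\<dots> \<le> (2 * r + 1) ^ CARD('d)"
    unfolding of_nat_power using r by (intro power_mono) auto
  finally show ?thesis .
qed

text \<open>
  The walk is stopped after about \<open>V g ln (V / M)\<close> jumps, \<open>g = green N 0\<close>, when about \<open>M\<close> vertices
  are left. The contribution of the pairs closer than \<open>(ln N)\<^sup>3\<close> is \<open>R\<close>; beyond that distance the
  correlation is small enough for \<open>F\<close> to tend to 1.
\<close>

lemma eventually_prob_close_le:
  fixes M \<delta> :: real and k :: nat
  assumes d: "CARD('d::finite) \<ge> 3" and M: "M > real k" "M \<ge> 1" and \<delta>: "\<delta> > 0"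
  defines "D \<equiv> real CARD('d)" and "C \<equiv> 2 * real CARD('d) * 3 ^ CARD('d)" and "K \<equiv> 120 * real CARD('d) * 3 ^ CARD('d)"
  defines "e \<equiv> \<lambda>x::real. D ^ 3 * ln x / x + 2 / x"
  defines "F \<equiv> \<lambda>x. exp (8 * (D * ln x * (K * (1 + ln x) / ln x ^ 3) + 2 * e x))"
  defines "R \<equiv> \<lambda>x. (2 * ln x ^ 3 + 3) ^ CARD('d) * (M * exp (ln M / (8 * C) - ln x / (8 * C)) * exp (16 / x))"
  defines "a \<equiv> \<lambda>x. exp (- (4 * (D * ln x / x))) - exp (2 * e x) * sqrt (4 * (D\<^sup>2 / x))"
  defines "B \<equiv> \<lambda>x. (M * exp (4 * e x) + (M\<^sup>2 * F x + R x) - 2 * M * (M * (a x)\<^sup>2) + M\<^sup>2) / (M - real k)\<^sup>2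
    + (M\<^sup>2 * (2 * \<delta> + 1 / x) ^ CARD('d) * F x + R x)"
  shows "\<forall>\<^sub>F N in sequentially. \<P>(\<omega> in (srw_space N :: 'd srw_sample measure).
      \<exists>i j. 1 \<le> i \<and> i < j \<and> j \<le> k \<and>
        torus_dist N (last_visited N \<omega> i) (last_visited N \<omega> j) \<le> \<delta> * real N) \<le> B (real N)"
proof -
  have D: "D \<ge> 3" unfolding D_def using d by simp
  have C: "C > 0" unfolding C_def using d by simp
  have K: "K \<ge> 0" unfolding K_def by simp
  \<comment> \<open>Positivity of \<open>a\<close> allows the lower bound on the square root of
    survival to be squared in \<open>single_l\<close>.\<close>
  have "(a \<longlongrightarrow> 1) at_top"
    unfolding a_def e_def using D by real_asymp
  then have "eventually (\<lambda>x. a x > 0) at_top"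
    by (rule order_tendstoD) simp
  then have ev_a: "\<forall>\<^sub>F N in sequentially. a (real N) > 0"
    using filterlim_real_sequentially by (rule eventually_compose_filterlim)
  \<comment> \<open>Ensures \<Lambda> >= 2, hence V g \<Lambda> >= 2. In \<open>ev_N\<close>, the
    condition with 8 D^2 gives s <= V / 8 and N >= k gives k <= V.\<close>
  have ev_ln: "\<forall>\<^sub>F N in sequentially. ln (real N) \<ge> ln M + 2"
    by real_asymp
  have ev_N: "\<forall>\<^sub>F N in sequentially. real N \<ge> 8 * D\<^sup>2 \<and> N \<ge> 3 \<and> N \<ge> k"
    by (intro eventually_conj eventually_ge_at_top) real_asymp
  from ev_a ev_ln ev_N show ?thesis
  proof eventually_elim
    case (elim N)
    then have N: "N \<ge> 2" "N > 0" "real N \<ge> 3" and Nk: "N \<ge> k" by auto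
    let ?T = "torus N :: (int ^ 'd) set"
    define V where "V = real (N ^ CARD('d))"
    define s where "s = (real CARD('d) * real N)\<^sup>2"
    define g where "g = green N (0 :: int ^ 'd)"
    define l where "l = ln (real N)"
    define \<Lambda> where "\<Lambda> = ln (V / M)"
    define n where "n = nat \<lfloor>V * g * \<Lambda> / 2\<rfloor>"
    define L where "L = nat \<lceil>l ^ 3\<rceil>"
    \<comment> \<open>The bound of \<open>green_decay\<close> beyond distance l^3. The exponent 3
      makes \<Lambda> \<eta> of order 1 / l; with exponent 2 it would stay of order 1.\<close>
    define \<eta> where "\<eta> = K * (1 + l) / l ^ 3"
    have V3: "V \<ge> real N ^ 3" unfolding V_def using N d by (intro volume_ge) auto
    have N3: "real N ^ 3 \<ge> real N" using N self_le_power[of "real N" 3] by simp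
    have VN: "V \<ge> real N" using V3 N3 by linarith
    have Vpos: "V > 0" using VN N by linarith
    have l: "l \<ge> ln M + 2" "l \<ge> 2" using elim(2) ln_ge_zero[OF M(2)] unfolding l_def by linarith+
    have lV: "ln V = D * l" using N by (simp add: V_def D_def l_def ln_realpow)
    have \<Lambda>: "\<Lambda> = D * l - ln M" using Vpos M by (simp add: \<Lambda>_def ln_div lV)
    have expL: "exp (- \<Lambda>) = M / V"
      using Vpos M by (simp add: \<Lambda>_def exp_minus)
    have "1 * l \<le> D * l" using D l by (intro mult_right_mono) auto
    then have \<Lambda>l: "\<Lambda> \<ge> 2" "\<Lambda> \<ge> l - ln M" "\<Lambda> \<le> D * l"
      using l ln_ge_zero[OF M(2)] unfolding \<Lambda> by linarith+
    have g: "g \<ge> 1 / 4" unfolding g_def by (rule green_0_ge[OF N(1)])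
    have gC: "g \<le> C" unfolding g_def C_def by (rule green_0_le[OF N(2) d])
    have V8: "V \<ge> 8"
    proof -
      have "8 \<le> real N ^ 3" using power_mono[of 2 "real N" 3] N by simp
      then show ?thesis using V3 by linarith
    qed
    have "8 * (1 / 4) * 2 \<le> V * g * \<Lambda>"
      using V8 g \<Lambda>l by (intro mult_mono) auto
    then have t\<Lambda>: "V * g * \<Lambda> \<ge> 2" by simp
    have sV: "s / V \<le> D\<^sup>2 / real N"
    proof -
      have "s / V \<le> s / real N ^ 3" using V3 N Vpos by (intro divide_left_mono) (auto simp: s_def)
      also have "\<dots> = D\<^sup>2 / real N"
        using N by (simp add: s_def D_def power_mult_distrib eval_nat_numeral)
      finally show ?thesis .
    qed
    have s8: "s \<le> V / 8"
    proof -
      have "D\<^sup>2 / real N \<le> 1 / 8" using elim(3) N by (simp add: field_simps)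
      with sV have "s / V \<le> 1 / 8" by linarith
      then show ?thesis using Vpos by (simp add: field_simps)
    qed
    have invV: "1 / V \<le> 1 / real N" using VN N by (intro divide_left_mono) auto
    have err: "(\<Lambda> * s + 2) / V \<le> e (real N)"
    proof -
      have "\<Lambda> * (s / V) \<le> (D * l) * (D\<^sup>2 / real N)"
        using \<Lambda>l sV D l by (intro mult_mono) (auto simp: s_def V_def)
      then have "\<Lambda> * s / V + 2 * (1 / V) \<le> (D * l) * (D\<^sup>2 / real N) + 2 * (1 / real N)"
        using invV by simp
      also have "\<dots> = e (real N)" by (simp add: e_def l_def eval_nat_numeral)
      finally show ?thesis by (simp add: add_divide_distrib)
    qed
    have \<Lambda>V: "\<Lambda> / V \<le> D * l / real N"
      using mult_mono[OF \<Lambda>l(3) invV] D l Vpos by simp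
    have single_u: "survival N (copies N {x}) (2 * n) \<le> M / V * exp (4 * e (real N))" if "x \<in> ?T" for x
    proof -
      have "survival N (copies N {x}) (2 * n) \<le> M / V * exp (4 * ((\<Lambda> * s + 2) / V))"
        using survival_single_upper[OF N(1) d that, folded V_def s_def g_def, OF t\<Lambda> expL n_def] .
      also have "\<dots> \<le> M / V * exp (4 * e (real N))"
        using M Vpos by (intro mult_left_mono iffD2[OF exp_le_cancel_iff] err) auto
      finally show ?thesis .
    qed
    have single_l: "survival N (copies N {x}) (2 * n) \<ge> M / V * (a (real N))\<^sup>2" if "x \<in> ?T" for x
    proof -
      have "a (real N) \<le> exp (- (4 * (\<Lambda> / V))) - exp (2 * ((\<Lambda> * s + 2) / V)) * sqrt (4 * (s / V))"
      proof -
        have "exp (2 * ((\<Lambda> * s + 2) / V)) \<le> exp (2 * e (real N))"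
          by (intro iffD2[OF exp_le_cancel_iff] mult_left_mono err) simp
        moreover have "exp (- (4 * (D * l / real N))) \<le> exp (- (4 * (\<Lambda> / V)))"
          by (intro iffD2[OF exp_le_cancel_iff] le_imp_neg_le mult_left_mono \<Lambda>V) simp
        moreover have "sqrt (4 * (s / V)) \<le> sqrt (4 * (D\<^sup>2 / real N))"
          by (intro real_sqrt_le_mono mult_left_mono sV) simp
        ultimately show ?thesis
          unfolding a_def l_def[symmetric]
          by (intro diff_mono mult_mono) (use Vpos in \<open>auto simp: s_def\<close>)
      qed
      then have "sqrt (M / V) * a (real N) \<le> sqrt (M / V) * (exp (- (4 * (\<Lambda> / V))) - exp (2 * ((\<Lambda> * s + 2) / V)) * sqrt (4 * (s / V)))"
        using M Vpos by (intro mult_left_mono) auto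
      also have "\<dots> \<le> sqrt (survival N (copies N {x}) (2 * n))"
        using survival_single_lower[OF N(1) d that, folded V_def s_def g_def, OF t\<Lambda> expL n_def] .
      finally have "(sqrt (M / V) * a (real N))\<^sup>2 \<le> (sqrt (survival N (copies N {x}) (2 * n)))\<^sup>2"
        using elim(1) M Vpos by (intro power_mono) auto
      then show ?thesis
        using M Vpos survival_nonneg[of N "copies N {x}" "2 * n"] by (simp add: power_mult_distrib)
    qed
    have far: "survival N (copies N {x, y}) (2 * n) \<le> (M / V)\<^sup>2 * F (real N)"
      if xy: "x \<in> ?T" "y \<in> ?T" "x \<noteq> y" "snorm N (y - x) > L" for x y
    proof -
      have sl: "real (snorm N (y - x)) \<ge> l ^ 3"
        using xy(4) unfolding L_def by linarith
      have l3: "l ^ 3 > 0" using l by simp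
      have "\<bar>green N (y - x)\<bar> * l ^ 3 \<le> \<bar>green N (y - x)\<bar> * real (snorm N (y - x))"
        by (rule mult_left_mono[OF sl]) simp
      also have "\<dots> \<le> K * (1 + l)"
        unfolding K_def l_def by (rule green_decay[OF N(2) d])
      finally have "\<bar>green N (y - x)\<bar> \<le> \<eta>"
        using l3 by (simp add: \<eta>_def pos_le_divide_eq)
      then have gr: "green N (y - x) \<le> \<eta>" by simp
      have \<eta>: "\<eta> \<ge> 0" unfolding \<eta>_def using K l by simp
      have "survival N (copies N {x, y}) (2 * n) \<le> (M / V)\<^sup>2 * exp (8 * (\<Lambda> * \<eta> + 2 * ((\<Lambda> * s + 2) / V)))"
        using survival_pair_far[OF N(1) d xy(1), folded V_def s_def g_def, OF t\<Lambda> expL n_def xy(2,3) gr \<eta>] .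
      also have "\<dots> \<le> (M / V)\<^sup>2 * F (real N)"
      proof -
        have "\<Lambda> * \<eta> \<le> D * l * \<eta>" by (rule mult_right_mono[OF \<Lambda>l(3) \<eta>])
        then show ?thesis
          unfolding F_def l_def[symmetric] \<eta>_def[symmetric]
          by (intro mult_left_mono iffD2[OF exp_le_cancel_iff] add_mono err) auto
      qed
      finally show ?thesis .
    qed
    define nr where "nr = exp (- \<Lambda> * (1 + 1 / (8 * C)) + 16 / V)"
    have near: "survival N (copies N {x, y}) (2 * n) \<le> nr"
      if xy: "x \<in> ?T" "y \<in> ?T" "x \<noteq> y" for x y
      unfolding nr_def
      using survival_pair_near[OF N(1) d xy(1), folded V_def s_def g_def, OF t\<Lambda> expL n_def xy(2,3) s8 gC] .
    \<comment> \<open>Near pairs: V vertices with polylogarithmically many partners. As V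
      \<open>nr\<close> is about M exp (- \<Lambda> / (8 C)), a negative power of \<open>N\<close>
      beats the logarithms.\<close>
    have R: "V * (real ((2 * L + 1) ^ CARD('d)) * nr) \<le> R (real N)"
    proof -
      have "real L \<le> l ^ 3 + 1" unfolding L_def using l by simp
      then have "real ((2 * L + 1) ^ CARD('d)) \<le> (2 * l ^ 3 + 3) ^ CARD('d)"
        unfolding of_nat_power by (intro power_mono) auto
      moreover have "V * nr \<le> M * exp (ln M / (8 * C) - l / (8 * C)) * exp (16 / real N)"
      proof -
        have nr: "- \<Lambda> * (1 + 1 / (8 * C)) + 16 / V = - \<Lambda> + - \<Lambda> / (8 * C) + 16 / V"
          by (simp add: algebra_simps)
        have "V * nr = M * exp (- \<Lambda> / (8 * C)) * exp (16 / V)"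
          unfolding nr_def nr exp_add expL using Vpos by simp
        also have "\<dots> \<le> M * exp (ln M / (8 * C) - l / (8 * C)) * exp (16 / real N)"
        proof (intro mult_mono)
          have "- \<Lambda> / (8 * C) \<le> (ln M - l) / (8 * C)"
            using \<Lambda>l C by (intro divide_right_mono) auto
          then show "exp (- \<Lambda> / (8 * C)) \<le> exp (ln M / (8 * C) - l / (8 * C))"
            by (simp add: diff_divide_distrib)
          show "exp (16 / V) \<le> exp (16 / real N)" using invV by simp
        qed (use M in auto)
        finally show ?thesis .
      qed
      ultimately have "real ((2 * L + 1) ^ CARD('d)) * (V * nr) \<le>
        (2 * l ^ 3 + 3) ^ CARD('d) * (M * exp (ln M / (8 * C) - l / (8 * C)) * exp (16 / real N))"
        by (rule mult_mono) (use l Vpos in \<open>auto simp: nr_def\<close>)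
      then show ?thesis unfolding R_def l_def by (simp only: mult_ac)
    qed
    have Fpos: "F (real N) > 0" by (simp add: F_def)
    define sS where "sS = (\<Sum>x\<in>?T. survival N (copies N {x}) (2 * n))"
    define pS where "pS = (\<Sum>x\<in>?T. \<Sum>y\<in>?T - {x}. survival N (copies N {x, y}) (2 * n))"
    define cS where "cS = (\<Sum>x\<in>?T. \<Sum>y\<in>{y\<in>?T - {x}. torus_dist N x y \<le> \<delta> * real N}. survival N (copies N {x, y}) (2 * n))"
    have cV: "real (card ?T) = V" by (simp add: card_torus V_def)
    have "sS \<le> V * (M / V * exp (4 * e (real N)))"
      unfolding sS_def cV[symmetric] by (rule sum_bounded_above) (use single_u in \<open>simp add: cV\<close>)
    then have sU: "sS \<le> M * exp (4 * e (real N))" using Vpos by simp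
    have "V * (M / V * (a (real N))\<^sup>2) \<le> sS"
      unfolding sS_def cV[symmetric] by (rule sum_bounded_below) (use single_l in \<open>simp add: cV\<close>)
    then have sL: "M * (a (real N))\<^sup>2 \<le> sS" using Vpos by simp
    have row: "(\<Sum>y\<in>S. survival N (copies N {x, y}) (2 * n)) \<le> q * ((M / V)\<^sup>2 * F (real N)) + real ((2 * L + 1) ^ CARD('d)) * nr"
      if x: "x \<in> ?T" and S: "S \<subseteq> ?T - {x}" and q: "real (card S) \<le> q" for x S q
    proof -
      have "(\<Sum>y\<in>S. survival N (copies N {x, y}) (2 * n)) \<le> real (card S) * ((M / V)\<^sup>2 * F (real N)) + real ((2 * L + 1) ^ CARD('d)) * nr"
      proof (rule sum_near_far_le[OF N(2)])
        show "S \<subseteq> ?T" using S by blast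
        fix y assume "y \<in> S"
        then have y: "y \<in> ?T" "x \<noteq> y" using S by auto
        show "survival N (copies N {x, y}) (2 * n) \<le> (M / V)\<^sup>2 * F (real N)" if "snorm N (y - x) > L"
          by (rule far[OF x y that])
        show "survival N (copies N {x, y}) (2 * n) \<le> nr"
          by (rule near[OF x y])
      qed (use Fpos in \<open>auto simp: nr_def\<close>)
      also have "\<dots> \<le> q * ((M / V)\<^sup>2 * F (real N)) + real ((2 * L + 1) ^ CARD('d)) * nr"
        using q Fpos by (intro add_right_mono mult_right_mono) auto
      finally show ?thesis .
    qed
    \<comment> \<open>Used twice: with q = V for all pairs and with q the size of a box of radius
      \<delta> N for close pairs.\<close>
    have total: "(\<Sum>x\<in>?T. \<Sum>y\<in>S x. survival N (copies N {x, y}) (2 * n)) \<le> M\<^sup>2 * (q / V) * F (real N) + R (real N)"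
      if "\<And>x. x \<in> ?T \<Longrightarrow> S x \<subseteq> ?T - {x}" "\<And>x. x \<in> ?T \<Longrightarrow> real (card (S x)) \<le> q" for S q
    proof -
      have "(\<Sum>x\<in>?T. \<Sum>y\<in>S x. survival N (copies N {x, y}) (2 * n)) \<le>
          V * (q * ((M / V)\<^sup>2 * F (real N)) + real ((2 * L + 1) ^ CARD('d)) * nr)"
        unfolding cV[symmetric] by (rule sum_bounded_above) (use row that in \<open>simp add: cV\<close>)
      also have "\<dots> = M\<^sup>2 * (q / V) * F (real N) + V * (real ((2 * L + 1) ^ CARD('d)) * nr)"
        using Vpos by (simp add: power_divide power2_eq_square distrib_left)
      finally show ?thesis using R by linarith
    qed
    have "pS \<le> M\<^sup>2 * (V / V) * F (real N) + R (real N)"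
      unfolding pS_def
    proof (rule total)
      fix x show "real (card (?T - {x})) \<le> V"
        unfolding cV[symmetric] by (intro of_nat_mono card_mono finite_torus) auto
    qed auto
    then have p: "pS \<le> M\<^sup>2 * F (real N) + R (real N)" using Vpos by simp
    have "cS \<le> M\<^sup>2 * ((2 * (\<delta> * real N) + 1) ^ CARD('d) / V) * F (real N) + R (real N)"
      unfolding cS_def
    proof (rule total)
      fix x :: "int ^ 'd"
      show "real (card {y \<in> ?T - {x}. torus_dist N x y \<le> \<delta> * real N}) \<le> (2 * (\<delta> * real N) + 1) ^ CARD('d)"
        by (rule card_close_le[OF N(2)]) (use \<delta> in simp)
    qed auto
    moreover have "(2 * (\<delta> * real N) + 1) ^ CARD('d) / V = (2 * \<delta> + 1 / real N) ^ CARD('d)"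
    proof -
      have "2 * \<delta> + 1 / real N = (2 * (\<delta> * real N) + 1) / real N" using N by (simp add: field_simps)
      then show ?thesis by (simp add: V_def power_divide)
    qed
    ultimately have c: "cS \<le> M\<^sup>2 * (2 * \<delta> + 1 / real N) ^ CARD('d) * F (real N) + R (real N)" by simp
    have k: "k \<le> N ^ CARD('d)"
      using Nk N self_le_power[of N "CARD('d)"] by simp
    have "\<P>(\<omega> in (srw_space N :: 'd srw_sample measure).
      \<exists>i j. 1 \<le> i \<and> i < j \<and> j \<le> k \<and>
        torus_dist N (last_visited N \<omega> i) (last_visited N \<omega> j) \<le> \<delta> * real N) \<le>
      (sS + pS - 2 * M * sS + M\<^sup>2) / (M - real k)\<^sup>2 + cS"
      unfolding sS_def pS_def cS_def
      by (rule prob_last_visited_close_le[OF N(2) k M(1)]) (rule survival_single_tendsto_0[OF N(1) d])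
    also have "\<dots> \<le> B (real N)"
    proof -
      \<comment> \<open>\<open>sS\<close> enters the Chebyshev numerator with both signs: the upper
        bound serves the linear term, the lower bound this one.\<close>
      have "2 * M * (M * (a (real N))\<^sup>2) \<le> 2 * M * sS" using sL M by (intro mult_left_mono) auto
      then show ?thesis unfolding B_def using sU p c
        by (intro add_mono divide_right_mono) auto
    qed
    finally show ?case .
  qed
qed

text \<open>In the limit the Chebyshev numerator M + M^2 - 2 M^2 + M^2 collapses to M, the variance
  of a Poisson variable of mean M.\<close>

lemma limsup_prob_close_le:
  fixes M \<delta> :: real and k :: nat
  assumes d: "CARD('d::finite) \<ge> 3" and M: "M > real k" "M \<ge> 1" and \<delta>: "\<delta> > 0"
  shows "limsup (\<lambda>N. ereal (\<P>(\<omega> in (srw_space N :: 'd srw_sample measure).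
      \<exists>i j. 1 \<le> i \<and> i < j \<and> j \<le> k \<and>
        torus_dist N (last_visited N \<omega> i) (last_visited N \<omega> j) \<le> \<delta> * real N)))
    \<le> ereal (M / (M - real k)\<^sup>2 + M\<^sup>2 * (2 * \<delta>) ^ CARD('d))"
proof -
  define D where "D = real CARD('d)"
  define C where "C = 2 * real CARD('d) * 3 ^ CARD('d)"
  define K where "K = 120 * real CARD('d) * 3 ^ CARD('d)"
  have pos: "D > 0" "C > 0" "K > 0" using d by (auto simp: D_def C_def K_def)
  define e where "e = (\<lambda>x::real. D ^ 3 * ln x / x + 2 / x)"
  define F where "F = (\<lambda>x. exp (8 * (D * ln x * (K * (1 + ln x) / ln x ^ 3) + 2 * e x)))"
  define R where "R = (\<lambda>x. (2 * ln x ^ 3 + 3) ^ CARD('d) * (M * exp (ln M / (8 * C) - ln x / (8 * C)) * exp (16 / x)))"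
  define a where "a = (\<lambda>x. exp (- (4 * (D * ln x / x))) - exp (2 * e x) * sqrt (4 * (D\<^sup>2 / x)))"
  define B where "B = (\<lambda>x. (M * exp (4 * e x) + (M\<^sup>2 * F x + R x) - 2 * M * (M * (a x)\<^sup>2) + M\<^sup>2) / (M - real k)\<^sup>2
    + (M\<^sup>2 * (2 * \<delta> + 1 / x) ^ CARD('d) * F x + R x))"
  have e: "(e \<longlongrightarrow> 0) at_top" unfolding e_def by real_asymp
  have F: "(F \<longlongrightarrow> exp (8 * (0 + 2 * 0))) at_top"
  proof -
    have "((\<lambda>x. D * ln x * (K * (1 + ln x) / ln x ^ 3)) \<longlongrightarrow> 0) at_top"
      by real_asymp
    then show ?thesis unfolding F_def by (intro tendsto_intros e)
  qed
  have a: "(a \<longlongrightarrow> 1) at_top" unfolding a_def e_def using pos by real_asymp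
  have R: "(R \<longlongrightarrow> 0) at_top"
  proof -
    \<comment> \<open>Splits the decay of order N^(-1 / (8 C)) evenly among the d polylogarithmic
      factors, reducing the claim to one factor.\<close>
    define c where "c = 1 / (8 * C * D)"
    have c: "c > 0" using pos by (simp add: c_def)
    have "((\<lambda>x. (2 * ln x ^ 3 + 3) * exp (- (c * ln x))) \<longlongrightarrow> 0) at_top"
      using c by real_asymp
    moreover have "((\<lambda>x::real. 16 / x) \<longlongrightarrow> 0) at_top"
      by real_asymp
    ultimately have "((\<lambda>x. ((2 * ln x ^ 3 + 3) * exp (- (c * ln x))) ^ CARD('d) * (M * exp (ln M / (8 * C)) * exp (16 / x))) \<longlongrightarrow>
        0 ^ CARD('d) * (M * exp (ln M / (8 * C)) * exp 0)) at_top"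
      by (intro tendsto_intros)
    moreover have "((2 * ln x ^ 3 + 3) * exp (- (c * ln x))) ^ CARD('d) * (M * exp (ln M / (8 * C)) * exp (16 / x)) = R x" for x
    proof -
      have "exp (- (c * ln x)) ^ CARD('d) = exp (- (ln x / (8 * C)))"
        using pos by (simp add: exp_of_nat_mult[symmetric] c_def D_def)
      then show ?thesis
        by (simp add: R_def power_mult_distrib exp_diff exp_minus field_simps)
    qed
    ultimately show ?thesis using d by (simp add: power_0_left)
  qed
  have "(B \<longlongrightarrow> (M * exp (4 * 0) + (M\<^sup>2 * exp (8 * (0 + 2 * 0)) + 0) - 2 * M * (M * 1\<^sup>2) + M\<^sup>2) / (M - real k)\<^sup>2
    + (M\<^sup>2 * (2 * \<delta> + 0) ^ CARD('d) * exp (8 * (0 + 2 * 0)) + 0)) at_top"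
    unfolding B_def using M by (intro tendsto_intros e F a R tendsto_divide_0[OF tendsto_const] filterlim_ident filterlim_at_top_imp_at_infinity) auto
  then have "(B \<longlongrightarrow> M / (M - real k)\<^sup>2 + M\<^sup>2 * (2 * \<delta>) ^ CARD('d)) at_top"
    by (simp add: power2_eq_square)
  then have lim: "(\<lambda>N. ereal (B (real N))) \<longlonglongrightarrow> ereal (M / (M - real k)\<^sup>2 + M\<^sup>2 * (2 * \<delta>) ^ CARD('d))"
    by (intro tendsto_ereal) (rule filterlim_compose[OF _ filterlim_real_sequentially])
  have "\<forall>\<^sub>F N in sequentially. ereal (\<P>(\<omega> in (srw_space N :: 'd srw_sample measure).
      \<exists>i j. 1 \<le> i \<and> i < j \<and> j \<le> k \<and>
        torus_dist N (last_visited N \<omega> i) (last_visited N \<omega> j) \<le> \<delta> * real N)) \<le> ereal (B (real N))"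
    using eventually_prob_close_le[OF d M \<delta>]
    unfolding B_def F_def R_def a_def e_def D_def C_def K_def by simp
  then have "limsup (\<lambda>N. ereal (\<P>(\<omega> in (srw_space N :: 'd srw_sample measure).
      \<exists>i j. 1 \<le> i \<and> i < j \<and> j \<le> k \<and>
        torus_dist N (last_visited N \<omega> i) (last_visited N \<omega> j) \<le> \<delta> * real N)))
    \<le> limsup (\<lambda>N. ereal (B (real N)))"
    by (rule Limsup_mono)
  also have "\<dots> = ereal (M / (M - real k)\<^sup>2 + M\<^sup>2 * (2 * \<delta>) ^ CARD('d))"
    by (rule lim_imp_Limsup[OF _ lim]) simp
  finally show ?thesis .
qed

theorem corollary2p5:
  fixes k :: nat
  assumes "CARD('d::finite) \<ge> 3" and "k \<ge> 2"
  shows "((\<lambda>\<delta>::real. limsup (\<lambda>N. ereal (\<P>(\<omega> in (srw_space N :: 'd srw_sample measure).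
            \<exists>i j. 1 \<le> i \<and> i < j \<and> j \<le> k \<and>
              torus_dist N (last_visited N \<omega> i) (last_visited N \<omega> j) \<le> \<delta> * real N))))
          \<longlongrightarrow> 0) (at 0 within {0<..1/4})"
proof (rule order_tendstoI)
  let ?p = "\<lambda>\<delta> N. \<P>(\<omega> in (srw_space N :: 'd srw_sample measure).
    \<exists>i j. 1 \<le> i \<and> i < j \<and> j \<le> k \<and>
      torus_dist N (last_visited N \<omega> i) (last_visited N \<omega> j) \<le> \<delta> * real N)"
  {
    fix a :: ereal assume a: "a < 0"
    have "0 \<le> limsup (\<lambda>N. ereal (?p \<delta> N))" for \<delta>
      by (rule le_Limsup) (auto intro!: always_eventually measure_nonneg)
    then show "\<forall>\<^sub>F \<delta> in at 0 within {0<..1/4}. a < limsup (\<lambda>N. ereal (?p \<delta> N))"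
      using a by (intro always_eventually) (auto intro: less_le_trans)
  next
    fix a :: ereal assume "a > 0"
    then obtain \<epsilon> where \<epsilon>: "\<epsilon> > 0" "ereal \<epsilon> < a"
      using ereal_dense2[of 0 a] by auto
    \<comment> \<open>M is fixed from \<epsilon> alone before \<delta> is made small, since the
      close-pair term grows like M^2.\<close>
    have "((\<lambda>M. M / (M - real k)\<^sup>2) \<longlongrightarrow> 0) at_top" by real_asymp
    then have "\<forall>\<^sub>F M in at_top. M / (M - real k)\<^sup>2 < \<epsilon> / 2"
      by (rule order_tendstoD) (use \<epsilon> in simp)
    then have "\<forall>\<^sub>F M in at_top. M / (M - real k)\<^sup>2 < \<epsilon> / 2 \<and> M > real k \<and> M \<ge> 1"
      by (intro eventually_conj eventually_gt_at_top eventually_ge_at_top)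
    then obtain M where M: "M / (M - real k)\<^sup>2 < \<epsilon> / 2" "M > real k" "M \<ge> 1"
      using eventually_happens'[OF trivial_limit_at_top_linorder] by blast
    have "((\<lambda>\<delta>. M\<^sup>2 * (2 * \<delta>) ^ CARD('d)) \<longlongrightarrow> M\<^sup>2 * (2 * 0) ^ CARD('d)) (at 0 within {0<..1/4})"
      by (intro tendsto_intros)
    then have "\<forall>\<^sub>F \<delta> in at 0 within {0<..1/4}. M\<^sup>2 * (2 * \<delta>) ^ CARD('d) < \<epsilon> / 2"
      by (rule order_tendstoD) (use \<epsilon> assms(1) in \<open>simp add: power_0_left\<close>)
    moreover have "\<forall>\<^sub>F \<delta> in at 0 within {0<..1/4 :: real}. \<delta> \<in> {0<..1/4}"
      by (simp add: eventually_at_filter)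
    ultimately show "\<forall>\<^sub>F \<delta> in at 0 within {0<..1/4}. limsup (\<lambda>N. ereal (?p \<delta> N)) < a"
    proof eventually_elim
      case (elim \<delta>)
      then have "limsup (\<lambda>N. ereal (?p \<delta> N)) \<le> ereal (M / (M - real k)\<^sup>2 + M\<^sup>2 * (2 * \<delta>) ^ CARD('d))"
        by (intro limsup_prob_close_le assms M) simp
      also have "\<dots> \<le> ereal \<epsilon>" unfolding ereal_less_eq using elim(1) M(1) by linarith
      finally show ?case using \<epsilon>(2) by (rule le_less_trans)
    qed
  }
qed

end
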